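(* Let $\mathbf G$ be any module over a commutative ring $\mathbf A$ with unit, let $\Sigma$ be a simplicial complex, $\sigma\in\Sigma$ a simplex and $\alpha\in\mathrm{Int}(\sigma)$ (with $\alpha=\alpha_0$ if and only if $\sigma=\emptyset_o$). Then there are, for every $i$, the following $\mathbf A$-module isomorphisms, all induced by chain equivalences: $$\hat{\mathbf H}_{i-\#\sigma}(\mathrm{Lk}_\Sigma\sigma;\mathbf G)\cong\hat{\mathbf H}_i(\Sigma,\mathrm{cost}_\Sigma\sigma;\mathbf G)\cong\hat{\mathbf H}_i(|\Sigma|,|\mathrm{cost}_\Sigma\sigma|;\mathbf G)\cong\hat{\mathbf H}_i(|\Sigma|,|\Sigma|\setminus_o\alpha;\mathbf G),$$ $$\hat{\mathbf H}^{i-\#\sigma}(\mathrm{Lk}_\Sigma\sigma;\mathbf G)\cong\hat{\mathbf H}^i(\Sigma,\mathrm{cost}_\Sigma\sigma;\mathbf G)\cong\hat{\mathbf H}^i(|\Sigma|,|\mathrm{cost}_\Sigma\sigma|;\mathbf G)\cong\hat{\mathbf H}^i(|\Sigma|,|\Sigma|\setminus_o\alpha;\mathbf G).$$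
   Context: Complexes. A simplicial complex on a vertex set $V_\Sigma$ is a collection $\Sigma$ of finite, possibly empty, subsets of $V_\Sigma$ (simplices) closed under taking subsets and containing $\{v\}$ for all $v\in V_\Sigma$. The complexes $\emptyset$ and $\{\emptyset_o\}$ are distinct; $\emptyset_o$ denotes the empty set viewed as a simplex. $\#\sigma$ is the cardinality of $\sigma$. $\mathrm{Lk}_\Sigma\sigma=\{\tau\in\Sigma\mid\sigma\cap\tau=\emptyset,\ \sigma\cup\tau\in\Sigma\}$ and $\mathrm{cost}_\Sigma\sigma=\{\tau\in\Sigma\mid\tau\not\supseteq\sigma\}$ (so $\mathrm{Lk}_\Sigma\emptyset_o=\Sigma$, $\mathrm{cost}_\Sigma\emptyset_o=\emptyset$). Simplicial augmental (co)homology. For a complex $\Sigma$ take the simplicial chain complex augmented by the empty simplex: chains in degree $q\ge-1$ are generated by the (ordered) $q$-simplices, with $\emptyset_o$ the generator in degree $-1$; the chains of the complex $\emptyset$ vanish in all degrees. $\hat{\mathbf H}_i(\Sigma_1,\Sigma_2;\mathbf G)$, $\hat{\mathbf H}^i(\Sigma_1,\Sigma_2;\mathbf G)$ are the (co)homology of the quotient chain complex with coefficients in $\mathbf G$, and $\hat{\mathbf H}_i(\Sigma;\mathbf G)=\hat{\mathbf H}_i(\Sigma,\emptyset;\mathbf G)$, likewise for cohomology. Augmented spaces. Objects are $\emptyset$ and spaces $A+\{\wp\}$ (topological sum of a classical space $A$ and an external point $\wp$); $\mathcal F_\wp(A)=A+\{\wp\}$, $\mathcal F(A+\{\wp\})=A$,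 $\mathcal F(\emptyset)=\emptyset$. The augmental singular chain complex $\Delta^\wp(X)$, $X\neq\emptyset$, is generated by the classical singular simplices of $\mathcal F(X)$ in degrees $\ge0$ and by the one map $\{\wp\}\to\{\wp\}$ in degree $-1$, the boundary of each singular $0$-simplex being that generator; $\Delta^\wp(\emptyset)=0$. The groups $\hat{\mathbf H}_i(X_1,X_2;\mathbf G)$, $\hat{\mathbf H}^i(X_1,X_2;\mathbf G)$ are the (co)homology of $\Delta^\wp(X_1)/\Delta^\wp(X_2)$ with coefficients in $\mathbf G$. Realization. $|\emptyset|=\emptyset$. For $\Sigma\ne\emptyset$, $|\Sigma|$ is the set consisting of the function $\alpha_0\equiv0$ on $V_\Sigma$ and all functions $\alpha:V_\Sigma\to[0,1]$ with $\{v\mid\alpha(v)\ne0\}\in\Sigma$ and $\sum_v\alpha(v)=1$, topologized as $|\Sigma\setminus\{\emptyset_o\}|+\{\alpha_0\}$, where the first summand is the classical realization with the weak topology; here $\alpha_0$ plays the role of $\wp$. $\mathrm{Int}(\sigma)=\{\alpha\in|\Sigma|\mid v\in\sigma\Leftrightarrow\alpha(v)\neq0\}$, so $\mathrm{Int}(\emptyset_o)=\{\alpha_0\}$. For a point $x$ of $X\neq\emptyset$: $X\setminus_o x=\emptyset$ if $x=\wp$, and $X\setminus_o x=\mathcal F_\wp(\mathcal F(X)\smallsetminus\{x\})$ otherwise. *)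

theory Defs
  imports "HOL-Homology.Homology" "HOL-Algebra.Module" "HOL-Algebra.Generated_Groups"
begin

section \<open>Module preliminaries\<close>

text \<open>The \<^typ>\<open>('a, 'b) module\<close> record inherits the fields \<^term>\<open>mult\<close> and \<^term>\<open>one\<close> from
  rings; they carry no meaning for a module and are left undefined below.\<close>

definition quot_module :: "('a, 'm) module \<Rightarrow> 'm set \<Rightarrow> ('a, 'm set) module" where
  "quot_module M N =
     \<lparr>carrier = a_rcosets\<^bsub>M\<^esub> N, mult = undefined, one = undefined,
      zero = N, add = set_add M,
      smult = (\<lambda>a X. \<Union>x\<in>X. N +>\<^bsub>M\<^esub> (a \<odot>\<^bsub>M\<^esub> x))\<rparr>"

definition module_iso ::
  "'a ring \<Rightarrow> ('a, 'm) module \<Rightarrow> ('a, 'n) module \<Rightarrow> ('m \<Rightarrow> 'n) set" where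
  "module_iso A M N =
     {h \<in> iso (add_monoid M) (add_monoid N).
        \<forall>a\<in>carrier A. \<forall>x\<in>carrier M. h (a \<odot>\<^bsub>M\<^esub> x) = a \<odot>\<^bsub>N\<^esub> h x}"


section \<open>Chain complexes of abelian groups\<close>

text \<open>The groups are written multiplicatively, as in HOL-Algebra; \<open>bd C q\<close> maps degree \<open>q\<close>
  to degree \<open>q - 1\<close>.\<close>

record 'c ab_complex =
  chains :: "int \<Rightarrow> 'c monoid"
  bd :: "int \<Rightarrow> 'c \<Rightarrow> 'c"

definition cchain_map :: "'c ab_complex \<Rightarrow> 'd ab_complex \<Rightarrow> (int \<Rightarrow> 'c \<Rightarrow> 'd) \<Rightarrow> bool" where
  "cchain_map C D f \<longleftrightarrow>
     (\<forall>q. f q \<in> hom (chains C q) (chains D q) \<and>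
          (\<forall>x\<in>carrier (chains C q). f (q - 1) (bd C q x) = bd D q (f q x)))"

definition cchain_homotopic ::
  "'c ab_complex \<Rightarrow> 'd ab_complex \<Rightarrow> (int \<Rightarrow> 'c \<Rightarrow> 'd) \<Rightarrow> (int \<Rightarrow> 'c \<Rightarrow> 'd) \<Rightarrow> bool" where
  "cchain_homotopic C D f g \<longleftrightarrow>
     (\<exists>h. \<forall>q. h q \<in> hom (chains C q) (chains D (q + 1)) \<and>
          (\<forall>x\<in>carrier (chains C q).
             f q x = g q x \<otimes>\<^bsub>chains D q\<^esub>
                     (bd D (q + 1) (h q x) \<otimes>\<^bsub>chains D q\<^esub> h (q - 1) (bd C q x))))"

definition chain_equivalence ::
  "'c ab_complex \<Rightarrow> 'd ab_complex \<Rightarrow> (int \<Rightarrow> 'c \<Rightarrow> 'd) \<Rightarrow> bool" where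
  "chain_equivalence C D f \<longleftrightarrow>
     cchain_map C D f \<and>
     (\<exists>g. cchain_map D C g \<and>
          cchain_homotopic C C (\<lambda>q. g q \<circ> f q) (\<lambda>q. id) \<and>
          cchain_homotopic D D (\<lambda>q. f q \<circ> g q) (\<lambda>q. id))"

text \<open>A chain map out of \<open>shift n C\<close> is a chain map out of \<open>C\<close> raising degrees by \<open>n\<close>.
  No sign is put on the boundary.\<close>

definition shift :: "int \<Rightarrow> 'c ab_complex \<Rightarrow> 'c ab_complex" where
  "shift n C = \<lparr>chains = (\<lambda>q. chains C (q - n)), bd = (\<lambda>q. bd C (q - n))\<rparr>"

definition free_complex ::
  "(int \<Rightarrow> 'b set) \<Rightarrow> (int \<Rightarrow> ('b \<Rightarrow>\<^sub>0 int) \<Rightarrow> ('b \<Rightarrow>\<^sub>0 int)) \<Rightarrow> ('b \<Rightarrow>\<^sub>0 int) ab_complex" where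
  "free_complex S d = \<lparr>chains = (\<lambda>q. free_Abelian_group (S q)), bd = d\<rparr>"

definition quot_complex :: "'c ab_complex \<Rightarrow> 'c ab_complex \<Rightarrow> 'c set ab_complex" where
  "quot_complex C D =
     \<lparr>chains = (\<lambda>q. chains C q Mod carrier (chains D q)),
      bd = (\<lambda>q X. \<Union>x\<in>X. carrier (chains D (q - 1)) #>\<^bsub>chains C (q - 1)\<^esub> bd C q x)\<rparr>"


section \<open>Coefficients, homology and cohomology\<close>

subsection \<open>Tensor product over the integers of an abelian group and a module\<close>

abbreviation tensor_gens ::
  "'c monoid \<Rightarrow> ('a, 'g) module \<Rightarrow> (('c \<times> 'g) \<Rightarrow>\<^sub>0 int) monoid" where
  "tensor_gens C G \<equiv> free_Abelian_group (carrier C \<times> carrier G)"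

definition tensor_rels :: "'c monoid \<Rightarrow> ('a, 'g) module \<Rightarrow> (('c \<times> 'g) \<Rightarrow>\<^sub>0 int) set" where
  "tensor_rels C G = generate (tensor_gens C G)
     ({frag_of (x \<otimes>\<^bsub>C\<^esub> y, g) - (frag_of (x, g) + frag_of (y, g)) | x y g.
         x \<in> carrier C \<and> y \<in> carrier C \<and> g \<in> carrier G} \<union>
      {frag_of (x, g \<oplus>\<^bsub>G\<^esub> h) - (frag_of (x, g) + frag_of (x, h)) | x g h.
         x \<in> carrier C \<and> g \<in> carrier G \<and> h \<in> carrier G})"

definition tensor ::
  "'c monoid \<Rightarrow> ('a, 'g) module \<Rightarrow> ('a, (('c \<times> 'g) \<Rightarrow>\<^sub>0 int) set) module" where
  "tensor C G =
     \<lparr>carrier = carrier (tensor_gens C G Mod tensor_rels C G),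
      mult = undefined, one = undefined,
      zero = \<one>\<^bsub>tensor_gens C G Mod tensor_rels C G\<^esub>,
      add = mult (tensor_gens C G Mod tensor_rels C G),
      smult = (\<lambda>a X. \<Union>c\<in>X. tensor_rels C G #>\<^bsub>tensor_gens C G\<^esub>
                 frag_extend (\<lambda>(x, g). frag_of (x, a \<odot>\<^bsub>G\<^esub> g)) c)\<rparr>"

text \<open>The map \<open>f \<otimes> id\<close> into \<open>D \<otimes> G\<close>.\<close>

definition tensor_map ::
  "'d monoid \<Rightarrow> ('a, 'g) module \<Rightarrow> ('c \<Rightarrow> 'd) \<Rightarrow>
   (('c \<times> 'g) \<Rightarrow>\<^sub>0 int) set \<Rightarrow> (('d \<times> 'g) \<Rightarrow>\<^sub>0 int) set" where
  "tensor_map D G f X =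
     (\<Union>c\<in>X. tensor_rels D G #>\<^bsub>tensor_gens D G\<^esub>
        frag_extend (\<lambda>(x, g). frag_of (f x, g)) c)"

subsection \<open>The module of homomorphisms from an abelian group to a module\<close>

definition hom_module :: "'c monoid \<Rightarrow> ('a, 'g) module \<Rightarrow> ('a, 'c \<Rightarrow> 'g) module" where
  "hom_module C G =
     \<lparr>carrier = hom C (add_monoid G) \<inter> extensional (carrier C),
      mult = undefined, one = undefined,
      zero = (\<lambda>x\<in>carrier C. \<zero>\<^bsub>G\<^esub>),
      add = (\<lambda>\<phi> \<psi>. \<lambda>x\<in>carrier C. \<phi> x \<oplus>\<^bsub>G\<^esub> \<psi> x),
      smult = (\<lambda>a \<phi>. \<lambda>x\<in>carrier C. a \<odot>\<^bsub>G\<^esub> \<phi> x)\<rparr>"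

subsection \<open>Homology of \<open>C \<otimes> G\<close>\<close>

definition cycles ::
  "'c ab_complex \<Rightarrow> ('a, 'g) module \<Rightarrow> int \<Rightarrow> (('c \<times> 'g) \<Rightarrow>\<^sub>0 int) set set" where
  "cycles C G i =
     {x \<in> carrier (tensor (chains C i) G).
        tensor_map (chains C (i - 1)) G (bd C i) x = \<zero>\<^bsub>tensor (chains C (i - 1)) G\<^esub>}"

definition boundaries ::
  "'c ab_complex \<Rightarrow> ('a, 'g) module \<Rightarrow> int \<Rightarrow> (('c \<times> 'g) \<Rightarrow>\<^sub>0 int) set set" where
  "boundaries C G i =
     tensor_map (chains C i) G (bd C (i + 1)) ` carrier (tensor (chains C (i + 1)) G)"

definition homology ::
  "'c ab_complex \<Rightarrow> ('a, 'g) module \<Rightarrow> int \<Rightarrow> ('a, (('c \<times> 'g) \<Rightarrow>\<^sub>0 int) set set) module" where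
  "homology C G i =
     quot_module (tensor (chains C i) G\<lparr>carrier := cycles C G i\<rparr>) (boundaries C G i)"

text \<open>The map \<open>H\<^sub>i(C; G) \<rightarrow> H\<^sub>i(D; G)\<close> induced by a chain map \<open>f\<close> from \<open>C\<close> to \<open>D\<close>.\<close>

definition homology_map ::
  "'d ab_complex \<Rightarrow> ('a, 'g) module \<Rightarrow> (int \<Rightarrow> 'c \<Rightarrow> 'd) \<Rightarrow> int \<Rightarrow>
   (('c \<times> 'g) \<Rightarrow>\<^sub>0 int) set set \<Rightarrow> (('d \<times> 'g) \<Rightarrow>\<^sub>0 int) set set" where
  "homology_map D G f i X =
     (\<Union>x\<in>X. boundaries D G i +>\<^bsub>tensor (chains D i) G\<^esub> tensor_map (chains D i) G (f i) x)"

subsection \<open>Cohomology, i.e. homology of \<open>Hom(C, G)\<close>\<close>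

definition hom_map :: "'c monoid \<Rightarrow> ('c \<Rightarrow> 'd) \<Rightarrow> ('d \<Rightarrow> 'g) \<Rightarrow> 'c \<Rightarrow> 'g" where
  "hom_map C f \<phi> = (\<lambda>x\<in>carrier C. \<phi> (f x))"

definition cocycles :: "'c ab_complex \<Rightarrow> ('a, 'g) module \<Rightarrow> int \<Rightarrow> ('c \<Rightarrow> 'g) set" where
  "cocycles C G i =
     {\<phi> \<in> carrier (hom_module (chains C i) G).
        hom_map (chains C (i + 1)) (bd C (i + 1)) \<phi> = \<zero>\<^bsub>hom_module (chains C (i + 1)) G\<^esub>}"

definition coboundaries :: "'c ab_complex \<Rightarrow> ('a, 'g) module \<Rightarrow> int \<Rightarrow> ('c \<Rightarrow> 'g) set" where
  "coboundaries C G i =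
     hom_map (chains C i) (bd C i) ` carrier (hom_module (chains C (i - 1)) G)"

definition cohomology ::
  "'c ab_complex \<Rightarrow> ('a, 'g) module \<Rightarrow> int \<Rightarrow> ('a, ('c \<Rightarrow> 'g) set) module" where
  "cohomology C G i =
     quot_module (hom_module (chains C i) G\<lparr>carrier := cocycles C G i\<rparr>) (coboundaries C G i)"

text \<open>The map \<open>H\<^sup>i(D; G) \<rightarrow> H\<^sup>i(C; G)\<close> induced by a chain map \<open>f\<close> from \<open>C\<close> to \<open>D\<close>.\<close>

definition cohomology_map ::
  "'c ab_complex \<Rightarrow> ('a, 'g) module \<Rightarrow> (int \<Rightarrow> 'c \<Rightarrow> 'd) \<Rightarrow> int \<Rightarrow>
   ('d \<Rightarrow> 'g) set \<Rightarrow> ('c \<Rightarrow> 'g) set" where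
  "cohomology_map C G f i X =
     (\<Union>\<phi>\<in>X. coboundaries C G i +>\<^bsub>hom_module (chains C i) G\<^esub> hom_map (chains C i) (f i) \<phi>)"


section \<open>Simplicial complexes\<close>

text \<open>The complexes \<open>{}\<close> and \<open>{{}}\<close> are distinct.\<close>

definition simplicial_complex :: "'v set \<Rightarrow> 'v set set \<Rightarrow> bool" where
  "simplicial_complex V \<Sigma> \<longleftrightarrow>
     (\<forall>s\<in>\<Sigma>. finite s \<and> s \<subseteq> V) \<and>
     (\<forall>s\<in>\<Sigma>. \<forall>t. t \<subseteq> s \<longrightarrow> t \<in> \<Sigma>) \<and>
     (\<forall>v\<in>V. {v} \<in> \<Sigma>)"

definition link :: "'v set set \<Rightarrow> 'v set \<Rightarrow> 'v set set" where
  "link \<Sigma> \<sigma> = {\<tau> \<in> \<Sigma>. \<sigma> \<inter> \<tau> = {} \<and> \<sigma> \<union> \<tau> \<in> \<Sigma>}"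

definition cost :: "'v set set \<Rightarrow> 'v set \<Rightarrow> 'v set set" where
  "cost \<Sigma> \<sigma> = {\<tau> \<in> \<Sigma>. \<not> \<sigma> \<subseteq> \<tau>}"

text \<open>As usual for the ordered chain complex, an ordered \<open>q\<close>-simplex is a sequence of \<open>q + 1\<close> not
  necessarily distinct vertices whose underlying set is a simplex. The empty sequence is the
  simplex \<open>{}\<close> in degree \<open>-1\<close>.\<close>

definition ordered_simplices :: "'v set set \<Rightarrow> int \<Rightarrow> 'v list set" where
  "ordered_simplices \<Sigma> q = {vs. set vs \<in> \<Sigma> \<and> int (length vs) = q + 1}"

definition ordered_boundary :: "('v list \<Rightarrow>\<^sub>0 int) \<Rightarrow> ('v list \<Rightarrow>\<^sub>0 int)" where
  "ordered_boundary =
     frag_extend (\<lambda>vs. \<Sum>k<length vs. frag_cmul ((-1) ^ k) (frag_of (take k vs @ drop (Suc k) vs)))"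

definition simplicial_chains :: "'v set set \<Rightarrow> ('v list \<Rightarrow>\<^sub>0 int) ab_complex" where
  "simplicial_chains \<Sigma> = free_complex (ordered_simplices \<Sigma>) (\<lambda>q. ordered_boundary)"

definition simplicial_pair :: "'v set set \<Rightarrow> 'v set set \<Rightarrow> ('v list \<Rightarrow>\<^sub>0 int) set ab_complex" where
  "simplicial_pair \<Sigma>1 \<Sigma>2 = quot_complex (simplicial_chains \<Sigma>1) (simplicial_chains \<Sigma>2)"


section \<open>Augmented spaces\<close>

text \<open>An augmented space is either the empty topology or a topological sum \<open>A + {p}\<close>; the external
  point \<open>p\<close> is an explicit argument, lying outside \<^term>\<open>topspace A\<close>.\<close>

definition add_point :: "'a \<Rightarrow> 'a topology \<Rightarrow> 'a topology" where
  "add_point p A =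
     topology (\<lambda>U. U \<subseteq> insert p (topspace A) \<and> openin A (U \<inter> topspace A))"

lemma openin_add_point:
  "openin (add_point p A) U \<longleftrightarrow> U \<subseteq> insert p (topspace A) \<and> openin A (U \<inter> topspace A)"
proof -
  have "istopology (\<lambda>U. U \<subseteq> insert p (topspace A) \<and> openin A (U \<inter> topspace A))"
    unfolding istopology_def
  proof (intro conjI allI impI)
    fix S T
    assume "S \<subseteq> insert p (topspace A) \<and> openin A (S \<inter> topspace A)"
      and "T \<subseteq> insert p (topspace A) \<and> openin A (T \<inter> topspace A)"
    moreover have "S \<inter> T \<inter> topspace A = (S \<inter> topspace A) \<inter> (T \<inter> topspace A)" by blast
    ultimately show "openin A (S \<inter> T \<inter> topspace A)" "S \<inter> T \<subseteq> insert p (topspace A)"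
      by auto
  next
    fix K assume K: "\<forall>S\<in>K. S \<subseteq> insert p (topspace A) \<and> openin A (S \<inter> topspace A)"
    then have "openin A (\<Union>((\<lambda>S. S \<inter> topspace A) ` K))" by (intro openin_Union) blast
    then show "openin A (\<Union>K \<inter> topspace A)" by (simp only: Int_Union2)
    show "\<Union>K \<subseteq> insert p (topspace A)" using K by blast
  qed
  then show ?thesis by (simp add: add_point_def)
qed

lemma topspace_add_point: "topspace (add_point p A) = insert p (topspace A)"
proof (rule subset_antisym)
  show "topspace (add_point p A) \<subseteq> insert p (topspace A)"
    using openin_topspace[of "add_point p A"] unfolding openin_add_point by (rule conjunct1)
  have "openin (add_point p A) (insert p (topspace A))"
    by (auto simp: openin_add_point Int_insert_left insert_absorb)
  then show "insert p (topspace A) \<subseteq> topspace (add_point p A)" by (rule openin_subset)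
qed

definition forget_point :: "'a \<Rightarrow> 'a topology \<Rightarrow> 'a topology" where
  "forget_point p X = subtopology X (topspace X - {p})"

definition point_removal :: "'a \<Rightarrow> 'a topology \<Rightarrow> 'a \<Rightarrow> 'a topology" where
  "point_removal p X x =
     (if x = p then discrete_topology {}
      else add_point p
             (subtopology (forget_point p X) (topspace (forget_point p X) - {x})))"

text \<open>The generator in degree \<open>-1\<close>, the map of \<open>{p}\<close> to itself, is encoded as the constant
  function with value \<open>p\<close>, so that it has the same type as the singular simplices.\<close>

definition aug_singular_simplices ::
  "'a \<Rightarrow> 'a topology \<Rightarrow> int \<Rightarrow> ((nat \<Rightarrow> real) \<Rightarrow> 'a) set" where
  "aug_singular_simplices p X q =
     (if topspace X = {} \<or> q < -1 then {}
      else if q = -1 then {\<lambda>_. p}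
      else singular_simplex_set (nat q) (forget_point p X))"

definition aug_singular_boundary :: "'a \<Rightarrow> int \<Rightarrow> 'a chain \<Rightarrow> 'a chain" where
  "aug_singular_boundary p q =
     (if q = 0 then frag_extend (\<lambda>_. frag_of (\<lambda>_. p)) else chain_boundary (nat q))"

definition aug_singular_chains :: "'a \<Rightarrow> 'a topology \<Rightarrow> 'a chain ab_complex" where
  "aug_singular_chains p X =
     free_complex (aug_singular_simplices p X) (aug_singular_boundary p)"

definition aug_singular_pair ::
  "'a \<Rightarrow> 'a topology \<Rightarrow> 'a topology \<Rightarrow> 'a chain set ab_complex" where
  "aug_singular_pair p X1 X2 =
     quot_complex (aug_singular_chains p X1) (aug_singular_chains p X2)"


section \<open>Realization\<close>

text \<open>Functions on the vertex set are extended by zero to the whole type, so that the realization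
  of a subcomplex is literally a subset.\<close>

definition alpha0 :: "'v \<Rightarrow> real" where
  "alpha0 = (\<lambda>_. 0)"

definition classical_points :: "'v set set \<Rightarrow> ('v \<Rightarrow> real) set" where
  "classical_points \<Sigma> =
     {\<alpha>. (\<forall>v. 0 \<le> \<alpha> v \<and> \<alpha> v \<le> 1) \<and> {v. \<alpha> v \<noteq> 0} \<in> \<Sigma> \<and> (\<Sum>v | \<alpha> v \<noteq> 0. \<alpha> v) = 1}"

definition closed_cell :: "'v set set \<Rightarrow> 'v set \<Rightarrow> ('v \<Rightarrow> real) set" where
  "closed_cell \<Sigma> s = {\<alpha> \<in> classical_points \<Sigma>. {v. \<alpha> v \<noteq> 0} \<subseteq> s}"

text \<open>On a closed cell, which has finitely many nonzero coordinates, the topology induced from the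
  product topology is the Euclidean one. The weak topology is coherent with the closed cells.\<close>

definition classical_realization :: "'v set set \<Rightarrow> ('v \<Rightarrow> real) topology" where
  "classical_realization \<Sigma> =
     topology (\<lambda>U. U \<subseteq> classical_points \<Sigma> \<and>
       (\<forall>s\<in>\<Sigma>. openin (subtopology (powertop_real UNIV) (closed_cell \<Sigma> s)) (U \<inter> closed_cell \<Sigma> s)))"

lemma openin_classical_realization:
  "openin (classical_realization \<Sigma>) U \<longleftrightarrow>
     U \<subseteq> classical_points \<Sigma> \<and>
     (\<forall>s\<in>\<Sigma>. openin (subtopology (powertop_real UNIV) (closed_cell \<Sigma> s)) (U \<inter> closed_cell \<Sigma> s))"
proof -
  have *: "istopology (\<lambda>U. U \<subseteq> P \<and> (\<forall>s\<in>I. openin (T s) (U \<inter> K s)))"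
    for P :: "'b set" and I :: "'c set" and T K
    unfolding istopology_def
  proof (intro conjI allI impI ballI)
    fix S S' s
    assume S: "S \<subseteq> P \<and> (\<forall>s\<in>I. openin (T s) (S \<inter> K s))"
      and S': "S' \<subseteq> P \<and> (\<forall>s\<in>I. openin (T s) (S' \<inter> K s))"
    show "S \<inter> S' \<subseteq> P" using S by blast
    assume "s \<in> I"
    then have "openin (T s) ((S \<inter> K s) \<inter> (S' \<inter> K s))" using S S' by (blast intro: openin_Int)
    moreover have "S \<inter> S' \<inter> K s = (S \<inter> K s) \<inter> (S' \<inter> K s)" by blast
    ultimately show "openin (T s) (S \<inter> S' \<inter> K s)" by simp
  next
    fix W s assume W: "\<forall>S\<in>W. S \<subseteq> P \<and> (\<forall>s\<in>I. openin (T s) (S \<inter> K s))"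
    show "\<Union>W \<subseteq> P" using W by blast
    assume "s \<in> I"
    then have "openin (T s) (\<Union>((\<lambda>S. S \<inter> K s) ` W))" using W by (intro openin_Union) blast
    then show "openin (T s) (\<Union>W \<inter> K s)" by (simp only: Int_Union2)
  qed
  show ?thesis
    unfolding classical_realization_def by (simp only: topology_inverse'[OF *])
qed

definition realization :: "'v set set \<Rightarrow> ('v \<Rightarrow> real) topology" where
  "realization \<Sigma> =
     (if \<Sigma> = {} then discrete_topology {} else add_point alpha0 (classical_realization \<Sigma>))"

lemma topspace_realization:
  "topspace (realization \<Sigma>) = (if \<Sigma> = {} then {} else insert alpha0 (classical_points \<Sigma>))"
proof -
  have "topspace (classical_realization \<Sigma>) = classical_points \<Sigma>"
  proof (rule subset_antisym)
    show "topspace (classical_realization \<Sigma>) \<subseteq> classical_points \<Sigma>"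
      using openin_topspace[of "classical_realization \<Sigma>"]
      unfolding openin_classical_realization by (rule conjunct1)
    have "openin (classical_realization \<Sigma>) (classical_points \<Sigma>)"
      unfolding openin_classical_realization
    proof (intro conjI ballI)
      fix s
      have "classical_points \<Sigma> \<inter> closed_cell \<Sigma> s = closed_cell \<Sigma> s"
        by (auto simp: closed_cell_def)
      moreover have "topspace (subtopology (powertop_real UNIV) (closed_cell \<Sigma> s)) = closed_cell \<Sigma> s"
        by simp
      ultimately show "openin (subtopology (powertop_real UNIV) (closed_cell \<Sigma> s))
        (classical_points \<Sigma> \<inter> closed_cell \<Sigma> s)"
        by (metis openin_topspace)
    qed simp
    then show "classical_points \<Sigma> \<subseteq> topspace (classical_realization \<Sigma>)"
      by (rule openin_subset)
  qed
  then show ?thesis by (simp add: realization_def topspace_add_point)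
qed

definition Int_simplex :: "'v set set \<Rightarrow> 'v set \<Rightarrow> ('v \<Rightarrow> real) set" where
  "Int_simplex \<Sigma> \<sigma> = {\<alpha> \<in> topspace (realization \<Sigma>). \<forall>v. v \<in> \<sigma> \<longleftrightarrow> \<alpha> v \<noteq> 0}"

lemma Int_simplex_alpha0: "\<alpha> \<in> Int_simplex \<Sigma> \<sigma> \<Longrightarrow> \<alpha> = alpha0 \<longleftrightarrow> \<sigma> = {}"
  by (auto simp: Int_simplex_def alpha0_def)


section \<open>Augmental homology and cohomology\<close>

abbreviation simplicial_homology where
  "simplicial_homology i \<Sigma>1 \<Sigma>2 G \<equiv> homology (simplicial_pair \<Sigma>1 \<Sigma>2) G i"

abbreviation simplicial_cohomology where
  "simplicial_cohomology i \<Sigma>1 \<Sigma>2 G \<equiv> cohomology (simplicial_pair \<Sigma>1 \<Sigma>2) G i"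

abbreviation singular_homology where
  "singular_homology i p X1 X2 G \<equiv> homology (aug_singular_pair p X1 X2) G i"

abbreviation singular_cohomology where
  "singular_cohomology i p X1 X2 G \<equiv> cohomology (aug_singular_pair p X1 X2) G i"

end

theory Submission
  imports Defs
begin

text \<open>Every arrow is a chain equivalence of pairs of free complexes, so the coefficients enter only at
  the very end: a chain equivalence stays one after tensoring with the module or after taking
  homomorphisms into it, and therefore induces isomorphisms of modules
  (\<open>chain_equivalence_homology\<close>, \<open>chain_equivalence_cohomology\<close>).

  The first equivalence adds the vertices of the simplex one at a time. For one vertex \<open>v\<close>, prefixing
  an ordered simplex of the link with \<open>v\<close> gives a simplex that contains \<open>v\<close>, and the part of a
  boundary from which \<open>v\<close> has disappeared leads back (\<open>vertex_link_equivalence\<close>).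

  The second equivalence connects ordered simplicial chains with singular chains without choosing
  simplicial approximations. Call a singular simplex of the realization small if some vertex
  coordinate is positive on all of it. Pairs of a small simplex \<open>s\<close> and a list of vertices whose
  coordinates are positive on \<open>s\<close> generate a double complex, where both \<open>s\<close> and the list may be the
  augmenting simplex of degree \<open>-1\<close>. Its bottom row is the ordered chain complex and its first
  column is the complex of small chains. Every other row is exact, because the vertices that are
  positive on a given \<open>s\<close> form a full simplex (\<open>rel_acyclic_row\<close>); every other column is exact,
  because the open star of a simplex contracts linearly (\<open>rel_acyclic_column\<close>). So both edges
  include into the total complex by chain equivalences, and small chains are equivalent to all
  chains by subdivision (\<open>rel_acyclic_small\<close>).

  The third equivalence holds because the realization without \<open>\<alpha>\<close> deforms onto the realization of
  the costar: subtract from a point \<open>\<beta>\<close> the largest multiple of \<open>\<alpha>\<close> that leaves the coordinates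
  nonnegative, and rescale (\<open>rel_acyclic_point_removal\<close>).

  Two principles carry these arguments. For free complexes that are bounded below, relative
  acyclicity of an inclusion already yields a chain equivalence, since a contraction can be built on
  generators by induction on the degree (\<open>relative_contraction\<close>). In the weak topology a compact set
  meets only finitely many open cells, so homotopies of singular chains have to be continuous only
  in the coordinates (\<open>realization_deformation_relboundary\<close>).\<close>

section \<open>Maps between quotient groups\<close>

lemma coset_eq_iff:
  assumes "comm_group K" "subgroup H K" "x \<in> carrier K" "y \<in> carrier K"
  shows "H #>\<^bsub>K\<^esub> x = H #>\<^bsub>K\<^esub> y \<longleftrightarrow> (\<exists>h\<in>H. x = h \<otimes>\<^bsub>K\<^esub> y)"
proof -
  interpret comm_group K by fact
  interpret H: subgroup H K by fact
  show ?thesis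
  proof
    assume "H #>\<^bsub>K\<^esub> x = H #>\<^bsub>K\<^esub> y"
    moreover have "x \<in> H #>\<^bsub>K\<^esub> x"
      using assms by (simp add: rcos_self)
    ultimately show "\<exists>h\<in>H. x = h \<otimes>\<^bsub>K\<^esub> y"
      by (auto simp: r_coset_def)
  next
    assume "\<exists>h\<in>H. x = h \<otimes>\<^bsub>K\<^esub> y"
    then have "x \<in> H #>\<^bsub>K\<^esub> y"
      by (auto simp: r_coset_def)
    then show "H #>\<^bsub>K\<^esub> x = H #>\<^bsub>K\<^esub> y"
      using assms repr_independence by metis
  qed
qed

lemma coset_map_eq:
  assumes K: "comm_group K" "subgroup B K" and L: "comm_group L" "subgroup C L"
    and F: "F \<in> hom K L" "F ` B \<subseteq> C" and x: "x \<in> carrier K"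
  shows "(\<Union>y\<in>B #>\<^bsub>K\<^esub> x. C #>\<^bsub>L\<^esub> F y) = C #>\<^bsub>L\<^esub> F x"
proof -
  interpret K: comm_group K by fact
  interpret L: comm_group L by fact
  interpret B: subgroup B K by fact
  have "C #>\<^bsub>L\<^esub> F y = C #>\<^bsub>L\<^esub> F x" if y: "y \<in> B #>\<^bsub>K\<^esub> x" for y
  proof -
    obtain b where b: "b \<in> B" "y = b \<otimes>\<^bsub>K\<^esub> x"
      using y unfolding r_coset_def by blast
    then have "F y = F b \<otimes>\<^bsub>L\<^esub> F x" "F b \<in> C" "y \<in> carrier K"
      using F x by (auto simp: hom_mult)
    then show ?thesis
      using coset_eq_iff[OF L, of "F y" "F x"] hom_in_carrier[OF F(1)] x by blast
  qed
  moreover have "x \<in> B #>\<^bsub>K\<^esub> x"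
    using K.rcos_self[OF x] assms(2) by simp
  ultimately show ?thesis by blast
qed

lemma coset_mult:
  assumes "comm_group K" "subgroup B K" "x \<in> carrier K" "y \<in> carrier K"
  shows "(B #>\<^bsub>K\<^esub> x) <#>\<^bsub>K\<^esub> (B #>\<^bsub>K\<^esub> y) = B #>\<^bsub>K\<^esub> (x \<otimes>\<^bsub>K\<^esub> y)"
proof -
  interpret comm_group K by fact
  have "B \<lhd> K" by (simp add: assms(2) subgroup_imp_normal)
  then show ?thesis
    using assms by (simp add: normal.rcos_sum)
qed

text \<open>In a fixed degree a chain equivalence and its homotopy inverse undo each other on cycles up to
  boundaries. For bare groups this situation covers homology and cohomology at once.\<close>

lemma coset_map_iso:
  assumes K: "comm_group K" "subgroup ZK K" "subgroup BK K" "BK \<subseteq> ZK"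
    and L: "comm_group L" "subgroup ZL L" "subgroup BL L" "BL \<subseteq> ZL"
    and F: "F \<in> hom K L" "F ` ZK \<subseteq> ZL" "F ` BK \<subseteq> BL"
    and H: "H \<in> hom L K" "H ` ZL \<subseteq> ZK" "H ` BL \<subseteq> BK"
    and HF: "\<And>x. x \<in> ZK \<Longrightarrow> \<exists>b\<in>BK. H (F x) = b \<otimes>\<^bsub>K\<^esub> x"
    and FH: "\<And>y. y \<in> ZL \<Longrightarrow> \<exists>b\<in>BL. F (H y) = b \<otimes>\<^bsub>L\<^esub> y"
    and QK: "carrier QK = (\<lambda>x. BK #>\<^bsub>K\<^esub> x) ` ZK" "mult QK = set_mult K"
    and QL: "carrier QL = (\<lambda>x. BL #>\<^bsub>L\<^esub> x) ` ZL" "mult QL = set_mult L"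
  shows "(\<lambda>X. \<Union>x\<in>X. BL #>\<^bsub>L\<^esub> F x)
    \<in> iso QK
          QL"
proof -
  interpret K: comm_group K by fact
  interpret L: comm_group L by fact
  interpret ZK: subgroup ZK K by fact
  interpret ZL: subgroup ZL L by fact
  interpret BK: subgroup BK K by fact
  interpret BL: subgroup BL L by fact
  let ?\<phi> = "\<lambda>X. \<Union>x\<in>X. BL #>\<^bsub>L\<^esub> F x"
  have FK: "F x \<in> carrier L" if "x \<in> carrier K" for x using F(1) that by (rule hom_in_carrier)
  have HK: "H x \<in> carrier K" if "x \<in> carrier L" for x using H(1) that by (rule hom_in_carrier)
  have eq: "?\<phi> (BK #>\<^bsub>K\<^esub> x) = BL #>\<^bsub>L\<^esub> F x" if "x \<in> ZK" for x
    using coset_map_eq[OF K(1,3) L(1,3) F(1,3)] that by simp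
  show ?thesis
  proof (rule isoI)
    show "?\<phi> \<in> hom QK
          QL"
    proof (rule homI)
      fix X assume "X \<in> carrier QK"
      then show "?\<phi> X \<in> carrier QL"
        using F(2) by (auto simp: QK QL eq)
    next
      fix X Y assume "X \<in> carrier QK"
        "Y \<in> carrier QK"
      then obtain x y where xy: "x \<in> ZK" "y \<in> ZK" "X = BK #>\<^bsub>K\<^esub> x" "Y = BK #>\<^bsub>K\<^esub> y" by (auto simp: QK)
      then have "X <#>\<^bsub>K\<^esub> Y = BK #>\<^bsub>K\<^esub> (x \<otimes>\<^bsub>K\<^esub> y)"
        using coset_mult[OF K(1,3)] by simp
      then have "?\<phi> (X <#>\<^bsub>K\<^esub> Y) = BL #>\<^bsub>L\<^esub> F (x \<otimes>\<^bsub>K\<^esub> y)"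
        using eq xy by simp
      also have "\<dots> = BL #>\<^bsub>L\<^esub> (F x \<otimes>\<^bsub>L\<^esub> F y)"
        using xy F(1) by (simp add: hom_mult)
      also have "\<dots> = ?\<phi> X <#>\<^bsub>L\<^esub> ?\<phi> Y"
        using xy FK by (simp only: eq coset_mult[OF L(1,3)] ZK.mem_carrier)
      finally show "?\<phi> (X \<otimes>\<^bsub>QK\<^esub> Y)
        = ?\<phi> X \<otimes>\<^bsub>QL\<^esub> ?\<phi> Y"
        by (simp add: QK QL)
    qed
    have "inj_on ?\<phi> ((\<lambda>x. BK #>\<^bsub>K\<^esub> x) ` ZK)"
    proof (rule inj_onI)
      fix X Y assume "X \<in> (\<lambda>x. BK #>\<^bsub>K\<^esub> x) ` ZK" "Y \<in> (\<lambda>x. BK #>\<^bsub>K\<^esub> x) ` ZK" and e: "?\<phi> X = ?\<phi> Y"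
      then obtain x y where xy: "x \<in> ZK" "y \<in> ZK" "X = BK #>\<^bsub>K\<^esub> x" "Y = BK #>\<^bsub>K\<^esub> y" by auto
      then have "BL #>\<^bsub>L\<^esub> F x = BL #>\<^bsub>L\<^esub> F y"
        using e eq by simp
      then obtain b where b: "b \<in> BL" "F x = b \<otimes>\<^bsub>L\<^esub> F y"
        using coset_eq_iff[OF L(1,3)] FK xy by (meson ZK.mem_carrier)
      then have 1: "H (F x) = H b \<otimes>\<^bsub>K\<^esub> H (F y)"
        using xy FK H(1) by (simp add: hom_mult)
      have hb: "H b \<in> BK" using b H(3) by auto
      obtain u v where u: "u \<in> BK" "H (F x) = u \<otimes>\<^bsub>K\<^esub> x" and v: "v \<in> BK" "H (F y) = v \<otimes>\<^bsub>K\<^esub> y"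
        using HF xy by meson
      have "BK #>\<^bsub>K\<^esub> H (F x) = BK #>\<^bsub>K\<^esub> H (F y)"
        using 1 hb coset_eq_iff[OF K(1,3)] xy FK HK by (meson ZK.mem_carrier)
      moreover have "BK #>\<^bsub>K\<^esub> H (F x) = BK #>\<^bsub>K\<^esub> x" "BK #>\<^bsub>K\<^esub> H (F y) = BK #>\<^bsub>K\<^esub> y"
        using u v xy coset_eq_iff[OF K(1,3)] FK HK by (meson ZK.mem_carrier)+
      ultimately show "X = Y" using xy by simp
    qed
    moreover have "?\<phi> ` ((\<lambda>x. BK #>\<^bsub>K\<^esub> x) ` ZK) = (\<lambda>x. BL #>\<^bsub>L\<^esub> x) ` ZL"
    proof
      show "?\<phi> ` ((\<lambda>x. BK #>\<^bsub>K\<^esub> x) ` ZK) \<subseteq> (\<lambda>x. BL #>\<^bsub>L\<^esub> x) ` ZL"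
        using F(2) by (auto simp: eq)
      show "(\<lambda>x. BL #>\<^bsub>L\<^esub> x) ` ZL \<subseteq> ?\<phi> ` ((\<lambda>x. BK #>\<^bsub>K\<^esub> x) ` ZK)"
      proof clarify
        fix y assume y: "y \<in> ZL"
        then have hy: "H y \<in> ZK" using H(2) by auto
        have "BL #>\<^bsub>L\<^esub> F (H y) = BL #>\<^bsub>L\<^esub> y"
          using FH[OF y] coset_eq_iff[OF L(1,3)] y hy FK by (meson ZL.mem_carrier ZK.mem_carrier)
        then show "BL #>\<^bsub>L\<^esub> y \<in> ?\<phi> ` ((\<lambda>x. BK #>\<^bsub>K\<^esub> x) ` ZK)"
          using eq[OF hy] hy by (metis image_eqI)
      qed
    qed
    ultimately show "bij_betw ?\<phi> (carrier QK)
       (carrier QL)"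
      by (simp add: bij_betw_def QK QL)
  qed
qed

lemma quot_module_iso:
  fixes M :: "('a, 'm) module" and N :: "('a, 'n) module"
  assumes M: "comm_group (add_monoid M)" "subgroup ZM (add_monoid M)" "subgroup BM (add_monoid M)" "BM \<subseteq> ZM"
    and N: "comm_group (add_monoid N)" "subgroup ZN (add_monoid N)" "subgroup BN (add_monoid N)" "BN \<subseteq> ZN"
    and F: "F \<in> hom (add_monoid M) (add_monoid N)" "F ` ZM \<subseteq> ZN" "F ` BM \<subseteq> BN"
    and H: "H \<in> hom (add_monoid N) (add_monoid M)" "H ` ZN \<subseteq> ZM" "H ` BN \<subseteq> BM"
    and HF: "\<And>x. x \<in> ZM \<Longrightarrow> \<exists>b\<in>BM. H (F x) = b \<oplus>\<^bsub>M\<^esub> x"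
    and FH: "\<And>y. y \<in> ZN \<Longrightarrow> \<exists>b\<in>BN. F (H y) = b \<oplus>\<^bsub>N\<^esub> y"
    and smM: "\<And>a. a \<in> carrier A \<Longrightarrow> (\<lambda>x. a \<odot>\<^bsub>M\<^esub> x) \<in> hom (add_monoid M) (add_monoid M)"
      "\<And>a. a \<in> carrier A \<Longrightarrow> (\<lambda>x. a \<odot>\<^bsub>M\<^esub> x) ` ZM \<subseteq> ZM"
      "\<And>a. a \<in> carrier A \<Longrightarrow> (\<lambda>x. a \<odot>\<^bsub>M\<^esub> x) ` BM \<subseteq> BM"
    and smN: "\<And>a. a \<in> carrier A \<Longrightarrow> (\<lambda>x. a \<odot>\<^bsub>N\<^esub> x) \<in> hom (add_monoid N) (add_monoid N)"
      "\<And>a. a \<in> carrier A \<Longrightarrow> (\<lambda>x. a \<odot>\<^bsub>N\<^esub> x) ` BN \<subseteq> BN"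
    and smF: "\<And>a x. a \<in> carrier A \<Longrightarrow> x \<in> ZM \<Longrightarrow> F (a \<odot>\<^bsub>M\<^esub> x) = a \<odot>\<^bsub>N\<^esub> F x"
  shows "(\<lambda>X. \<Union>x\<in>X. BN +>\<^bsub>N\<^esub> F x) \<in>
    module_iso A (quot_module (M\<lparr>carrier := ZM\<rparr>) BM) (quot_module (N\<lparr>carrier := ZN\<rparr>) BN)"
proof -
  have addc: "carrier (add_monoid (quot_module (M'\<lparr>carrier := Z\<rparr>) B)) = (\<lambda>x. B #>\<^bsub>add_monoid M'\<^esub> x) ` Z"
    and addm: "mult (add_monoid (quot_module (M'\<lparr>carrier := Z\<rparr>) B)) = set_mult (add_monoid M')"
    for M' :: "('a, 'k) module" and Z B
    by (auto simp: quot_module_def A_RCOSETS_def RCOSETS_def r_coset_def set_add_def set_mult_def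
        intro!: ext)
  have sm: "a \<odot>\<^bsub>quot_module (M'\<lparr>carrier := Z\<rparr>) B\<^esub> X = (\<Union>x\<in>X. B #>\<^bsub>add_monoid M'\<^esub> (a \<odot>\<^bsub>M'\<^esub> x))"
    for M' :: "('a, 'k) module" and Z B a X
    by (auto simp: quot_module_def a_r_coset_def r_coset_def)
  have rc: "BN +>\<^bsub>N\<^esub> x = BN #>\<^bsub>add_monoid N\<^esub> x" for x
    by (simp add: a_r_coset_def)
  let ?\<phi> = "\<lambda>X. \<Union>x\<in>X. BN #>\<^bsub>add_monoid N\<^esub> F x"
  have iso: "?\<phi> \<in> iso (add_monoid (quot_module (M\<lparr>carrier := ZM\<rparr>) BM)) (add_monoid (quot_module (N\<lparr>carrier := ZN\<rparr>) BN))"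
    
  proof (rule coset_map_iso[OF M N F H])
    show "\<exists>b\<in>BM. H (F x) = b \<otimes>\<^bsub>add_monoid M\<^esub> x" if "x \<in> ZM" for x
      using HF[OF that] by simp
    show "\<exists>b\<in>BN. F (H y) = b \<otimes>\<^bsub>add_monoid N\<^esub> y" if "y \<in> ZN" for y
      using FH[OF that] by simp
  qed (rule addc addm)+
  have ZM: "x \<in> carrier M" if "x \<in> ZM" for x
    using subgroup.mem_carrier[OF M(2) that] by simp
  have Fc: "F x \<in> carrier N" if "x \<in> carrier M" for x
    using hom_in_carrier[OF F(1)] that by simp
  have "?\<phi> (a \<odot>\<^bsub>quot_module (M\<lparr>carrier := ZM\<rparr>) BM\<^esub> X) = a \<odot>\<^bsub>quot_module (N\<lparr>carrier := ZN\<rparr>) BN\<^esub> ?\<phi> X"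
    if a: "a \<in> carrier A" and X: "X \<in> (\<lambda>x. BM #>\<^bsub>add_monoid M\<^esub> x) ` ZM" for a X
  proof -
    obtain x where x: "x \<in> ZM" "X = BM #>\<^bsub>add_monoid M\<^esub> x" using X by blast
    have ax: "a \<odot>\<^bsub>M\<^esub> x \<in> ZM" using smM(2)[OF a] x by auto
    have 1: "a \<odot>\<^bsub>quot_module (M\<lparr>carrier := ZM\<rparr>) BM\<^esub> X = BM #>\<^bsub>add_monoid M\<^esub> (a \<odot>\<^bsub>M\<^esub> x)"
      unfolding sm x(2) by (rule coset_map_eq[OF M(1,3) M(1,3) smM(1)[OF a] smM(3)[OF a]]) (simp add: x ZM)
    have 2: "?\<phi> X = BN #>\<^bsub>add_monoid N\<^esub> F x"
      unfolding x(2) by (rule coset_map_eq[OF M(1,3) N(1,3) F(1,3)]) (simp add: x ZM)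
    have 3: "a \<odot>\<^bsub>quot_module (N\<lparr>carrier := ZN\<rparr>) BN\<^esub> ?\<phi> X = BN #>\<^bsub>add_monoid N\<^esub> (a \<odot>\<^bsub>N\<^esub> F x)"
      unfolding sm 2 by (rule coset_map_eq[OF N(1,3) N(1,3) smN(1)[OF a] smN(2)[OF a]]) (simp add: x ZM Fc)
    have 4: "?\<phi> (BM #>\<^bsub>add_monoid M\<^esub> (a \<odot>\<^bsub>M\<^esub> x)) = BN #>\<^bsub>add_monoid N\<^esub> F (a \<odot>\<^bsub>M\<^esub> x)"
      by (rule coset_map_eq[OF M(1,3) N(1,3) F(1,3)]) (simp add: ax ZM)
    show ?thesis
      using 1 2 3 4 smF[OF a x(1)] by simp
  qed
  moreover have "carrier (quot_module (M\<lparr>carrier := ZM\<rparr>) BM) = (\<lambda>x. BM #>\<^bsub>add_monoid M\<^esub> x) ` ZM"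
    by (auto simp: quot_module_def A_RCOSETS_def RCOSETS_def r_coset_def)
  ultimately show ?thesis
    using iso unfolding module_iso_def rc by simp
qed

section \<open>Functoriality of the tensor product\<close>

text \<open>The tensor product is a quotient of a free group, and all maps on it come from operators on that
  free group. The operators below act on representatives; functoriality is checked there and then
  transported to classes.\<close>

abbreviation tensor_class :: "'c monoid \<Rightarrow> ('a, 'g) module \<Rightarrow> (('c \<times> 'g) \<Rightarrow>\<^sub>0 int) \<Rightarrow> (('c \<times> 'g) \<Rightarrow>\<^sub>0 int) set" where
  "tensor_class C G c \<equiv> tensor_rels C G #>\<^bsub>tensor_gens C G\<^esub> c"

abbreviation tensor_lift :: "('c \<Rightarrow> 'd) \<Rightarrow> (('c \<times> 'g) \<Rightarrow>\<^sub>0 int) \<Rightarrow> (('d \<times> 'g) \<Rightarrow>\<^sub>0 int)" where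
  "tensor_lift f \<equiv> frag_extend (\<lambda>(x, g). frag_of (f x, g))"

abbreviation tensor_scale :: "('a, 'g) module \<Rightarrow> 'a \<Rightarrow> (('c \<times> 'g) \<Rightarrow>\<^sub>0 int) \<Rightarrow> (('c \<times> 'g) \<Rightarrow>\<^sub>0 int)" where
  "tensor_scale G a \<equiv> frag_extend (\<lambda>(x, g). frag_of (x, a \<odot>\<^bsub>G\<^esub> g))"

abbreviation tensor_relators :: "'c monoid \<Rightarrow> ('a, 'g) module \<Rightarrow> (('c \<times> 'g) \<Rightarrow>\<^sub>0 int) set" where
  "tensor_relators C G \<equiv>
     {frag_of (x \<otimes>\<^bsub>C\<^esub> y, g) - (frag_of (x, g) + frag_of (y, g)) | x y g.
         x \<in> carrier C \<and> y \<in> carrier C \<and> g \<in> carrier G} \<union>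
      {frag_of (x, g \<oplus>\<^bsub>G\<^esub> h) - (frag_of (x, g) + frag_of (x, h)) | x g h.
         x \<in> carrier C \<and> g \<in> carrier G \<and> h \<in> carrier G}"

lemma keys_tensor_relator:
  "a \<in> S \<Longrightarrow> b \<in> S \<Longrightarrow> c \<in> S \<Longrightarrow> Poly_Mapping.keys (frag_of a - (frag_of b + frag_of c)) \<subseteq> S"
proof -
  assume "a \<in> S" "b \<in> S" "c \<in> S"
  moreover have "Poly_Mapping.keys (frag_of a - (frag_of b + frag_of c))
      \<subseteq> Poly_Mapping.keys (frag_of a) \<union> (Poly_Mapping.keys (frag_of b) \<union> Poly_Mapping.keys (frag_of c))"
    by (rule order_trans[OF keys_diff Un_mono[OF order_refl keys_add]])
  ultimately show ?thesis by (simp add: subset_iff) blast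
qed

lemma tensor_relatorI:
  "x \<in> carrier C \<Longrightarrow> y \<in> carrier C \<Longrightarrow> g \<in> carrier G \<Longrightarrow>
    frag_of (x \<otimes>\<^bsub>C\<^esub> y, g) - (frag_of (x, g) + frag_of (y, g)) \<in> tensor_relators C G"
  "x \<in> carrier C \<Longrightarrow> g \<in> carrier G \<Longrightarrow> h \<in> carrier G \<Longrightarrow>
    frag_of (x, g \<oplus>\<^bsub>G\<^esub> h) - (frag_of (x, g) + frag_of (x, h)) \<in> tensor_relators C G"
  by blast+

lemma tensor_relators_image:
  assumes "\<And>x y g. x \<in> carrier C \<Longrightarrow> y \<in> carrier C \<Longrightarrow> g \<in> carrier G \<Longrightarrow>
      F (frag_of (x \<otimes>\<^bsub>C\<^esub> y, g) - (frag_of (x, g) + frag_of (y, g))) \<in> T"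
    and "\<And>x g h. x \<in> carrier C \<Longrightarrow> g \<in> carrier G \<Longrightarrow> h \<in> carrier G \<Longrightarrow>
      F (frag_of (x, g \<oplus>\<^bsub>G\<^esub> h) - (frag_of (x, g) + frag_of (x, h))) \<in> T"
  shows "F ` tensor_relators C G \<subseteq> T"
  using assms by blast

lemma tensor_relators_subset:
  assumes "comm_group C" "module A G"
  shows "tensor_relators C G \<subseteq> carrier (tensor_gens C G)"
proof -
  interpret C: comm_group C by fact
  interpret module A G by fact
  have "(\<lambda>r. r) ` tensor_relators C G \<subseteq> carrier (tensor_gens C G)"
    by (rule tensor_relators_image; simp only: carrier_free_Abelian_group_iff; rule keys_tensor_relator; simp)
  then show ?thesis by simp
qed

lemma subgroup_tensor_rels:
  assumes "comm_group C" "module A G"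
  shows "subgroup (tensor_rels C G) (tensor_gens C G)"
  unfolding tensor_rels_def
  by (rule group.generate_is_subgroup[OF group_free_Abelian_group tensor_relators_subset[OF assms]])

lemma tensor_relators_rels: "tensor_relators C G \<subseteq> tensor_rels C G"
  unfolding tensor_rels_def by (rule subsetI, rule generate.incl)

lemma frag_extend_hom:
  assumes "\<And>x. x \<in> S \<Longrightarrow> Poly_Mapping.keys (f x) \<subseteq> T"
  shows "frag_extend f \<in> hom (free_Abelian_group S) (free_Abelian_group T)"
proof (rule homI)
  show "frag_extend f x \<in> carrier (free_Abelian_group T)" if "x \<in> carrier (free_Abelian_group S)" for x
    using that assms keys_frag_extend[of f x] by fastforce
qed (simp add: frag_extend_add)

lemma tensor_rels_image:
  assumes C: "comm_group C" "module A G"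
    and F: "F \<in> hom (tensor_gens C G) (tensor_gens D G)" "F ` tensor_relators C G \<subseteq> tensor_relators D G"
  shows "F ` tensor_rels C G \<subseteq> tensor_rels D G"
proof -
  interpret group_hom "tensor_gens C G" "tensor_gens D G" F
    using F by (simp add: group_hom_def group_hom_axioms_def)
  have "F ` tensor_rels C G = generate (tensor_gens D G) (F ` tensor_relators C G)"
    unfolding tensor_rels_def by (rule generate_img[OF tensor_relators_subset[OF C], symmetric])
  also have "\<dots> \<subseteq> tensor_rels D G"
    unfolding tensor_rels_def by (rule group.mono_generate[OF group_free_Abelian_group F(2)])
  finally show ?thesis .
qed

lemma tensor_lift_hom:
  assumes C: "comm_group C" "module A G" and f: "f \<in> hom C D"
  shows "tensor_lift f \<in> hom (tensor_gens C G) (tensor_gens D G)"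
    and "tensor_lift f ` tensor_rels C G \<subseteq> tensor_rels D G"
proof -
  show 1: "tensor_lift f \<in> hom (tensor_gens C G) (tensor_gens D G)"
    by (rule frag_extend_hom) (use hom_in_carrier[OF f] in auto)
  show "tensor_lift f ` tensor_rels C G \<subseteq> tensor_rels D G"
  proof (rule tensor_rels_image[OF C 1])
    show "tensor_lift f ` tensor_relators C G \<subseteq> tensor_relators D G"
    proof (rule tensor_relators_image)
      fix x y g assume "x \<in> carrier C" "y \<in> carrier C" "g \<in> carrier G"
      then show "tensor_lift f (frag_of (x \<otimes>\<^bsub>C\<^esub> y, g) - (frag_of (x, g) + frag_of (y, g))) \<in> tensor_relators D G"
        using tensor_relatorI(1)[of "f x" D "f y" g G] hom_in_carrier[OF f]
        by (simp only: frag_extend_diff frag_extend_add frag_extend_of prod.case hom_mult[OF f])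
    next
      fix x g h assume "x \<in> carrier C" "g \<in> carrier G" "h \<in> carrier G"
      then show "tensor_lift f (frag_of (x, g \<oplus>\<^bsub>G\<^esub> h) - (frag_of (x, g) + frag_of (x, h))) \<in> tensor_relators D G"
        using tensor_relatorI(2)[of "f x" D g G h] hom_in_carrier[OF f]
        by (simp only: frag_extend_diff frag_extend_add frag_extend_of prod.case)
    qed
  qed
qed

lemma tensor_scale_hom:
  assumes C: "comm_group C" "module A G" and a: "a \<in> carrier A"
  shows "tensor_scale G a \<in> hom (tensor_gens C G) (tensor_gens C G)"
    and "tensor_scale G a ` tensor_rels C G \<subseteq> tensor_rels C G"
proof -
  interpret module A G by fact
  show 1: "tensor_scale G a \<in> hom (tensor_gens C G) (tensor_gens C G)"
    by (rule frag_extend_hom) (use a in auto)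
  show "tensor_scale G a ` tensor_rels C G \<subseteq> tensor_rels C G"
  proof (rule tensor_rels_image[OF C 1])
    show "tensor_scale G a ` tensor_relators C G \<subseteq> tensor_relators C G"
    proof (rule tensor_relators_image)
      fix x y g assume "x \<in> carrier C" "y \<in> carrier C" "g \<in> carrier G"
      then show "tensor_scale G a (frag_of (x \<otimes>\<^bsub>C\<^esub> y, g) - (frag_of (x, g) + frag_of (y, g))) \<in> tensor_relators C G"
        using tensor_relatorI(1)[of x C y "a \<odot>\<^bsub>G\<^esub> g" G] smult_closed[OF a]
        by (simp only: frag_extend_diff frag_extend_add frag_extend_of prod.case)
    next
      fix x g h assume "x \<in> carrier C" "g \<in> carrier G" "h \<in> carrier G"
      then show "tensor_scale G a (frag_of (x, g \<oplus>\<^bsub>G\<^esub> h) - (frag_of (x, g) + frag_of (x, h))) \<in> tensor_relators C G"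
        using tensor_relatorI(2)[of x C "a \<odot>\<^bsub>G\<^esub> g" G "a \<odot>\<^bsub>G\<^esub> h"] smult_closed[OF a]
        by (simp only: frag_extend_diff frag_extend_add frag_extend_of prod.case smult_r_distr[OF a])
    qed
  qed
qed

lemma carrier_tensor: "carrier (tensor C G) = tensor_class C G ` carrier (tensor_gens C G)"
  by (simp add: tensor_def carrier_FactGroup)

lemma comm_group_cong:
  assumes "comm_group K" "carrier L = carrier K" "mult L = mult K" "one L = one K"
  shows "comm_group L"
proof -
  interpret K: comm_group K by fact
  show ?thesis
  proof (rule comm_groupI; unfold assms(2-4))
    show "\<exists>y\<in>carrier K. y \<otimes>\<^bsub>K\<^esub> x = \<one>\<^bsub>K\<^esub>" if "x \<in> carrier K" for x
      using that K.l_inv K.inv_closed by blast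
    show "x \<otimes>\<^bsub>K\<^esub> y = y \<otimes>\<^bsub>K\<^esub> x" if "x \<in> carrier K" "y \<in> carrier K" for x y
      using that by (rule K.m_comm)
  qed (simp_all add: K.m_assoc)
qed

lemma comm_group_tensor:
  assumes "comm_group C" "module A G"
  shows "comm_group (add_monoid (tensor C G))"
  by (rule comm_group_cong[OF comm_group.abelian_FactGroup[OF abelian_free_Abelian_group subgroup_tensor_rels[OF assms]]])
    (simp_all add: tensor_def)

lemma tensor_class_eq:
  assumes "comm_group C" "module A G"
    and "Poly_Mapping.keys c \<subseteq> carrier C \<times> carrier G" "Poly_Mapping.keys d \<subseteq> carrier C \<times> carrier G"
  shows "tensor_class C G c = tensor_class C G d \<longleftrightarrow> c - d \<in> tensor_rels C G"
proof -
  have "(\<exists>h\<in>tensor_rels C G. c = h + d) \<longleftrightarrow> c - d \<in> tensor_rels C G"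
    by (metis add_diff_cancel_right' diff_add_cancel)
  then show ?thesis
    using coset_eq_iff[OF abelian_free_Abelian_group subgroup_tensor_rels[OF assms(1,2)]] assms(3,4)
    by simp
qed

lemma tensor_map_class:
  assumes "comm_group C" "module A G" "comm_group D" "f \<in> hom C D"
    and "Poly_Mapping.keys c \<subseteq> carrier C \<times> carrier G"
  shows "tensor_map D G f (tensor_class C G c) = tensor_class D G (tensor_lift f c)"
  unfolding tensor_map_def
  by (rule coset_map_eq[OF abelian_free_Abelian_group subgroup_tensor_rels[OF assms(1,2)]
        abelian_free_Abelian_group subgroup_tensor_rels[OF assms(3,2)] tensor_lift_hom[OF assms(1,2,4)]])
    (use assms(5) in simp)

lemma tensor_smult_class:
  assumes "comm_group C" "module A G" "a \<in> carrier A"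
    and "Poly_Mapping.keys c \<subseteq> carrier C \<times> carrier G"
  shows "a \<odot>\<^bsub>tensor C G\<^esub> tensor_class C G c = tensor_class C G (tensor_scale G a c)"
proof -
  have "(\<Union>c\<in>tensor_class C G c. tensor_class C G (tensor_scale G a c)) = tensor_class C G (tensor_scale G a c)"
  by (rule coset_map_eq[OF abelian_free_Abelian_group subgroup_tensor_rels[OF assms(1,2)]
        abelian_free_Abelian_group subgroup_tensor_rels[OF assms(1,2)] tensor_scale_hom[OF assms(1-3)]])
    (use assms(4) in simp)
  then show ?thesis by (simp add: tensor_def)
qed

lemma tensor_add_class:
  assumes "comm_group C" "module A G" 
    and "Poly_Mapping.keys c \<subseteq> carrier C \<times> carrier G" "Poly_Mapping.keys d \<subseteq> carrier C \<times> carrier G"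
  shows "tensor_class C G c \<oplus>\<^bsub>tensor C G\<^esub> tensor_class C G d = tensor_class C G (c + d)"
  using coset_mult[OF abelian_free_Abelian_group subgroup_tensor_rels[OF assms(1,2)]] assms(3,4)
  by (simp add: tensor_def)

lemma keys_tensor_lift:
  fixes C :: "'c monoid" and D :: "'d monoid" and G :: "('a, 'g) module"
  assumes "f \<in> hom C D" "Poly_Mapping.keys c \<subseteq> carrier C \<times> carrier G"
  shows "Poly_Mapping.keys (tensor_lift f c) \<subseteq> carrier D \<times> carrier G"
proof -
  have "tensor_lift f \<in> hom (tensor_gens C G) (tensor_gens D G)"
    by (rule frag_extend_hom) (use hom_in_carrier[OF assms(1)] in auto)
  from hom_in_carrier[OF this, of c] show ?thesis
    using assms(2) by simp
qed

lemma keys_tensor_scale: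
  fixes C :: "'c monoid" and G :: "('a, 'g) module"
  assumes "module A G" "a \<in> carrier A" "Poly_Mapping.keys c \<subseteq> carrier C \<times> carrier G"
  shows "Poly_Mapping.keys (tensor_scale G a c) \<subseteq> carrier C \<times> carrier G"
proof -
  interpret module A G by fact
  have "tensor_scale G a \<in> hom (tensor_gens C G) (tensor_gens C G)"
    by (rule frag_extend_hom) (use assms(2) in auto)
  from hom_in_carrier[OF this, of c] show ?thesis
    using assms(3) by simp
qed

lemma tensor_map_hom:
  assumes "comm_group C" "module A G" "comm_group D" "f \<in> hom C D"
  shows "tensor_map D G f \<in> hom (add_monoid (tensor C G)) (add_monoid (tensor D G))"
proof (rule homI)
  fix X assume "X \<in> carrier (add_monoid (tensor C G))"
  then obtain c where c: "X = tensor_class C G c" "Poly_Mapping.keys c \<subseteq> carrier C \<times> carrier G"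
    by (auto simp: carrier_tensor)
  then show "tensor_map D G f X \<in> carrier (add_monoid (tensor D G))"
    using keys_tensor_lift[OF assms(4) c(2)] by (simp add: carrier_tensor tensor_map_class[OF assms])
next
  fix X Y assume "X \<in> carrier (add_monoid (tensor C G))" "Y \<in> carrier (add_monoid (tensor C G))"
  then obtain c d where cd: "X = tensor_class C G c" "Y = tensor_class C G d"
    "Poly_Mapping.keys c \<subseteq> carrier C \<times> carrier G" "Poly_Mapping.keys d \<subseteq> carrier C \<times> carrier G"
    by (auto simp: carrier_tensor)
  have k: "Poly_Mapping.keys (c + d) \<subseteq> carrier C \<times> carrier G"
    using cd(3,4) keys_add[of c d] by blast
  show "tensor_map D G f (X \<otimes>\<^bsub>add_monoid (tensor C G)\<^esub> Y)
    = tensor_map D G f X \<otimes>\<^bsub>add_monoid (tensor D G)\<^esub> tensor_map D G f Y"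
    using cd keys_tensor_lift[OF assms(4) cd(3)] keys_tensor_lift[OF assms(4) cd(4)]
    by (simp add: tensor_add_class[OF assms(1,2)] tensor_add_class[OF assms(3,2)]
        tensor_map_class[OF assms] k frag_extend_add)
qed

lemma tensor_smult_hom:
  assumes "comm_group C" "module A G" "a \<in> carrier A"
  shows "(\<lambda>x. a \<odot>\<^bsub>tensor C G\<^esub> x) \<in> hom (add_monoid (tensor C G)) (add_monoid (tensor C G))"
proof (rule homI)
  fix X assume "X \<in> carrier (add_monoid (tensor C G))"
  then obtain c where c: "X = tensor_class C G c" "Poly_Mapping.keys c \<subseteq> carrier C \<times> carrier G"
    by (auto simp: carrier_tensor)
  then show "a \<odot>\<^bsub>tensor C G\<^esub> X \<in> carrier (add_monoid (tensor C G))"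
    using keys_tensor_scale[OF assms(2,3) c(2)] by (simp add: carrier_tensor tensor_smult_class[OF assms])
next
  fix X Y assume "X \<in> carrier (add_monoid (tensor C G))" "Y \<in> carrier (add_monoid (tensor C G))"
  then obtain c d where cd: "X = tensor_class C G c" "Y = tensor_class C G d"
    "Poly_Mapping.keys c \<subseteq> carrier C \<times> carrier G" "Poly_Mapping.keys d \<subseteq> carrier C \<times> carrier G"
    by (auto simp: carrier_tensor)
  have k: "Poly_Mapping.keys (c + d) \<subseteq> carrier C \<times> carrier G"
    using cd(3,4) keys_add[of c d] by blast
  show "a \<odot>\<^bsub>tensor C G\<^esub> (X \<otimes>\<^bsub>add_monoid (tensor C G)\<^esub> Y)
    = (a \<odot>\<^bsub>tensor C G\<^esub> X) \<otimes>\<^bsub>add_monoid (tensor C G)\<^esub> (a \<odot>\<^bsub>tensor C G\<^esub> Y)"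
    using cd keys_tensor_scale[OF assms(2,3) cd(3)] keys_tensor_scale[OF assms(2,3) cd(4)]
    by (simp add: tensor_add_class[OF assms(1,2)] 
        tensor_smult_class[OF assms] k frag_extend_add)
qed

lemma tensor_map_smult:
  assumes "comm_group C" "module A G" "comm_group D" "f \<in> hom C D" "a \<in> carrier A"
    "X \<in> carrier (tensor C G)"
  shows "tensor_map D G f (a \<odot>\<^bsub>tensor C G\<^esub> X) = a \<odot>\<^bsub>tensor D G\<^esub> tensor_map D G f X"
proof -
  obtain c where c: "X = tensor_class C G c" "Poly_Mapping.keys c \<subseteq> carrier C \<times> carrier G"
    using assms(6) by (auto simp: carrier_tensor)
  have "tensor_lift f (tensor_scale G a c) = tensor_scale G a (tensor_lift f c)"
    by (induction c rule: frag_induction[OF subset_UNIV]) (auto simp: frag_extend_diff)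
  then show ?thesis
    using c keys_tensor_lift[OF assms(4) c(2)] keys_tensor_scale[OF assms(2,5) c(2)]
    by (simp add: tensor_smult_class[OF assms(1,2,5)] tensor_smult_class[OF assms(3,2,5)]
        tensor_map_class[OF assms(1-4)])
qed

lemma tensor_map_compose:
  assumes "comm_group C" "module A G" "comm_group D" "comm_group E" "f \<in> hom C D" "g \<in> hom D E"
    "X \<in> carrier (tensor C G)"
  shows "tensor_map E G g (tensor_map D G f X) = tensor_map E G (\<lambda>x. g (f x)) X"
proof -
  obtain c where c: "X = tensor_class C G c" "Poly_Mapping.keys c \<subseteq> carrier C \<times> carrier G"
    using assms(7) by (auto simp: carrier_tensor)
  have gf: "(\<lambda>x. g (f x)) \<in> hom C E"
    using hom_compose[OF assms(5,6)] by (simp add: o_def)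
  have "tensor_lift g (tensor_lift f c) = tensor_lift (\<lambda>x. g (f x)) c"
    by (induction c rule: frag_induction[OF subset_UNIV]) (auto simp: frag_extend_diff)
  then show ?thesis
    using c keys_tensor_lift[OF assms(5) c(2)]
    by (simp add: tensor_map_class[OF assms(1,2,3,5)] tensor_map_class[OF assms(3,2,4,6)]
        tensor_map_class[OF assms(1,2,4) gf])
qed

lemma tensor_map_cong:
  assumes "comm_group C" "module A G" "comm_group D" "f \<in> hom C D" "f' \<in> hom C D"
    "X \<in> carrier (tensor C G)" "\<And>x. x \<in> carrier C \<Longrightarrow> f x = f' x"
  shows "tensor_map D G f X = tensor_map D G f' X"
proof -
  obtain c where c: "X = tensor_class C G c" "Poly_Mapping.keys c \<subseteq> carrier C \<times> carrier G"
    using assms(6) by (auto simp: carrier_tensor)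
  have "tensor_lift f c = tensor_lift f' c"
    by (rule frag_extend_eq) (use c assms(7) in auto)
  then show ?thesis
    using c by (simp add: tensor_map_class[OF assms(1-4)] tensor_map_class[OF assms(1-3,5)])
qed

lemma tensor_map_id:
  assumes "comm_group C" "module A G" "X \<in> carrier (tensor C G)"
  shows "tensor_map C G (\<lambda>x. x) X = X"
proof -
  obtain c where c: "X = tensor_class C G c" "Poly_Mapping.keys c \<subseteq> carrier C \<times> carrier G"
    using assms(3) by (auto simp: carrier_tensor)
  have "tensor_lift (\<lambda>x. x) c = c"
    by (induction c rule: frag_induction[OF subset_UNIV]) (auto simp: frag_extend_diff)
  then show ?thesis
    using c tensor_map_class[OF assms(1,2,1), of "\<lambda>x. x" c] by (simp add: hom_def)
qed

text \<open>Additivity in the homomorphism, which turns a chain homotopy into a homotopy after tensoring, holds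
  only modulo the bilinearity relations: on a generator the difference is itself a relator.\<close>

lemma tensor_map_add:
  assumes "comm_group C" "module A G" "comm_group D" "f \<in> hom C D" "g \<in> hom C D" "k \<in> hom C D"
    "X \<in> carrier (tensor C G)" "\<And>x. x \<in> carrier C \<Longrightarrow> k x = f x \<otimes>\<^bsub>D\<^esub> g x"
  shows "tensor_map D G k X = tensor_map D G f X \<oplus>\<^bsub>tensor D G\<^esub> tensor_map D G g X"
proof -
  obtain c where c: "X = tensor_class C G c" "Poly_Mapping.keys c \<subseteq> carrier C \<times> carrier G"
    using assms(7) by (auto simp: carrier_tensor)
  interpret R: subgroup "tensor_rels D G" "tensor_gens D G"
    by (rule subgroup_tensor_rels[OF assms(3,2)])
  have "tensor_lift k c - (tensor_lift f c + tensor_lift g c) \<in> tensor_rels D G"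
    (is "?P c \<in> _")
  proof (rule free_Abelian_group_induct[OF c(2), where P = "\<lambda>c. ?P c \<in> tensor_rels D G"])
    show "?P 0 \<in> tensor_rels D G" using R.one_closed by simp
  next
    fix x y assume xy: "?P x \<in> tensor_rels D G" "?P y \<in> tensor_rels D G"
    have "?P x \<otimes>\<^bsub>tensor_gens D G\<^esub> inv\<^bsub>tensor_gens D G\<^esub> ?P y \<in> tensor_rels D G"
      using xy by (intro R.m_closed R.m_inv_closed)
    moreover have "Poly_Mapping.keys (?P y) \<subseteq> carrier D \<times> carrier G"
      using R.mem_carrier[OF xy(2)] by simp
    ultimately show "?P (x - y) \<in> tensor_rels D G"
      by (simp add: frag_extend_diff algebra_simps)
  next
    fix a assume "a \<in> carrier C \<times> carrier G"
    then obtain x g' where a: "a = (x, g')" "x \<in> carrier C" "g' \<in> carrier G" by blast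
    then show "?P (frag_of a) \<in> tensor_rels D G"
      using tensor_relatorI(1)[of "f x" D "g x" g' G, THEN subsetD[OF tensor_relators_rels]]
        hom_in_carrier[OF assms(4)] hom_in_carrier[OF assms(5)]
      by (simp add: assms(8))
  qed
  moreover have "Poly_Mapping.keys (tensor_lift f c + tensor_lift g c) \<subseteq> carrier D \<times> carrier G"
    using keys_tensor_lift[OF assms(4) c(2)] keys_tensor_lift[OF assms(5) c(2)]
    by (meson Un_least keys_add order_trans)
  ultimately show ?thesis
    using c keys_tensor_lift[OF assms(4) c(2)] keys_tensor_lift[OF assms(5) c(2)] keys_tensor_lift[OF assms(6) c(2)]
    by (simp add: tensor_map_class[OF assms(1-4)] tensor_map_class[OF assms(1-3,5)] tensor_map_class[OF assms(1-3,6)]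
        tensor_add_class[OF assms(3,2)] tensor_class_eq[OF assms(3,2)])
qed

lemma tensor_map_one:
  assumes "comm_group C" "module A G" "comm_group D" "X \<in> carrier (tensor C G)"
    "f \<in> hom C D" "\<And>x. x \<in> carrier C \<Longrightarrow> f x = \<one>\<^bsub>D\<^esub>"
  shows "tensor_map D G f X = \<zero>\<^bsub>tensor D G\<^esub>"
proof -
  interpret D: comm_group D by fact
  interpret T: comm_group "add_monoid (tensor D G)" by (rule comm_group_tensor[OF assms(3,2)])
  have in_c: "tensor_map D G f X \<in> carrier (tensor D G)"
    using hom_in_carrier[OF tensor_map_hom[OF assms(1,2,3,5)]] assms(4) by simp
  have "tensor_map D G f X = tensor_map D G f X \<oplus>\<^bsub>tensor D G\<^esub> tensor_map D G f X"
    by (rule tensor_map_add[OF assms(1-3,5,5,5,4)]) (simp add: assms(6))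
  then show ?thesis
    using T.l_cancel_one'[of "tensor_map D G f X" "tensor_map D G f X"] in_c by simp
qed

section \<open>Chain equivalences induce isomorphisms\<close>

text \<open>The record of a complex carries no laws; these are the ones that homology needs.\<close>

definition is_complex :: "'c ab_complex \<Rightarrow> bool" where
  "is_complex C \<longleftrightarrow>
     (\<forall>q. comm_group (chains C q) \<and> bd C q \<in> hom (chains C q) (chains C (q - 1)) \<and>
       (\<forall>x\<in>carrier (chains C q). bd C (q - 1) (bd C q x) = \<one>\<^bsub>chains C (q - 1 - 1)\<^esub>))"

lemma is_complexD:
  assumes "is_complex C"
  shows "comm_group (chains C q)" "bd C q \<in> hom (chains C q) (chains C (q - 1))"
    "bd C (q + 1) \<in> hom (chains C (q + 1)) (chains C q)"
    "x \<in> carrier (chains C q) \<Longrightarrow> bd C (q - 1) (bd C q x) = \<one>\<^bsub>chains C (q - 1 - 1)\<^esub>"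
    "x \<in> carrier (chains C (q + 1)) \<Longrightarrow> bd C q (bd C (q + 1) x) = \<one>\<^bsub>chains C (q - 1)\<^esub>"
proof -
  have *: "comm_group (chains C q)" "bd C q \<in> hom (chains C q) (chains C (q - 1))"
    "x \<in> carrier (chains C q) \<Longrightarrow> bd C (q - 1) (bd C q x) = \<one>\<^bsub>chains C (q - 1 - 1)\<^esub>" for q x
    using assms by (auto simp: is_complex_def)
  show "comm_group (chains C q)" "bd C q \<in> hom (chains C q) (chains C (q - 1))"
    "x \<in> carrier (chains C q) \<Longrightarrow> bd C (q - 1) (bd C q x) = \<one>\<^bsub>chains C (q - 1 - 1)\<^esub>"
    by (rule * | assumption)+
  show "bd C (q + 1) \<in> hom (chains C (q + 1)) (chains C q)"
    "x \<in> carrier (chains C (q + 1)) \<Longrightarrow> bd C q (bd C (q + 1) x) = \<one>\<^bsub>chains C (q - 1)\<^esub>"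
    using *(2)[of "q + 1"] *(3)[of x "q + 1"] by simp_all
qed

lemma subgroup_kernel:
  assumes "comm_group K" "comm_group L" "f \<in> hom K L"
  shows "subgroup {x \<in> carrier K. f x = \<one>\<^bsub>L\<^esub>} K"
proof -
  interpret group_hom K L f
    using assms by (simp add: group_hom_def group_hom_axioms_def comm_group_def)
  show ?thesis using subgroup_kernel by (simp add: kernel_def)
qed

lemma subgroup_image:
  assumes "comm_group K" "comm_group L" "f \<in> hom K L"
  shows "subgroup (f ` carrier K) L"
proof -
  interpret group_hom K L f
    using assms by (simp add: group_hom_def group_hom_axioms_def comm_group_def)
  show ?thesis using img_is_subgroup by simp
qed

lemma hom_module_simps:
  fixes G :: "('a, 'g) module"
  shows "carrier (hom_module K G) = hom K (add_monoid G) \<inter> extensional (carrier K)"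
  "zero (hom_module K G) = (\<lambda>x\<in>carrier K. \<zero>\<^bsub>G\<^esub>)"
  "\<phi> \<oplus>\<^bsub>hom_module K G\<^esub> \<psi> = (\<lambda>x\<in>carrier K. \<phi> x \<oplus>\<^bsub>G\<^esub> \<psi> x)"
  "a \<odot>\<^bsub>hom_module K G\<^esub> \<phi> = (\<lambda>x\<in>carrier K. a \<odot>\<^bsub>G\<^esub> \<phi> x)"
  by (simp_all add: hom_module_def)

lemma hom_module_memD:
  assumes "\<phi> \<in> carrier (hom_module K G)"
  shows "x \<in> carrier K \<Longrightarrow> \<phi> x \<in> carrier G"
    "x \<in> carrier K \<Longrightarrow> y \<in> carrier K \<Longrightarrow> \<phi> (x \<otimes>\<^bsub>K\<^esub> y) = \<phi> x \<oplus>\<^bsub>G\<^esub> \<phi> y"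
    "x \<notin> carrier K \<Longrightarrow> \<phi> x = undefined"
  using assms by (auto simp: hom_module_simps hom_def Pi_def extensional_def)

lemma hom_module_memI:
  assumes "comm_group K" "\<And>x. x \<in> carrier K \<Longrightarrow> \<phi> x \<in> carrier G"
    "\<And>x y. x \<in> carrier K \<Longrightarrow> y \<in> carrier K \<Longrightarrow> \<phi> (x \<otimes>\<^bsub>K\<^esub> y) = \<phi> x \<oplus>\<^bsub>G\<^esub> \<phi> y"
  shows "restrict \<phi> (carrier K) \<in> carrier (hom_module K G)"
proof -
  interpret comm_group K by fact
  show ?thesis
  using assms by (auto simp: hom_module_simps hom_def Pi_def)
qed

lemma hom_map_smult:
  assumes "f \<in> hom K L"
  shows "hom_map K f (a \<odot>\<^bsub>hom_module L G\<^esub> \<phi>) = a \<odot>\<^bsub>hom_module K G\<^esub> hom_map K f \<phi>"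
  using hom_in_carrier[OF assms] by (auto simp: hom_map_def hom_module_simps intro!: restrict_ext)

lemma hom_map_compose:
  assumes "f \<in> hom K L"
  shows "hom_map K f (hom_map L g \<phi>) = hom_map K (\<lambda>x. g (f x)) \<phi>"
  using hom_in_carrier[OF assms] by (auto simp: hom_map_def intro!: restrict_ext)

lemma hom_map_zero:
  assumes "f \<in> hom K L" "\<phi> = \<zero>\<^bsub>hom_module L G\<^esub>"
  shows "hom_map K f \<phi> = \<zero>\<^bsub>hom_module K G\<^esub>"
  using hom_in_carrier[OF assms(1)] assms(2) by (auto simp: hom_map_def hom_module_simps intro!: restrict_ext)

context
  fixes A :: "'a ring" and G :: "('a, 'g) module"
  assumes G: "module A G"
begin

lemma cycles_boundaries:
  assumes C: "is_complex C"
  shows "subgroup (cycles C G i) (add_monoid (tensor (chains C i) G))"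
    and "subgroup (boundaries C G i) (add_monoid (tensor (chains C i) G))"
    and "boundaries C G i \<subseteq> cycles C G i"
proof -
  note D = is_complexD[OF C]
  show "subgroup (cycles C G i) (add_monoid (tensor (chains C i) G))"
    using subgroup_kernel[OF comm_group_tensor[OF D(1) G] comm_group_tensor[OF D(1) G] tensor_map_hom[OF D(1) G D(1) D(2)]]
    by (simp add: cycles_def)
  show "subgroup (boundaries C G i) (add_monoid (tensor (chains C i) G))"
    using subgroup_image[OF comm_group_tensor[OF D(1) G] comm_group_tensor[OF D(1) G] tensor_map_hom[OF D(1) G D(1) D(3)]]
    by (simp add: boundaries_def)
  show "boundaries C G i \<subseteq> cycles C G i"
  proof
    fix y assume "y \<in> boundaries C G i"
    then obtain x where x: "x \<in> carrier (tensor (chains C (i + 1)) G)"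
      "y = tensor_map (chains C i) G (bd C (i + 1)) x"
      by (auto simp: boundaries_def)
    have "y \<in> carrier (tensor (chains C i) G)"
      using hom_in_carrier[OF tensor_map_hom[OF D(1) G D(1) D(3)]] x by simp
    moreover have "tensor_map (chains C (i - 1)) G (bd C i) y
        = tensor_map (chains C (i - 1)) G (\<lambda>x. bd C i (bd C (i + 1) x)) x"
      unfolding x(2) by (rule tensor_map_compose[OF D(1) G D(1) D(1) D(3) D(2) x(1)])
    moreover have "\<dots> = \<zero>\<^bsub>tensor (chains C (i - 1)) G\<^esub>"
      using hom_compose[OF D(3) D(2)]
      by (intro tensor_map_one[OF D(1) G D(1) x(1)]) (simp_all add: D(5) o_def)
    ultimately show "y \<in> cycles C G i" by (simp add: cycles_def)
  qed
qed

lemma cchain_map_cycles: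
  assumes C: "is_complex C" and D: "is_complex D" and f: "cchain_map C D f"
  shows "tensor_map (chains D i) G (f i) ` cycles C G i \<subseteq> cycles D G i"
    and "tensor_map (chains D i) G (f i) ` boundaries C G i \<subseteq> boundaries D G i"
proof -
  note c = is_complexD[OF C] and d = is_complexD[OF D]
  have fh: "f q \<in> hom (chains C q) (chains D q)" for q
    using f by (simp add: cchain_map_def)
  have fc: "f (q - 1) (bd C q x) = bd D q (f q x)" if "x \<in> carrier (chains C q)" for q x
    using f that by (simp add: cchain_map_def)
  have sq: "tensor_map (chains D (q - 1)) G (bd D q) (tensor_map (chains D q) G (f q) x)
    = tensor_map (chains D (q - 1)) G (f (q - 1)) (tensor_map (chains C (q - 1)) G (bd C q) x)"
    if x: "x \<in> carrier (tensor (chains C q) G)" for q x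
  proof -
    have "tensor_map (chains D (q - 1)) G (bd D q) (tensor_map (chains D q) G (f q) x)
      = tensor_map (chains D (q - 1)) G (\<lambda>x. bd D q (f q x)) x"
      by (rule tensor_map_compose[OF c(1) G d(1) d(1) fh d(2) x])
    also have "\<dots> = tensor_map (chains D (q - 1)) G (\<lambda>x. f (q - 1) (bd C q x)) x"
      using hom_compose[OF fh d(2), of q] hom_compose[OF c(2) fh, of q]
      by (intro tensor_map_cong[OF c(1) G d(1) _ _ x]) (auto simp: fc o_def)
    also have "\<dots> = tensor_map (chains D (q - 1)) G (f (q - 1)) (tensor_map (chains C (q - 1)) G (bd C q) x)"
      by (rule tensor_map_compose[OF c(1) G c(1) d(1) c(2) fh x, symmetric])
    finally show ?thesis .
  qed
  have fcar: "tensor_map (chains D q) G (f q) x \<in> carrier (tensor (chains D q) G)"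
    if "x \<in> carrier (tensor (chains C q) G)" for q x
    using hom_in_carrier[OF tensor_map_hom[OF c(1) G d(1) fh]] that by simp
  show "tensor_map (chains D i) G (f i) ` cycles C G i \<subseteq> cycles D G i"
  proof (rule image_subsetI)
    fix x assume x: "x \<in> cycles C G i"
    then have xc: "x \<in> carrier (tensor (chains C i) G)" by (simp add: cycles_def)
    have "tensor_map (chains D (i - 1)) G (f (i - 1)) \<zero>\<^bsub>tensor (chains C (i - 1)) G\<^esub> = \<zero>\<^bsub>tensor (chains D (i - 1)) G\<^esub>"
      using hom_one[OF tensor_map_hom[OF c(1) G d(1) fh]] comm_group_tensor[OF c(1) G] comm_group_tensor[OF d(1) G]
      by (simp add: comm_group_def)
    then show "tensor_map (chains D i) G (f i) x \<in> cycles D G i"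
      using x sq[OF xc] fcar[OF xc] by (simp add: cycles_def)
  qed
  show "tensor_map (chains D i) G (f i) ` boundaries C G i \<subseteq> boundaries D G i"
  proof (rule image_subsetI)
    fix x assume "x \<in> boundaries C G i"
    then obtain y where y: "y \<in> carrier (tensor (chains C (i + 1)) G)" "x = tensor_map (chains C i) G (bd C (i + 1)) y"
      by (auto simp: boundaries_def)
    then show "tensor_map (chains D i) G (f i) x \<in> boundaries D G i"
      using sq[OF y(1)] fcar[OF y(1)] by (auto simp: boundaries_def intro!: image_eqI)
  qed
qed

text \<open>On a cycle the term \<open>h d\<close> of a homotopy vanishes, so the map moves the cycle by a boundary.\<close>

lemma homotopic_id_cycles:
  assumes C: "is_complex C" and f: "cchain_map C C f" and h: "cchain_homotopic C C f (\<lambda>q. id)"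
    and x: "x \<in> cycles C G i"
  shows "\<exists>b\<in>boundaries C G i. tensor_map (chains C i) G (f i) x = b \<oplus>\<^bsub>tensor (chains C i) G\<^esub> x"
proof -
  note c = is_complexD[OF C]
  obtain h where h: "\<And>q. h q \<in> hom (chains C q) (chains C (q + 1))"
    and hf: "\<And>q x. x \<in> carrier (chains C q) \<Longrightarrow> f q x = x \<otimes>\<^bsub>chains C q\<^esub>
           (bd C (q + 1) (h q x) \<otimes>\<^bsub>chains C q\<^esub> h (q - 1) (bd C q x))"
    using h by (auto simp: cchain_homotopic_def)
  have fh: "f q \<in> hom (chains C q) (chains C q)" for q
    using f by (simp add: cchain_map_def)
  interpret K: comm_group "chains C i" by (rule c(1))
  interpret T: comm_group "add_monoid (tensor (chains C i) G)" by (rule comm_group_tensor[OF c(1) G])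
  let ?T = "tensor_map (chains C i) G"
  have xc: "x \<in> carrier (tensor (chains C i) G)" using x by (simp add: cycles_def)
  have h': "h (i - 1) \<in> hom (chains C (i - 1)) (chains C i)" using h[of "i - 1"] by simp
  have dh: "(\<lambda>x. bd C (i + 1) (h i x)) \<in> hom (chains C i) (chains C i)"
    using hom_compose[OF h c(3)] by (simp add: o_def)
  have hd: "(\<lambda>x. h (i - 1) (bd C i x)) \<in> hom (chains C i) (chains C i)"
    using hom_compose[OF c(2) h'] by (simp add: o_def)
  have sm: "(\<lambda>x. bd C (i + 1) (h i x) \<otimes>\<^bsub>chains C i\<^esub> h (i - 1) (bd C i x)) \<in> hom (chains C i) (chains C i)"
    using K.hom_group_mult[OF dh hd] by simp
  have idh: "(\<lambda>x. x) \<in> hom (chains C i) (chains C i)" by (simp add: hom_def)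
  have "?T (f i) x = ?T (\<lambda>x. x) x \<oplus>\<^bsub>tensor (chains C i) G\<^esub>
      ?T (\<lambda>x. bd C (i + 1) (h i x) \<otimes>\<^bsub>chains C i\<^esub> h (i - 1) (bd C i x)) x"
    by (rule tensor_map_add[OF c(1) G c(1) idh sm fh xc]) (rule hf)
  moreover have "?T (\<lambda>x. bd C (i + 1) (h i x) \<otimes>\<^bsub>chains C i\<^esub> h (i - 1) (bd C i x)) x
    = ?T (\<lambda>x. bd C (i + 1) (h i x)) x \<oplus>\<^bsub>tensor (chains C i) G\<^esub> ?T (\<lambda>x. h (i - 1) (bd C i x)) x"
    by (rule tensor_map_add[OF c(1) G c(1) dh hd sm xc]) simp
  moreover have "?T (\<lambda>x. h (i - 1) (bd C i x)) x = \<zero>\<^bsub>tensor (chains C i) G\<^esub>"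
  proof -
    have "?T (\<lambda>x. h (i - 1) (bd C i x)) x = ?T (h (i - 1)) (tensor_map (chains C (i - 1)) G (bd C i) x)"
      by (rule tensor_map_compose[OF c(1) G c(1) c(1) c(2) h' xc, symmetric])
    also have "\<dots> = ?T (h (i - 1)) \<zero>\<^bsub>tensor (chains C (i - 1)) G\<^esub>"
      using x by (simp add: cycles_def)
    also have "\<dots> = \<zero>\<^bsub>tensor (chains C i) G\<^esub>"
      using hom_one[OF tensor_map_hom[OF c(1) G c(1) h']] comm_group_tensor[OF c(1) G]
      by (simp add: comm_group_def)
    finally show ?thesis .
  qed
  moreover have "?T (\<lambda>x. bd C (i + 1) (h i x)) x = ?T (bd C (i + 1)) (tensor_map (chains C (i + 1)) G (h i) x)"
    by (rule tensor_map_compose[OF c(1) G c(1) c(1) h c(3) xc, symmetric])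
  moreover have hx: "tensor_map (chains C (i + 1)) G (h i) x \<in> carrier (tensor (chains C (i + 1)) G)"
    using hom_in_carrier[OF tensor_map_hom[OF c(1) G c(1) h]] xc by simp
  moreover have "?T (bd C (i + 1)) (tensor_map (chains C (i + 1)) G (h i) x) \<in> carrier (tensor (chains C i) G)"
    using hom_in_carrier[OF tensor_map_hom[OF c(1) G c(1) c(3)]] hx by simp
  ultimately have "?T (f i) x = ?T (bd C (i + 1)) (tensor_map (chains C (i + 1)) G (h i) x) \<oplus>\<^bsub>tensor (chains C i) G\<^esub> x"
    using tensor_map_id[OF c(1) G xc] xc T.r_one T.m_comm by simp
  then show ?thesis using hx by (auto simp: boundaries_def)
qed

theorem chain_equivalence_homology:
  assumes C: "is_complex C" and D: "is_complex D" and f: "chain_equivalence C D f"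
  shows "homology_map D G f i \<in> module_iso A (homology C G i) (homology D G i)"
proof -
  note c = is_complexD[OF C] and d = is_complexD[OF D]
  obtain g where fm: "cchain_map C D f" and gm: "cchain_map D C g"
    and gf: "cchain_homotopic C C (\<lambda>q. g q \<circ> f q) (\<lambda>q. id)"
    and fg: "cchain_homotopic D D (\<lambda>q. f q \<circ> g q) (\<lambda>q. id)"
    using f by (auto simp: chain_equivalence_def)
  have fh: "f q \<in> hom (chains C q) (chains D q)" and gh: "g q \<in> hom (chains D q) (chains C q)" for q
    using fm gm by (simp_all add: cchain_map_def)
  have gfm: "cchain_map C C (\<lambda>q. g q \<circ> f q)"
    using fm gm hom_in_carrier[OF fh] hom_compose[OF fh gh] by (simp add: cchain_map_def)
  have fgm: "cchain_map D D (\<lambda>q. f q \<circ> g q)"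
    using fm gm hom_in_carrier[OF gh] hom_compose[OF gh fh] by (simp add: cchain_map_def)
  note cyc = cycles_boundaries
  have sm1: "(\<lambda>x. a \<odot>\<^bsub>tensor (chains B i) G\<^esub> x) \<in> hom (add_monoid (tensor (chains B i) G)) (add_monoid (tensor (chains B i) G))"
    and sm2: "(\<lambda>x. a \<odot>\<^bsub>tensor (chains B i) G\<^esub> x) ` cycles B G i \<subseteq> cycles B G i"
    and sm3: "(\<lambda>x. a \<odot>\<^bsub>tensor (chains B i) G\<^esub> x) ` boundaries B G i \<subseteq> boundaries B G i"
    if B: "is_complex B" and a: "a \<in> carrier A" for B :: "'k ab_complex" and a i
  proof -
    note b = is_complexD[OF B]
    show 1: "(\<lambda>x. a \<odot>\<^bsub>tensor (chains B i) G\<^esub> x) \<in> hom (add_monoid (tensor (chains B i) G)) (add_monoid (tensor (chains B i) G))" for i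
      by (rule tensor_smult_hom[OF b(1) G a])
    have ac: "a \<odot>\<^bsub>tensor (chains B i) G\<^esub> x \<in> carrier (tensor (chains B i) G)"
      if "x \<in> carrier (tensor (chains B i) G)" for i x
      using hom_in_carrier[OF 1] that by simp
    show "(\<lambda>x. a \<odot>\<^bsub>tensor (chains B i) G\<^esub> x) ` cycles B G i \<subseteq> cycles B G i"
    proof (rule image_subsetI)
      fix x assume x: "x \<in> cycles B G i"
      have "a \<odot>\<^bsub>tensor (chains B (i - 1)) G\<^esub> \<zero>\<^bsub>tensor (chains B (i - 1)) G\<^esub> = \<zero>\<^bsub>tensor (chains B (i - 1)) G\<^esub>"
        using hom_one[OF 1] comm_group_tensor[OF b(1) G] by (simp add: comm_group_def)
      then show "a \<odot>\<^bsub>tensor (chains B i) G\<^esub> x \<in> cycles B G i"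
        using x tensor_map_smult[OF b(1) G b(1) b(2) a] ac by (simp add: cycles_def)
    qed
    show "(\<lambda>x. a \<odot>\<^bsub>tensor (chains B i) G\<^esub> x) ` boundaries B G i \<subseteq> boundaries B G i"
      using tensor_map_smult[OF b(1) G b(1) b(3) a, symmetric] ac
      by (auto simp: boundaries_def)
  qed
  show ?thesis
    unfolding homology_def homology_map_def
  proof (rule quot_module_iso)
    show "tensor_map (chains D i) G (f i) \<in> hom (add_monoid (tensor (chains C i) G)) (add_monoid (tensor (chains D i) G))"
      by (rule tensor_map_hom[OF c(1) G d(1) fh])
    show "tensor_map (chains C i) G (g i) \<in> hom (add_monoid (tensor (chains D i) G)) (add_monoid (tensor (chains C i) G))"
      by (rule tensor_map_hom[OF d(1) G c(1) gh])
    show "\<exists>b\<in>boundaries C G i. tensor_map (chains C i) G (g i) (tensor_map (chains D i) G (f i) x)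
        = b \<oplus>\<^bsub>tensor (chains C i) G\<^esub> x" if x: "x \<in> cycles C G i" for x
      using homotopic_id_cycles[OF C gfm gf x] x tensor_map_compose[OF c(1) G d(1) c(1) fh gh, where X = x]
      by (simp add: cycles_def o_def)
    show "\<exists>b\<in>boundaries D G i. tensor_map (chains D i) G (f i) (tensor_map (chains C i) G (g i) x)
        = b \<oplus>\<^bsub>tensor (chains D i) G\<^esub> x" if x: "x \<in> cycles D G i" for x
      using homotopic_id_cycles[OF D fgm fg x] x tensor_map_compose[OF d(1) G c(1) d(1) gh fh, where X = x]
      by (simp add: cycles_def o_def)
    show "tensor_map (chains D i) G (f i) (a \<odot>\<^bsub>tensor (chains C i) G\<^esub> x)
        = a \<odot>\<^bsub>tensor (chains D i) G\<^esub> tensor_map (chains D i) G (f i) x"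
      if "a \<in> carrier A" "x \<in> cycles C G i" for a x
      by (rule tensor_map_smult[OF c(1) G d(1) fh]) (use that in \<open>auto simp: cycles_def\<close>)
  qed (rule cyc[OF C] cyc[OF D] cchain_map_cycles[OF C D fm] cchain_map_cycles[OF D C gm]
      comm_group_tensor[OF c(1) G] comm_group_tensor[OF d(1) G] sm1[OF C] sm2[OF C] sm3[OF C] sm1[OF D] sm3[OF D]
      | assumption)+
qed


lemma comm_group_hom_module:
  assumes K: "comm_group K"
  shows "comm_group (add_monoid (hom_module K G))"
proof -
  interpret module A G by (rule G)
  interpret K: comm_group K by fact
  show ?thesis
  proof (rule comm_groupI)
    fix \<phi> \<psi> assume "\<phi> \<in> carrier (add_monoid (hom_module K G))" "\<psi> \<in> carrier (add_monoid (hom_module K G))"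
    then have *: "\<phi> \<in> carrier (hom_module K G)" "\<psi> \<in> carrier (hom_module K G)" by simp_all
    note m = hom_module_memD[OF *(1)] hom_module_memD[OF *(2)]
    have "(\<lambda>x\<in>carrier K. \<phi> x \<oplus>\<^bsub>G\<^esub> \<psi> x) \<in> carrier (hom_module K G)"
      by (rule hom_module_memI[OF K]) (simp_all add: m M.a_ac)
    then show "\<phi> \<otimes>\<^bsub>add_monoid (hom_module K G)\<^esub> \<psi> \<in> carrier (add_monoid (hom_module K G))"
      by (simp add: hom_module_simps)
    show "\<phi> \<otimes>\<^bsub>add_monoid (hom_module K G)\<^esub> \<psi> = \<psi> \<otimes>\<^bsub>add_monoid (hom_module K G)\<^esub> \<phi>"
      by (auto simp: hom_module_simps m M.a_comm intro!: restrict_ext)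
    fix \<theta> assume "\<theta> \<in> carrier (add_monoid (hom_module K G))"
    then have **: "\<theta> \<in> carrier (hom_module K G)" by simp
    show "\<phi> \<otimes>\<^bsub>add_monoid (hom_module K G)\<^esub> \<psi> \<otimes>\<^bsub>add_monoid (hom_module K G)\<^esub> \<theta>
      = \<phi> \<otimes>\<^bsub>add_monoid (hom_module K G)\<^esub> (\<psi> \<otimes>\<^bsub>add_monoid (hom_module K G)\<^esub> \<theta>)"
      by (auto simp: hom_module_simps m hom_module_memD[OF **] M.a_assoc intro!: restrict_ext)
  next
    have "(\<lambda>x\<in>carrier K. \<zero>\<^bsub>G\<^esub>) \<in> carrier (hom_module K G)"
      by (rule hom_module_memI[OF K]) simp_all
    then show "\<one>\<^bsub>add_monoid (hom_module K G)\<^esub> \<in> carrier (add_monoid (hom_module K G))"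
      by (simp add: hom_module_simps)
  next
    fix \<phi> assume "\<phi> \<in> carrier (add_monoid (hom_module K G))"
    then have *: "\<phi> \<in> carrier (hom_module K G)" by simp
    note m = hom_module_memD[OF *]
    show "\<one>\<^bsub>add_monoid (hom_module K G)\<^esub> \<otimes>\<^bsub>add_monoid (hom_module K G)\<^esub> \<phi> = \<phi>"
      using m by (auto simp: hom_module_simps)
    have "(\<lambda>x\<in>carrier K. \<ominus>\<^bsub>G\<^esub> \<phi> x) \<in> carrier (hom_module K G)"
      by (rule hom_module_memI[OF K]) (simp_all add: m M.minus_add)
    moreover have "(\<lambda>x\<in>carrier K. \<ominus>\<^bsub>G\<^esub> \<phi> x) \<otimes>\<^bsub>add_monoid (hom_module K G)\<^esub> \<phi> = \<one>\<^bsub>add_monoid (hom_module K G)\<^esub>"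
      by (auto simp: hom_module_simps m M.l_neg intro!: restrict_ext)
    ultimately show "\<exists>\<psi>\<in>carrier (add_monoid (hom_module K G)).
        \<psi> \<otimes>\<^bsub>add_monoid (hom_module K G)\<^esub> \<phi> = \<one>\<^bsub>add_monoid (hom_module K G)\<^esub>"
      by auto
  qed
qed

lemma hom_map_hom:
  assumes K: "comm_group K" and f: "f \<in> hom K L"
  shows "hom_map K f \<in> hom (add_monoid (hom_module L G)) (add_monoid (hom_module K G))"
proof -
  interpret K: comm_group K by fact
  have fc: "f x \<in> carrier L" if "x \<in> carrier K" for x using hom_in_carrier[OF f that] .
  show ?thesis
  proof (rule homI)
    fix \<phi> assume "\<phi> \<in> carrier (add_monoid (hom_module L G))"
    then have *: "\<phi> \<in> carrier (hom_module L G)" by simp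
    have "hom_map K f \<phi> \<in> carrier (hom_module K G)"
      unfolding hom_map_def
      by (rule hom_module_memI[OF K]) (simp_all add: hom_module_memD[OF *] fc hom_mult[OF f])
    then show "hom_map K f \<phi> \<in> carrier (add_monoid (hom_module K G))" by simp
  next
    fix \<phi> \<psi>
    show "hom_map K f (\<phi> \<otimes>\<^bsub>add_monoid (hom_module L G)\<^esub> \<psi>) =
      hom_map K f \<phi> \<otimes>\<^bsub>add_monoid (hom_module K G)\<^esub> hom_map K f \<psi>"
      by (auto simp: hom_map_def hom_module_simps fc intro!: restrict_ext)
  qed
qed

lemma hom_smult_hom:
  assumes K: "comm_group K" and a: "a \<in> carrier A"
  shows "(\<lambda>x. a \<odot>\<^bsub>hom_module K G\<^esub> x) \<in> hom (add_monoid (hom_module K G)) (add_monoid (hom_module K G))"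
proof -
  interpret module A G by (rule G)
  interpret K: comm_group K by fact
  show ?thesis
  proof (rule homI)
    fix \<phi> assume "\<phi> \<in> carrier (add_monoid (hom_module K G))"
    then have *: "\<phi> \<in> carrier (hom_module K G)" by simp
    have "(\<lambda>x\<in>carrier K. a \<odot>\<^bsub>G\<^esub> \<phi> x) \<in> carrier (hom_module K G)"
      by (rule hom_module_memI[OF K]) (simp_all add: hom_module_memD[OF *] a smult_r_distr)
    then show "a \<odot>\<^bsub>hom_module K G\<^esub> \<phi> \<in> carrier (add_monoid (hom_module K G))"
      by (simp add: hom_module_simps)
  next
    fix \<phi> \<psi> assume "\<phi> \<in> carrier (add_monoid (hom_module K G))" "\<psi> \<in> carrier (add_monoid (hom_module K G))"
    then have *: "\<phi> \<in> carrier (hom_module K G)" "\<psi> \<in> carrier (hom_module K G)" by simp_all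
    show "a \<odot>\<^bsub>hom_module K G\<^esub> (\<phi> \<otimes>\<^bsub>add_monoid (hom_module K G)\<^esub> \<psi>) =
      (a \<odot>\<^bsub>hom_module K G\<^esub> \<phi>) \<otimes>\<^bsub>add_monoid (hom_module K G)\<^esub> (a \<odot>\<^bsub>hom_module K G\<^esub> \<psi>)"
      by (auto simp: hom_module_simps smult_r_distr a hom_module_memD[OF *(1)] hom_module_memD[OF *(2)] intro!: restrict_ext)
  qed
qed

lemma cocycles_coboundaries:
  assumes C: "is_complex C"
  shows "subgroup (cocycles C G i) (add_monoid (hom_module (chains C i) G))"
    and "subgroup (coboundaries C G i) (add_monoid (hom_module (chains C i) G))"
    and "coboundaries C G i \<subseteq> cocycles C G i"
proof -
  interpret module A G by (rule G)
  note D = is_complexD[OF C]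
  show "subgroup (cocycles C G i) (add_monoid (hom_module (chains C i) G))"
    using subgroup_kernel[OF comm_group_hom_module[OF D(1)] comm_group_hom_module[OF D(1)] hom_map_hom[OF D(1) D(3)]]
    by (simp add: cocycles_def)
  show "subgroup (coboundaries C G i) (add_monoid (hom_module (chains C i) G))"
    using subgroup_image[OF comm_group_hom_module[OF D(1)] comm_group_hom_module[OF D(1)] hom_map_hom[OF D(1) D(2)]]
    by (simp add: coboundaries_def)
  show "coboundaries C G i \<subseteq> cocycles C G i"
  proof
    fix \<phi> assume "\<phi> \<in> coboundaries C G i"
    then obtain \<psi> where \<psi>: "\<psi> \<in> carrier (hom_module (chains C (i - 1)) G)"
      "\<phi> = hom_map (chains C i) (bd C i) \<psi>"
      by (auto simp: coboundaries_def)
    have "\<phi> \<in> carrier (hom_module (chains C i) G)"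
      using hom_in_carrier[OF hom_map_hom[OF D(1) D(2)]] \<psi> by simp
    moreover have "hom_map (chains C (i + 1)) (bd C (i + 1)) \<phi> = \<zero>\<^bsub>hom_module (chains C (i + 1)) G\<^esub>"
    proof -
      interpret K: comm_group "chains C (i - 1)" by (rule D(1))
      have "\<psi> \<one>\<^bsub>chains C (i - 1)\<^esub> \<oplus>\<^bsub>G\<^esub> \<psi> \<one>\<^bsub>chains C (i - 1)\<^esub> = \<psi> \<one>\<^bsub>chains C (i - 1)\<^esub>"
        using hom_module_memD(2)[OF \<psi>(1), of "\<one>\<^bsub>chains C (i - 1)\<^esub>" "\<one>\<^bsub>chains C (i - 1)\<^esub>"] by simp
      then have "\<psi> \<one>\<^bsub>chains C (i - 1)\<^esub> = \<zero>\<^bsub>G\<^esub>"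
        using hom_module_memD(1)[OF \<psi>(1), of "\<one>\<^bsub>chains C (i - 1)\<^esub>"]
        by (metis M.add.l_cancel_one' K.one_closed)
      then show ?thesis
        unfolding \<psi>(2) hom_map_compose[OF D(3)]
        by (auto simp: hom_map_def hom_module_simps D(5) intro!: restrict_ext)
    qed
    ultimately show "\<phi> \<in> cocycles C G i" by (simp add: cocycles_def)
  qed
qed

lemma cchain_map_cocycles:
  assumes C: "is_complex C" and D: "is_complex D" and f: "cchain_map C D f"
  shows "hom_map (chains C i) (f i) ` cocycles D G i \<subseteq> cocycles C G i"
    and "hom_map (chains C i) (f i) ` coboundaries D G i \<subseteq> coboundaries C G i"
proof -
  note c = is_complexD[OF C] and d = is_complexD[OF D]
  have fh: "f q \<in> hom (chains C q) (chains D q)" for q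
    using f by (simp add: cchain_map_def)
  have fc: "f (q - 1) (bd C q x) = bd D q (f q x)" if "x \<in> carrier (chains C q)" for q x
    using f that by (simp add: cchain_map_def)
  have sq: "hom_map (chains C q) (bd C q) (hom_map (chains C (q - 1)) (f (q - 1)) \<phi>)
     = hom_map (chains C q) (f q) (hom_map (chains D q) (bd D q) \<phi>)" for q \<phi>
    unfolding hom_map_compose[OF c(2)] hom_map_compose[OF fh]
    by (auto simp: hom_map_def fc intro!: restrict_ext)
  have fcar: "hom_map (chains C q) (f q) \<phi> \<in> carrier (hom_module (chains C q) G)"
    if "\<phi> \<in> carrier (hom_module (chains D q) G)" for q \<phi>
    using hom_in_carrier[OF hom_map_hom[OF c(1) fh]] that by simp
  show "hom_map (chains C i) (f i) ` cocycles D G i \<subseteq> cocycles C G i"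
  proof (rule image_subsetI)
    fix \<phi> assume "\<phi> \<in> cocycles D G i"
    then have 1: "\<phi> \<in> carrier (hom_module (chains D i) G)"
      and 2: "hom_map (chains D (i + 1)) (bd D (i + 1)) \<phi> = \<zero>\<^bsub>hom_module (chains D (i + 1)) G\<^esub>"
      by (simp_all add: cocycles_def)
    have "hom_map (chains C (i + 1)) (bd C (i + 1)) (hom_map (chains C i) (f i) \<phi>)
        = \<zero>\<^bsub>hom_module (chains C (i + 1)) G\<^esub>"
      using sq[of "i + 1" \<phi>] hom_map_zero[OF fh 2] by simp
    then show "hom_map (chains C i) (f i) \<phi> \<in> cocycles C G i"
      using fcar[OF 1] by (simp add: cocycles_def)
  qed
  show "hom_map (chains C i) (f i) ` coboundaries D G i \<subseteq> coboundaries C G i"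
    using sq[of i, symmetric] fcar by (auto simp: coboundaries_def)
qed

text \<open>Dually, the term \<open>d h\<close> is killed by a cocycle and \<open>h d\<close> contributes a coboundary.\<close>

lemma homotopic_id_cocycles:
  assumes C: "is_complex C" and f: "cchain_map C C f" and h: "cchain_homotopic C C f (\<lambda>q. id)"
    and \<phi>: "\<phi> \<in> cocycles C G i"
  shows "\<exists>b\<in>coboundaries C G i. hom_map (chains C i) (f i) \<phi> = b \<oplus>\<^bsub>hom_module (chains C i) G\<^esub> \<phi>"
proof -
  interpret module A G by (rule G)
  note c = is_complexD[OF C]
  obtain h where h: "\<And>q. h q \<in> hom (chains C q) (chains C (q + 1))"
    and hf: "\<And>q x. x \<in> carrier (chains C q) \<Longrightarrow> f q x = x \<otimes>\<^bsub>chains C q\<^esub>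
           (bd C (q + 1) (h q x) \<otimes>\<^bsub>chains C q\<^esub> h (q - 1) (bd C q x))"
    using h by (auto simp: cchain_homotopic_def)
  interpret K: comm_group "chains C i" by (rule c(1))
  have h': "h (i - 1) \<in> hom (chains C (i - 1)) (chains C i)" using h[of "i - 1"] by simp
  have \<phi>c: "\<phi> \<in> carrier (hom_module (chains C i) G)" using \<phi> by (simp add: cocycles_def)
  note m = hom_module_memD[OF \<phi>c]
  have z: "\<phi> (bd C (i + 1) y) = \<zero>\<^bsub>G\<^esub>" if "y \<in> carrier (chains C (i + 1))" for y
  proof -
    have "hom_map (chains C (i + 1)) (bd C (i + 1)) \<phi> = \<zero>\<^bsub>hom_module (chains C (i + 1)) G\<^esub>"
      using \<phi> by (simp add: cocycles_def)
    from fun_cong[OF this, of y] show ?thesis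
      using that by (simp add: hom_map_def hom_module_simps)
  qed
  define b where "b = hom_map (chains C i) (bd C i) (hom_map (chains C (i - 1)) (h (i - 1)) \<phi>)"
  have "b \<in> coboundaries C G i"
    using hom_in_carrier[OF hom_map_hom[OF c(1) h']] \<phi>c by (simp add: b_def coboundaries_def)
  moreover have "hom_map (chains C i) (f i) \<phi> = b \<oplus>\<^bsub>hom_module (chains C i) G\<^esub> \<phi>"
    unfolding b_def hom_map_compose[OF c(2)]
  proof (auto simp: hom_map_def hom_module_simps intro!: restrict_ext)
    fix x assume x: "x \<in> carrier (chains C i)"
    have 1: "bd C (i + 1) (h i x) \<in> carrier (chains C i)" "h (i - 1) (bd C i x) \<in> carrier (chains C i)"
      "h i x \<in> carrier (chains C (i + 1))"
      using hom_in_carrier[OF h x] hom_in_carrier[OF c(3)] hom_in_carrier[OF h' hom_in_carrier[OF c(2) x]] by auto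
    show "\<phi> (f i x) = \<phi> (h (i - 1) (bd C i x)) \<oplus>\<^bsub>G\<^esub> \<phi> x"
      using x 1 by (simp add: hf m z M.a_comm)
  qed
  ultimately show ?thesis by blast
qed

theorem chain_equivalence_cohomology:
  assumes C: "is_complex C" and D: "is_complex D" and f: "chain_equivalence C D f"
  shows "cohomology_map C G f i \<in> module_iso A (cohomology D G i) (cohomology C G i)"
proof -
  note c = is_complexD[OF C] and d = is_complexD[OF D]
  obtain g where fm: "cchain_map C D f" and gm: "cchain_map D C g"
    and gf: "cchain_homotopic C C (\<lambda>q. g q \<circ> f q) (\<lambda>q. id)"
    and fg: "cchain_homotopic D D (\<lambda>q. f q \<circ> g q) (\<lambda>q. id)"
    using f by (auto simp: chain_equivalence_def)
  have fh: "f q \<in> hom (chains C q) (chains D q)" and gh: "g q \<in> hom (chains D q) (chains C q)" for q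
    using fm gm by (simp_all add: cchain_map_def)
  have gfm: "cchain_map C C (\<lambda>q. g q \<circ> f q)"
    using fm gm hom_in_carrier[OF fh] hom_compose[OF fh gh] by (simp add: cchain_map_def)
  have fgm: "cchain_map D D (\<lambda>q. f q \<circ> g q)"
    using fm gm hom_in_carrier[OF gh] hom_compose[OF gh fh] by (simp add: cchain_map_def)
  note cyc = cocycles_coboundaries
  have sm1: "(\<lambda>x. a \<odot>\<^bsub>hom_module (chains B i) G\<^esub> x) \<in> hom (add_monoid (hom_module (chains B i) G)) (add_monoid (hom_module (chains B i) G))"
    and sm2: "(\<lambda>x. a \<odot>\<^bsub>hom_module (chains B i) G\<^esub> x) ` cocycles B G i \<subseteq> cocycles B G i"
    and sm3: "(\<lambda>x. a \<odot>\<^bsub>hom_module (chains B i) G\<^esub> x) ` coboundaries B G i \<subseteq> coboundaries B G i"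
    if B: "is_complex B" and a: "a \<in> carrier A" for B :: "'k ab_complex" and a i
  proof -
    note b = is_complexD[OF B]
    show 1: "(\<lambda>x. a \<odot>\<^bsub>hom_module (chains B i) G\<^esub> x) \<in> hom (add_monoid (hom_module (chains B i) G)) (add_monoid (hom_module (chains B i) G))" for i
      by (rule hom_smult_hom[OF b(1) a])
    have ac: "a \<odot>\<^bsub>hom_module (chains B i) G\<^esub> x \<in> carrier (hom_module (chains B i) G)"
      if "x \<in> carrier (hom_module (chains B i) G)" for i x
      using hom_in_carrier[OF 1] that by simp
    have "a \<odot>\<^bsub>hom_module (chains B i) G\<^esub> \<zero>\<^bsub>hom_module (chains B i) G\<^esub> = \<zero>\<^bsub>hom_module (chains B i) G\<^esub>" for i
        using hom_one[OF 1] comm_group_hom_module[OF b(1)] by (simp add: comm_group_def)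
    then show "(\<lambda>x. a \<odot>\<^bsub>hom_module (chains B i) G\<^esub> x) ` cocycles B G i \<subseteq> cocycles B G i"
      using ac by (auto simp: cocycles_def hom_map_smult[OF b(3)])
    show "(\<lambda>x. a \<odot>\<^bsub>hom_module (chains B i) G\<^esub> x) ` coboundaries B G i \<subseteq> coboundaries B G i"
      using ac by (auto simp: coboundaries_def hom_map_smult[OF b(2), symmetric])
  qed
  show ?thesis
    unfolding cohomology_def cohomology_map_def
  proof (rule quot_module_iso)
    show "hom_map (chains C i) (f i) \<in> hom (add_monoid (hom_module (chains D i) G)) (add_monoid (hom_module (chains C i) G))"
      by (rule hom_map_hom[OF c(1) fh])
    show "hom_map (chains D i) (g i) \<in> hom (add_monoid (hom_module (chains C i) G)) (add_monoid (hom_module (chains D i) G))"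
      by (rule hom_map_hom[OF d(1) gh])
    show "\<exists>b\<in>coboundaries D G i. hom_map (chains D i) (g i) (hom_map (chains C i) (f i) x)
        = b \<oplus>\<^bsub>hom_module (chains D i) G\<^esub> x" if x: "x \<in> cocycles D G i" for x
      using homotopic_id_cocycles[OF D fgm fg x] by (simp only: o_def hom_map_compose[OF gh])
    show "\<exists>b\<in>coboundaries C G i. hom_map (chains C i) (f i) (hom_map (chains D i) (g i) x)
        = b \<oplus>\<^bsub>hom_module (chains C i) G\<^esub> x" if x: "x \<in> cocycles C G i" for x
      using homotopic_id_cocycles[OF C gfm gf x] by (simp only: o_def hom_map_compose[OF fh])
    show "hom_map (chains C i) (f i) (a \<odot>\<^bsub>hom_module (chains D i) G\<^esub> x)
        = a \<odot>\<^bsub>hom_module (chains C i) G\<^esub> hom_map (chains C i) (f i) x"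
      if "a \<in> carrier A" "x \<in> cocycles D G i" for a x
      by (rule hom_map_smult[OF fh])
  qed (rule cyc[OF C] cyc[OF D] cchain_map_cocycles[OF C D fm] cchain_map_cocycles[OF D C gm]
      comm_group_hom_module[OF c(1)] comm_group_hom_module[OF d(1)] sm1[OF C] sm1[OF D] sm2[OF D] sm3[OF D] sm3[OF C]
      | assumption)+
qed

end


section \<open>Composition and inversion of chain equivalences\<close>

lemma cchain_map_compose:
  assumes "cchain_map C D f" "cchain_map D E g"
  shows "cchain_map C E (\<lambda>q. g q \<circ> f q)"
  unfolding cchain_map_def
proof (intro allI conjI ballI)
  fix q
  show "g q \<circ> f q \<in> hom (chains C q) (chains E q)"
    using assms by (auto simp: cchain_map_def intro: hom_compose)
  fix x assume "x \<in> carrier (chains C q)"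
  then show "(g (q - 1) \<circ> f (q - 1)) (bd C q x) = bd E q ((g q \<circ> f q) x)"
    using assms hom_in_carrier[of "f q" "chains C q" "chains D q" x] by (simp add: cchain_map_def)
qed

text \<open>Inserting a self-map homotopic to the identity between a map and its homotopy inverse changes
  nothing up to homotopy; with \<open>u\<close> the middle pair of a composite this is transitivity.\<close>

lemma cchain_homotopic_compose_id:
  assumes C: "is_complex C" and D: "is_complex D"
    and f: "cchain_map C D f" and g: "cchain_map D C g"
    and gf: "cchain_homotopic C C (\<lambda>q. g q \<circ> f q) (\<lambda>q. id)"
    and u1: "cchain_homotopic D D u (\<lambda>q. id)"
  shows "cchain_homotopic C C (\<lambda>q. g q \<circ> (u q \<circ> f q)) (\<lambda>q. id)"
proof -
  note c = is_complexD[OF C] and d = is_complexD[OF D]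
  obtain h where h: "\<And>q. h q \<in> hom (chains C q) (chains C (q + 1))"
    and hf: "\<And>q x. x \<in> carrier (chains C q) \<Longrightarrow> g q (f q x) = x \<otimes>\<^bsub>chains C q\<^esub>
           (bd C (q + 1) (h q x) \<otimes>\<^bsub>chains C q\<^esub> h (q - 1) (bd C q x))"
    using gf by (auto simp: cchain_homotopic_def)
  obtain k where k: "\<And>q. k q \<in> hom (chains D q) (chains D (q + 1))"
    and kf: "\<And>q x. x \<in> carrier (chains D q) \<Longrightarrow> u q x = x \<otimes>\<^bsub>chains D q\<^esub>
           (bd D (q + 1) (k q x) \<otimes>\<^bsub>chains D q\<^esub> k (q - 1) (bd D q x))"
    using u1 by (auto simp: cchain_homotopic_def)
  have fh: "f q \<in> hom (chains C q) (chains D q)" and gh: "g q \<in> hom (chains D q) (chains C q)" for q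
    using f g by (simp_all add: cchain_map_def)
  have fb: "f (q - 1) (bd C q x) = bd D q (f q x)" if "x \<in> carrier (chains C q)" for q x
    using f that by (simp add: cchain_map_def)
  have gb: "g q (bd D (q + 1) x) = bd C (q + 1) (g (q + 1) x)" if "x \<in> carrier (chains D (q + 1))" for q x
  proof -
    have "g (q + 1 - 1) (bd D (q + 1) x) = bd C (q + 1) (g (q + 1) x)"
      using g that unfolding cchain_map_def by blast
    then show ?thesis by simp
  qed
  let ?e = "\<lambda>q x. h q x \<otimes>\<^bsub>chains C (q + 1)\<^esub> g (q + 1) (k q (f q x))"
  show ?thesis
    unfolding cchain_homotopic_def
  proof (intro exI[of _ ?e] allI conjI ballI)
    fix q
    interpret K1: comm_group "chains C (q + 1)" by (rule c(1))
    interpret K: comm_group "chains C q" by (rule c(1))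
    have "(\<lambda>x. g (q + 1) (k q (f q x))) \<in> hom (chains C q) (chains C (q + 1))"
      using hom_compose[OF fh hom_compose[OF k gh]] by (simp add: o_def)
    then show "?e q \<in> hom (chains C q) (chains C (q + 1))"
      using K1.hom_group_mult[OF h] by simp
    fix x assume x: "x \<in> carrier (chains C q)"
    have k': "k (q - 1) \<in> hom (chains D (q - 1)) (chains D q)"
      and h': "h (q - 1) \<in> hom (chains C (q - 1)) (chains C q)"
      using k[of "q - 1"] h[of "q - 1"] by simp_all
    define y where "y = f q x"
    have y: "y \<in> carrier (chains D q)" using hom_in_carrier[OF fh x] by (simp add: y_def)
    have ky: "k q y \<in> carrier (chains D (q + 1))" using hom_in_carrier[OF k y] .
    have dy: "bd D q y \<in> carrier (chains D (q - 1))" using hom_in_carrier[OF d(2) y] .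
    have kby: "k (q - 1) (bd D q y) \<in> carrier (chains D q)" using hom_in_carrier[OF k' dy] .
    have bky: "bd D (q + 1) (k q y) \<in> carrier (chains D q)" using hom_in_carrier[OF d(3) ky] .
    have bx: "bd C q x \<in> carrier (chains C (q - 1))" using hom_in_carrier[OF c(2) x] .
    have hbx: "h (q - 1) (bd C q x) \<in> carrier (chains C q)" using hom_in_carrier[OF h' bx] .
    have hx: "h q x \<in> carrier (chains C (q + 1))" using hom_in_carrier[OF h x] .
    have bhx: "bd C (q + 1) (h q x) \<in> carrier (chains C q)" using hom_in_carrier[OF c(3) hx] .
    have gky: "g (q + 1) (k q y) \<in> carrier (chains C (q + 1))" using hom_in_carrier[OF gh ky] .
    have bgky: "bd C (q + 1) (g (q + 1) (k q y)) \<in> carrier (chains C q)" using hom_in_carrier[OF c(3) gky] .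
    have gkby: "g q (k (q - 1) (bd D q y)) \<in> carrier (chains C q)" using hom_in_carrier[OF gh kby] .
    interpret L: comm_group "chains D q" by (rule d(1))
    have "g q (u q y) = g q y \<otimes>\<^bsub>chains C q\<^esub>
        (bd C (q + 1) (g (q + 1) (k q y)) \<otimes>\<^bsub>chains C q\<^esub> g q (k (q - 1) (bd D q y)))"
      by (simp add: kf[OF y] hom_mult[OF gh] y bky kby gb[OF ky])
    also have "g q y = x \<otimes>\<^bsub>chains C q\<^esub> (bd C (q + 1) (h q x) \<otimes>\<^bsub>chains C q\<^esub> h (q - 1) (bd C q x))"
      unfolding y_def by (rule hf[OF x])
    finally have "g q (u q y) = x \<otimes>\<^bsub>chains C q\<^esub>
      ((bd C (q + 1) (h q x) \<otimes>\<^bsub>chains C q\<^esub> bd C (q + 1) (g (q + 1) (k q y))) \<otimes>\<^bsub>chains C q\<^esub>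
       (h (q - 1) (bd C q x) \<otimes>\<^bsub>chains C q\<^esub> g q (k (q - 1) (bd D q y))))"
      using x bhx hbx bgky gkby by (simp add: K.m_ac)
    then show "(g q \<circ> (u q \<circ> f q)) x = id x \<otimes>\<^bsub>chains C q\<^esub>
        (bd C (q + 1) (?e q x) \<otimes>\<^bsub>chains C q\<^esub> ?e (q - 1) (bd C q x))"
      using hom_mult[OF c(3) hx gky] fb[OF x] by (simp add: y_def)
  qed
qed

lemma chain_equivalence_trans:
  assumes C: "is_complex C" and D: "is_complex D" and E: "is_complex E"
    and f: "chain_equivalence C D f" and f': "chain_equivalence D E f'"
  shows "chain_equivalence C E (\<lambda>q. f' q \<circ> f q)"
proof -
  obtain g where g: "cchain_map C D f" "cchain_map D C g"
    "cchain_homotopic C C (\<lambda>q. g q \<circ> f q) (\<lambda>q. id)" "cchain_homotopic D D (\<lambda>q. f q \<circ> g q) (\<lambda>q. id)"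
    using f by (auto simp: chain_equivalence_def)
  obtain g' where g': "cchain_map D E f'" "cchain_map E D g'"
    "cchain_homotopic D D (\<lambda>q. g' q \<circ> f' q) (\<lambda>q. id)" "cchain_homotopic E E (\<lambda>q. f' q \<circ> g' q) (\<lambda>q. id)"
    using f' by (auto simp: chain_equivalence_def)
  have "cchain_homotopic C C (\<lambda>q. g q \<circ> ((g' q \<circ> f' q) \<circ> f q)) (\<lambda>q. id)"
    by (rule cchain_homotopic_compose_id[OF C D g(1,2) g(3) g'(3)])
  moreover have "cchain_homotopic E E (\<lambda>q. f' q \<circ> ((f q \<circ> g q) \<circ> g' q)) (\<lambda>q. id)"
    by (rule cchain_homotopic_compose_id[OF E D g'(2,1) g'(4) g(4)])
  ultimately show ?thesis
    using cchain_map_compose[OF g(1) g'(1)] cchain_map_compose[OF g'(2) g(2)]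
    unfolding chain_equivalence_def by (intro conjI exI[of _ "\<lambda>q. g q \<circ> g' q"]) (simp_all add: o_assoc)
qed

lemma chain_equivalence_sym:
  assumes "chain_equivalence C D f"
  obtains g where "chain_equivalence D C g"
  using assms by (auto simp: chain_equivalence_def)

lemma is_complex_shift:
  assumes "is_complex C" shows "is_complex (shift n C)"
proof -
  have e: "q - 1 - n = q - n - 1" "q - 1 - 1 - n = q - n - 1 - 1" for q by simp_all
  show ?thesis
    using is_complexD(1,2,4)[OF assms]
    unfolding is_complex_def shift_def ab_complex.simps e by blast
qed

section \<open>Pairs of free complexes\<close>

definition frag_on :: "'b set \<Rightarrow> ('b \<Rightarrow>\<^sub>0 int) set" where
  "frag_on S = {c. Poly_Mapping.keys c \<subseteq> S}"

lemma carrier_free_eq: "carrier (free_Abelian_group S) = frag_on S"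
  by (auto simp: frag_on_def)

lemma frag_on_zero [simp]: "0 \<in> frag_on S"
  by (simp add: frag_on_def)

lemma frag_on_of [simp]: "frag_of x \<in> frag_on S \<longleftrightarrow> x \<in> S"
  by (simp add: frag_on_def)

lemma frag_on_add: "a \<in> frag_on S \<Longrightarrow> b \<in> frag_on S \<Longrightarrow> a + b \<in> frag_on S"
  using keys_add[of a b] by (auto simp: frag_on_def)

lemma frag_on_diff: "a \<in> frag_on S \<Longrightarrow> b \<in> frag_on S \<Longrightarrow> a - b \<in> frag_on S"
  using keys_diff[of a b] by (auto simp: frag_on_def)

lemma frag_on_minus: "a \<in> frag_on S \<Longrightarrow> - a \<in> frag_on S"
  by (simp add: frag_on_def)

lemma frag_on_cmul: "a \<in> frag_on S \<Longrightarrow> frag_cmul n a \<in> frag_on S"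
  using keys_cmul[of n a] by (auto simp: frag_on_def)

lemma frag_on_sum: "(\<And>i. i \<in> I \<Longrightarrow> f i \<in> frag_on S) \<Longrightarrow> sum f I \<in> frag_on S"
  by (induction I rule: infinite_finite_induct) (auto intro: frag_on_add)

lemma frag_on_mono: "S \<subseteq> T \<Longrightarrow> a \<in> frag_on S \<Longrightarrow> a \<in> frag_on T"
  by (auto simp: frag_on_def)

lemma frag_on_Int: "a \<in> frag_on (S \<inter> T) \<longleftrightarrow> a \<in> frag_on S \<and> a \<in> frag_on T"
  by (auto simp: frag_on_def)

lemma frag_on_empty: "a \<in> frag_on {} \<Longrightarrow> a = 0"
  by (simp add: frag_on_def)

lemma additive_frag_extend: "additive (frag_extend f)"
  by (simp add: additive_def frag_extend_add)

lemma additive_compose: "additive f \<Longrightarrow> additive g \<Longrightarrow> additive (\<lambda>x. f (g x))"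
  by (simp add: additive_def)

lemma additive_plus: "additive f \<Longrightarrow> additive g \<Longrightarrow> additive (\<lambda>x. f x + g x :: 'b::ab_group_add)"
  by (simp add: additive_def algebra_simps)

lemma additive_minus: "additive f \<Longrightarrow> additive g \<Longrightarrow> additive (\<lambda>x. f x - g x :: 'b::ab_group_add)"
  by (simp add: additive_def algebra_simps)

lemma additive_uminus: "additive f \<Longrightarrow> additive (\<lambda>x. - f x :: 'b::ab_group_add)"
  by (simp add: additive_def)

lemma additive_id: "additive (\<lambda>x :: 'b::ab_group_add. x)"
  by (simp add: additive_def)

lemma frag_on_induct [consumes 1, case_names zero diff of]:
  assumes "c \<in> frag_on S" "P 0"
    "\<And>x y. x \<in> frag_on S \<Longrightarrow> y \<in> frag_on S \<Longrightarrow> P x \<Longrightarrow> P y \<Longrightarrow> P (x - y)"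
    "\<And>a. a \<in> S \<Longrightarrow> P (frag_of a)"
  shows "P c"
  using assms free_Abelian_group_induct[of c S P] by (simp add: frag_on_def)

lemma frag_on_hom:
  assumes f: "additive f" and gen: "\<And>s. s \<in> S \<Longrightarrow> f (frag_of s) \<in> frag_on T" and c: "c \<in> frag_on S"
  shows "f c \<in> frag_on T"
  using c
proof (induction c rule: frag_on_induct)
  case zero show ?case using additive.zero[OF f] by simp
next
  case (diff x y) then show ?case by (simp add: additive.diff[OF f] frag_on_diff)
next
  case (of a) then show ?case by (rule gen)
qed

lemma additive_eq_on:
  assumes f: "additive f" and g: "additive g" and gen: "\<And>s. s \<in> S \<Longrightarrow> f (frag_of s) = g (frag_of s)"
    and c: "c \<in> frag_on S"
  shows "f c = g c"
  using c
proof (induction c rule: frag_on_induct)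
  case zero show ?case using additive.zero[OF f] additive.zero[OF g] by simp
next
  case (diff x y) then show ?case by (simp add: additive.diff[OF f] additive.diff[OF g])
next
  case (of a) then show ?case by (rule gen)
qed

text \<open>The boundary operator is defined on an ambient free group, so a complex is only a graded set of
  generators closed under it, and inclusions of complexes are inclusions of sets.\<close>

definition free_cx :: "(int \<Rightarrow> 'b set) \<Rightarrow> (int \<Rightarrow> ('b \<Rightarrow>\<^sub>0 int) \<Rightarrow> ('b \<Rightarrow>\<^sub>0 int)) \<Rightarrow> bool" where
  "free_cx S d \<longleftrightarrow> (\<forall>q. additive (d q)) \<and>
     (\<forall>q. \<forall>c\<in>frag_on (S q). d q c \<in> frag_on (S (q - 1)) \<and> d (q - 1) (d q c) = 0)"

abbreviation pair_cx where
  "pair_cx S T d \<equiv> quot_complex (free_complex S d) (free_complex T d)"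

lemma free_cxD:
  assumes "free_cx S d"
  shows "additive (d q)" "c \<in> frag_on (S q) \<Longrightarrow> d q c \<in> frag_on (S (q - 1))"
    "c \<in> frag_on (S q) \<Longrightarrow> d (q - 1) (d q c) = 0"
    "c \<in> frag_on (S (q + 1)) \<Longrightarrow> d (q + 1) c \<in> frag_on (S q)"
    "c \<in> frag_on (S (q + 1)) \<Longrightarrow> d q (d (q + 1) c) = 0"
proof -
  have *: "additive (d q)" "c \<in> frag_on (S q) \<Longrightarrow> d q c \<in> frag_on (S (q - 1))"
    "c \<in> frag_on (S q) \<Longrightarrow> d (q - 1) (d q c) = 0" for q c
    using assms by (auto simp: free_cx_def)
  show "additive (d q)" "c \<in> frag_on (S q) \<Longrightarrow> d q c \<in> frag_on (S (q - 1))"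
    "c \<in> frag_on (S q) \<Longrightarrow> d (q - 1) (d q c) = 0" by (rule * | assumption)+
  show "c \<in> frag_on (S (q + 1)) \<Longrightarrow> d (q + 1) c \<in> frag_on (S q)"
    "c \<in> frag_on (S (q + 1)) \<Longrightarrow> d q (d (q + 1) c) = 0"
    using *(2,3)[of c "q + 1"] by simp_all
qed

lemma free_cxI:
  assumes "\<And>q. additive (d q)"
    and "\<And>q s. s \<in> S q \<Longrightarrow> d q (frag_of s) \<in> frag_on (S (q - 1))"
    and "\<And>q s. s \<in> S q \<Longrightarrow> d (q - 1) (d q (frag_of s)) = 0"
  shows "free_cx S d"
  unfolding free_cx_def
proof (intro conjI allI ballI)
  fix q c assume c: "c \<in> frag_on (S q)"
  show "d q c \<in> frag_on (S (q - 1))"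
    by (rule frag_on_hom[OF assms(1,2) c])
  have z: "additive (\<lambda>x :: 'a \<Rightarrow>\<^sub>0 int. 0 :: 'a \<Rightarrow>\<^sub>0 int)" by (simp add: additive_def)
  show "d (q - 1) (d q c) = 0"
    by (rule additive_eq_on[OF additive_compose[OF assms(1,1)] z assms(3) c])
qed (rule assms(1))

lemma subgroup_frag_on:
  assumes "T \<subseteq> S" shows "subgroup (frag_on T) (free_Abelian_group S)"
proof (rule group.subgroupI[OF group_free_Abelian_group])
  show "frag_on T \<subseteq> carrier (free_Abelian_group S)"
    using assms by (auto simp: frag_on_def)
  show "frag_on T \<noteq> {}" using frag_on_zero by blast
  show "inv\<^bsub>free_Abelian_group S\<^esub> a \<in> frag_on T" if "a \<in> frag_on T" for a
    using that assms frag_on_minus[of a T] by (simp add: frag_on_def subset_trans)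
  show "a \<otimes>\<^bsub>free_Abelian_group S\<^esub> b \<in> frag_on T" if "a \<in> frag_on T" "b \<in> frag_on T" for a b
    using frag_on_add[OF that] by simp
qed

lemma frag_on_Mod:
  assumes "T \<subseteq> S"
  shows "comm_group (free_Abelian_group S Mod frag_on T)"
  by (rule comm_group.abelian_FactGroup[OF abelian_free_Abelian_group subgroup_frag_on[OF assms]])

abbreviation cls :: "'b set \<Rightarrow> 'b set \<Rightarrow> ('b \<Rightarrow>\<^sub>0 int) \<Rightarrow> ('b \<Rightarrow>\<^sub>0 int) set" where
  "cls S T c \<equiv> frag_on T #>\<^bsub>free_Abelian_group S\<^esub> c"

lemma cls_eq_iff:
  assumes "T \<subseteq> S" "x \<in> frag_on S" "y \<in> frag_on S"
  shows "cls S T x = cls S T y \<longleftrightarrow> x - y \<in> frag_on T"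
proof -
  have "(\<exists>h\<in>frag_on T. x = h + y) \<longleftrightarrow> x - y \<in> frag_on T"
    by (metis add_diff_cancel_right' diff_add_cancel)
  then show ?thesis
    using coset_eq_iff[OF abelian_free_Abelian_group subgroup_frag_on[OF assms(1)], of x y] assms(2,3)
    by (simp add: frag_on_def)
qed

lemma additive_hom:
  assumes "additive f" "\<And>x. x \<in> frag_on S \<Longrightarrow> f x \<in> frag_on S'"
  shows "f \<in> hom (free_Abelian_group S) (free_Abelian_group S')"
  using assms by (auto simp: hom_def frag_on_def additive_def)

lemma cls_map:
  assumes T: "T \<subseteq> S" "T' \<subseteq> S'" and f: "additive f" "\<And>x. x \<in> frag_on S \<Longrightarrow> f x \<in> frag_on S'"
    "\<And>x. x \<in> frag_on T \<Longrightarrow> f x \<in> frag_on T'" and x: "x \<in> frag_on S"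
  shows "(\<Union>y\<in>cls S T x. cls S' T' (f y)) = cls S' T' (f x)"
  by (rule coset_map_eq[OF abelian_free_Abelian_group subgroup_frag_on[OF T(1)]
      abelian_free_Abelian_group subgroup_frag_on[OF T(2)] additive_hom[OF f(1,2)]])
    (use f(3) x in \<open>auto simp: frag_on_def\<close>)

lemma carrier_Mod_frag: "carrier (free_Abelian_group S Mod frag_on T) = cls S T ` frag_on S"
  by (simp add: carrier_FactGroup carrier_free_eq)

lemma cls_mult:
  assumes "T \<subseteq> S" "x \<in> frag_on S" "y \<in> frag_on S"
  shows "cls S T x \<otimes>\<^bsub>free_Abelian_group S Mod frag_on T\<^esub> cls S T y = cls S T (x + y)"
  using coset_mult[OF abelian_free_Abelian_group subgroup_frag_on[OF assms(1)], of x y] assms(2,3)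
  by (simp add: frag_on_def)

lemma cls_map_hom:
  assumes T: "T \<subseteq> S" "T' \<subseteq> S'" and f: "additive f" "\<And>x. x \<in> frag_on S \<Longrightarrow> f x \<in> frag_on S'"
    "\<And>x. x \<in> frag_on T \<Longrightarrow> f x \<in> frag_on T'"
  shows "(\<lambda>X. \<Union>y\<in>X. cls S' T' (f y)) \<in> hom (free_Abelian_group S Mod frag_on T) (free_Abelian_group S' Mod frag_on T')"
proof (rule homI)
  fix X assume "X \<in> carrier (free_Abelian_group S Mod frag_on T)"
  then show "(\<Union>y\<in>X. cls S' T' (f y)) \<in> carrier (free_Abelian_group S' Mod frag_on T')"
    using f(2) by (auto simp: carrier_Mod_frag cls_map[OF T f])
next
  fix X Y assume "X \<in> carrier (free_Abelian_group S Mod frag_on T)" "Y \<in> carrier (free_Abelian_group S Mod frag_on T)"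
  then obtain x y where "X = cls S T x" "x \<in> frag_on S" "Y = cls S T y" "y \<in> frag_on S"
    by (auto simp: carrier_Mod_frag)
  then show "(\<Union>y\<in>X \<otimes>\<^bsub>free_Abelian_group S Mod frag_on T\<^esub> Y. cls S' T' (f y))
    = (\<Union>y\<in>X. cls S' T' (f y)) \<otimes>\<^bsub>free_Abelian_group S' Mod frag_on T'\<^esub> (\<Union>y\<in>Y. cls S' T' (f y))"
    using f(2) by (simp only: cls_mult[OF T(1)] cls_mult[OF T(2)] cls_map[OF T f] frag_on_add additive.add[OF f(1)])
qed

lemma pair_cx_simps:
  "chains (pair_cx S T d) q = free_Abelian_group (S q) Mod frag_on (T q)"
  "bd (pair_cx S T d) q = (\<lambda>X. \<Union>x\<in>X. cls (S (q - 1)) (T (q - 1)) (d q x))"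
  by (simp_all add: quot_complex_def free_complex_def carrier_free_eq)

lemma pair_bd:
  assumes "free_cx S d" "free_cx T d" "\<And>q. T q \<subseteq> S q" "x \<in> frag_on (S q)"
  shows "bd (pair_cx S T d) q (cls (S q) (T q) x) = cls (S (q - 1)) (T (q - 1)) (d q x)"
  unfolding pair_cx_simps
  by (rule cls_map[OF assms(3,3) free_cxD(1)[OF assms(1)] free_cxD(2)[OF assms(1)] free_cxD(2)[OF assms(2)] assms(4)])

lemma is_complex_pair:
  assumes S: "free_cx S d" and T: "free_cx T d" and TS: "\<And>q. T q \<subseteq> S q"
  shows "is_complex (pair_cx S T d)"
  unfolding is_complex_def
proof (intro allI conjI ballI)
  fix q
  show "comm_group (chains (pair_cx S T d) q)"
    by (simp only: pair_cx_simps frag_on_Mod[OF TS])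
  show "bd (pair_cx S T d) q \<in> hom (chains (pair_cx S T d) q) (chains (pair_cx S T d) (q - 1))"
    unfolding pair_cx_simps
    by (rule cls_map_hom[OF TS TS free_cxD(1)[OF S] free_cxD(2)[OF S] free_cxD(2)[OF T]])
  fix X assume "X \<in> carrier (chains (pair_cx S T d) q)"
  then obtain x where x: "x \<in> frag_on (S q)" "X = cls (S q) (T q) x"
    by (auto simp: pair_cx_simps carrier_Mod_frag)
  have "cls (S (q - 1 - 1)) (T (q - 1 - 1)) 0 = frag_on (T (q - 1 - 1))"
    by (simp add: r_coset_def)
  then show "bd (pair_cx S T d) (q - 1) (bd (pair_cx S T d) q X) = \<one>\<^bsub>chains (pair_cx S T d) (q - 1 - 1)\<^esub>"
    using x free_cxD(2,3)[OF S x(1)] by (simp add: pair_bd[OF S T TS]) (simp add: pair_cx_simps)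
qed

text \<open>The operators live on the ambient free groups and satisfy the identities only modulo the
  subcomplexes, so that later constructions never have to handle cosets.\<close>

lemma pair_chain_equivalence:
  assumes S: "free_cx S d" "free_cx T d" "\<And>q. T q \<subseteq> S q"
    and S': "free_cx S' d'" "free_cx T' d'" "\<And>q. T' q \<subseteq> S' q"
    and f: "\<And>q. additive (f q)" "\<And>q x. x \<in> frag_on (S q) \<Longrightarrow> f q x \<in> frag_on (S' q)"
      "\<And>q x. x \<in> frag_on (T q) \<Longrightarrow> f q x \<in> frag_on (T' q)"
      "\<And>q x. x \<in> frag_on (S q) \<Longrightarrow> f (q - 1) (d q x) - d' q (f q x) \<in> frag_on (T' (q - 1))"
    and g: "\<And>q. additive (g q)" "\<And>q x. x \<in> frag_on (S' q) \<Longrightarrow> g q x \<in> frag_on (S q)"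
      "\<And>q x. x \<in> frag_on (T' q) \<Longrightarrow> g q x \<in> frag_on (T q)"
      "\<And>q x. x \<in> frag_on (S' q) \<Longrightarrow> g (q - 1) (d' q x) - d q (g q x) \<in> frag_on (T (q - 1))"
    and h: "\<And>q. additive (h q)" "\<And>q x. x \<in> frag_on (S q) \<Longrightarrow> h q x \<in> frag_on (S (q + 1))"
      "\<And>q x. x \<in> frag_on (T q) \<Longrightarrow> h q x \<in> frag_on (T (q + 1))"
    and k: "\<And>q. additive (k q)" "\<And>q x. x \<in> frag_on (S' q) \<Longrightarrow> k q x \<in> frag_on (S' (q + 1))"
      "\<And>q x. x \<in> frag_on (T' q) \<Longrightarrow> k q x \<in> frag_on (T' (q + 1))"
    and gf: "\<And>q x. x \<in> frag_on (S q) \<Longrightarrow>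
        g q (f q x) - (x + (d (q + 1) (h q x) + h (q - 1) (d q x))) \<in> frag_on (T q)"
    and fg: "\<And>q x. x \<in> frag_on (S' q) \<Longrightarrow>
        f q (g q x) - (x + (d' (q + 1) (k q x) + k (q - 1) (d' q x))) \<in> frag_on (T' q)"
  shows "chain_equivalence (pair_cx S T d) (pair_cx S' T' d') (\<lambda>q X. \<Union>x\<in>X. cls (S' q) (T' q) (f q x))"
proof -
  have cm: "cchain_map (pair_cx S T d) (pair_cx S' T' d') (\<lambda>q X. \<Union>x\<in>X. cls (S' q) (T' q) (f q x))"
    if S: "free_cx S d" "free_cx T d" "\<And>q. T q \<subseteq> S q"
    and S': "free_cx S' d'" "free_cx T' d'" "\<And>q. T' q \<subseteq> S' q"
    and f: "\<And>q. additive (f q)" "\<And>q x. x \<in> frag_on (S q) \<Longrightarrow> f q x \<in> frag_on (S' q)"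
      "\<And>q x. x \<in> frag_on (T q) \<Longrightarrow> f q x \<in> frag_on (T' q)"
      "\<And>q x. x \<in> frag_on (S q) \<Longrightarrow> f (q - 1) (d q x) - d' q (f q x) \<in> frag_on (T' (q - 1))"
    for S T :: "int \<Rightarrow> 'x set" and d and S' T' :: "int \<Rightarrow> 'y set" and d' f
    unfolding cchain_map_def
  proof (intro allI conjI ballI)
    fix q
    have cl: "(\<Union>y\<in>cls (S q) (T q) x. cls (S' q) (T' q) (f q y)) = cls (S' q) (T' q) (f q x)"
      if "x \<in> frag_on (S q)" for q x
      by (rule cls_map[OF S(3) S'(3) f(1) f(2) f(3) that])
    show "(\<lambda>X. \<Union>x\<in>X. cls (S' q) (T' q) (f q x)) \<in> hom (chains (pair_cx S T d) q) (chains (pair_cx S' T' d') q)"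
      unfolding pair_cx_simps by (rule cls_map_hom[OF S(3) S'(3) f(1) f(2) f(3)])
    fix X assume "X \<in> carrier (chains (pair_cx S T d) q)"
    then obtain x where x: "x \<in> frag_on (S q)" "X = cls (S q) (T q) x"
      by (auto simp: pair_cx_simps carrier_Mod_frag)
    note dx = free_cxD(2)[OF S(1) x(1)]
    have "cls (S' (q - 1)) (T' (q - 1)) (f (q - 1) (d q x)) = cls (S' (q - 1)) (T' (q - 1)) (d' q (f q x))"
      using f(4)[OF x(1)] f(2)[OF dx] free_cxD(2)[OF S'(1) f(2)[OF x(1)]]
      by (simp only: cls_eq_iff[OF S'(3)])
    then show "(\<Union>x\<in>bd (pair_cx S T d) q X. cls (S' (q - 1)) (T' (q - 1)) (f (q - 1) x))
        = bd (pair_cx S' T' d') q (\<Union>x\<in>X. cls (S' q) (T' q) (f q x))"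
      unfolding x(2) pair_bd[OF S x(1)] cl[OF dx] cl[OF x(1)] pair_bd[OF S' f(2)[OF x(1)]] .
  qed
  have hm: "cchain_homotopic (pair_cx S T d) (pair_cx S T d)
      (\<lambda>q. (\<lambda>X. \<Union>x\<in>X. cls (S q) (T q) (g q x)) \<circ> (\<lambda>X. \<Union>x\<in>X. cls (S' q) (T' q) (f q x))) (\<lambda>q. id)"
    if S: "free_cx S d" "free_cx T d" "\<And>q. T q \<subseteq> S q"
    and S': "\<And>q. T' q \<subseteq> S' q"
    and f: "\<And>q. additive (f q)" "\<And>q x. x \<in> frag_on (S q) \<Longrightarrow> f q x \<in> frag_on (S' q)"
      "\<And>q x. x \<in> frag_on (T q) \<Longrightarrow> f q x \<in> frag_on (T' q)"
    and g: "\<And>q. additive (g q)" "\<And>q x. x \<in> frag_on (S' q) \<Longrightarrow> g q x \<in> frag_on (S q)"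
      "\<And>q x. x \<in> frag_on (T' q) \<Longrightarrow> g q x \<in> frag_on (T q)"
    and h: "\<And>q. additive (h q)" "\<And>q x. x \<in> frag_on (S q) \<Longrightarrow> h q x \<in> frag_on (S (q + 1))"
      "\<And>q x. x \<in> frag_on (T q) \<Longrightarrow> h q x \<in> frag_on (T (q + 1))"
    and gf: "\<And>q x. x \<in> frag_on (S q) \<Longrightarrow>
        g q (f q x) - (x + (d (q + 1) (h q x) + h (q - 1) (d q x))) \<in> frag_on (T q)"
    for S T :: "int \<Rightarrow> 'x set" and d and S' T' :: "int \<Rightarrow> 'y set" and f g h
    unfolding cchain_homotopic_def
  proof (intro exI[of _ "\<lambda>q X. \<Union>x\<in>X. cls (S (q + 1)) (T (q + 1)) (h q x)"] allI conjI ballI)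
    fix q
    show "(\<lambda>X. \<Union>x\<in>X. cls (S (q + 1)) (T (q + 1)) (h q x)) \<in> hom (chains (pair_cx S T d) q) (chains (pair_cx S T d) (q + 1))"
      unfolding pair_cx_simps by (rule cls_map_hom[OF S(3) S(3) h(1) h(2) h(3)])
    fix X assume "X \<in> carrier (chains (pair_cx S T d) q)"
    then obtain x where x: "x \<in> frag_on (S q)" "X = cls (S q) (T q) x"
      by (auto simp: pair_cx_simps carrier_Mod_frag)
    note dx = free_cxD(2)[OF S(1) x(1)]
    have clf: "(\<Union>y\<in>cls (S q) (T q) x. cls (S' q) (T' q) (f q y)) = cls (S' q) (T' q) (f q x)"
      if "x \<in> frag_on (S q)" for q x
      by (rule cls_map[OF S(3) S' f(1) f(2) f(3) that])
    have clg: "(\<Union>y\<in>cls (S' q) (T' q) x. cls (S q) (T q) (g q y)) = cls (S q) (T q) (g q x)"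
      if "x \<in> frag_on (S' q)" for q x
      by (rule cls_map[OF S' S(3) g(1) g(2) g(3) that])
    have clh: "(\<Union>y\<in>cls (S q) (T q) x. cls (S (q + 1)) (T (q + 1)) (h q y)) = cls (S (q + 1)) (T (q + 1)) (h q x)"
      if "x \<in> frag_on (S q)" for q x
      by (rule cls_map[OF S(3) S(3) h(1) h(2) h(3) that])
    have hdx: "h (q - 1) (d q x) \<in> frag_on (S q)" using h(2)[OF dx] by simp
    have dhx: "d (q + 1) (h q x) \<in> frag_on (S q)" by (rule free_cxD(4)[OF S(1) h(2)[OF x(1)]])
    have 1: "(\<Union>x\<in>bd (pair_cx S T d) q X. cls (S (q - 1 + 1)) (T (q - 1 + 1)) (h (q - 1) x)) = cls (S q) (T q) (h (q - 1) (d q x))"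
      unfolding x(2) pair_bd[OF S x(1)] clh[OF dx] by simp
    have 2: "bd (pair_cx S T d) (q + 1) (\<Union>x\<in>X. cls (S (q + 1)) (T (q + 1)) (h q x)) = cls (S q) (T q) (d (q + 1) (h q x))"
      unfolding x(2) clh[OF x(1)] pair_bd[OF S h(2)[OF x(1)]] by simp
    have 3: "((\<lambda>X. \<Union>x\<in>X. cls (S q) (T q) (g q x)) \<circ> (\<lambda>X. \<Union>x\<in>X. cls (S' q) (T' q) (f q x))) X = cls (S q) (T q) (g q (f q x))"
      unfolding x(2) o_def clf[OF x(1)] clg[OF f(2)[OF x(1)]] ..
    have 4: "cls (S q) (T q) (g q (f q x)) = cls (S q) (T q) (x + (d (q + 1) (h q x) + h (q - 1) (d q x)))"
      using gf[OF x(1)] g(2)[OF f(2)[OF x(1)]] x(1) hdx dhx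
      by (simp only: cls_eq_iff[OF S(3)] frag_on_add)
    show "((\<lambda>X. \<Union>x\<in>X. cls (S q) (T q) (g q x)) \<circ> (\<lambda>X. \<Union>x\<in>X. cls (S' q) (T' q) (f q x))) X =
        id X \<otimes>\<^bsub>chains (pair_cx S T d) q\<^esub>
        (bd (pair_cx S T d) (q + 1) (\<Union>x\<in>X. cls (S (q + 1)) (T (q + 1)) (h q x)) \<otimes>\<^bsub>chains (pair_cx S T d) q\<^esub>
         (\<Union>x\<in>bd (pair_cx S T d) q X. cls (S (q - 1 + 1)) (T (q - 1 + 1)) (h (q - 1) x)))"
      unfolding 1 2 3 4 unfolding id_apply x(2) pair_cx_simps
      using x(1) hdx dhx by (simp only: cls_mult[OF S(3)] frag_on_add)
  qed
  show ?thesis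
    unfolding chain_equivalence_def
    by (intro conjI exI[of _ "\<lambda>q X. \<Union>x\<in>X. cls (S q) (T q) (g q x)"]
        cm[OF S S' f] cm[OF S' S g] hm[OF S S'(3) f(1-3) g(1-3) h gf] hm[OF S' S(3) g(1-3) f(1-3) k fg])
qed

section \<open>Contractions of relatively acyclic pairs\<close>

text \<open>Vanishing of the relative homology of the pair, in terms of representatives.\<close>

definition rel_acyclic :: "(int \<Rightarrow> 'b set) \<Rightarrow> (int \<Rightarrow> 'b set) \<Rightarrow> (int \<Rightarrow> ('b \<Rightarrow>\<^sub>0 int) \<Rightarrow> ('b \<Rightarrow>\<^sub>0 int)) \<Rightarrow> bool" where
  "rel_acyclic S' S d \<longleftrightarrow> (\<forall>q. \<forall>x\<in>frag_on (S' q). d q x \<in> frag_on (S (q - 1)) \<longrightarrow>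
     (\<exists>y\<in>frag_on (S' (q + 1)). x - d (q + 1) y \<in> frag_on (S q)))"

lemma free_cx_Int:
  assumes "free_cx S d" "free_cx T d" shows "free_cx (\<lambda>q. S q \<inter> T q) d"
  using assms by (auto simp: free_cx_def frag_on_Int)

text \<open>The contraction is built on generators, degree by degree. If it exists up to degree \<open>q - 1\<close> and
  \<open>s\<close> is a generator of degree \<open>q\<close>, then \<open>s - h (d s)\<close> has its boundary in \<open>S\<close>, and acyclicity fills
  it. Filling inside \<open>T'\<close> whenever \<open>s\<close> lies there makes one contraction serve both pairs.\<close>

lemma relative_contraction:
  assumes S': "free_cx S' d" and S: "free_cx S d" and T': "free_cx T' d"
    and SS': "\<And>q. S q \<subseteq> S' q" and TS': "\<And>q. T' q \<subseteq> S' q"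
    and low: "\<And>q. q < n0 \<Longrightarrow> S' q = {}"
    and acS: "rel_acyclic S' S d" and acT: "rel_acyclic T' (\<lambda>q. T' q \<inter> S q) d"
  obtains h where "\<And>q. additive (h q)" "\<And>q s. s \<notin> S' q - S q \<Longrightarrow> h q (frag_of s) = 0"
    "\<And>q x. x \<in> frag_on (S' q) \<Longrightarrow> h q x \<in> frag_on (S' (q + 1))"
    "\<And>q x. x \<in> frag_on (T' q) \<Longrightarrow> h q x \<in> frag_on (T' (q + 1))"
    "\<And>q x. x \<in> frag_on (S' q) \<Longrightarrow> x - d (q + 1) (h q x) - h (q - 1) (d q x) \<in> frag_on (S q)"
proof -
  note s' = free_cxD[OF S'] and s = free_cxD[OF S] and t = free_cxD[OF T']
  define pick where "pick q x = (SOME y. y \<in> frag_on (S' (q + 1)) \<and> x - d (q + 1) y \<in> frag_on (S q) \<and>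
      (x \<in> frag_on (T' q) \<longrightarrow> y \<in> frag_on (T' (q + 1))))" for q x
  have pick: "pick q x \<in> frag_on (S' (q + 1)) \<and> x - d (q + 1) (pick q x) \<in> frag_on (S q) \<and>
      (x \<in> frag_on (T' q) \<longrightarrow> pick q x \<in> frag_on (T' (q + 1)))"
    if "x \<in> frag_on (S' q)" "d q x \<in> frag_on (S (q - 1))" for q x
  proof -
    have "\<exists>y. y \<in> frag_on (S' (q + 1)) \<and> x - d (q + 1) y \<in> frag_on (S q) \<and>
      (x \<in> frag_on (T' q) \<longrightarrow> y \<in> frag_on (T' (q + 1)))"
    proof (cases "x \<in> frag_on (T' q)")
      case True
      then have "d q x \<in> frag_on (T' (q - 1) \<inter> S (q - 1))"
        using t(2) that by (simp add: frag_on_Int)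
      then obtain y where "y \<in> frag_on (T' (q + 1))" "x - d (q + 1) y \<in> frag_on (T' q \<inter> S q)"
        using acT True unfolding rel_acyclic_def by blast
      then show ?thesis using frag_on_mono[OF TS'] by (auto simp: frag_on_Int)
    next
      case False
      then show ?thesis using acS that unfolding rel_acyclic_def by blast
    qed
    then show ?thesis unfolding pick_def by (rule someI_ex)
  qed
  \<comment> \<open>\<open>H n\<close> is the contraction in degree \<open>n0 + n - 1\<close>; the shift makes \<open>H 0\<close> the zero map in the last
      degree without generators.\<close>
  define H where "H = rec_nat (\<lambda>_. 0) (\<lambda>n k. frag_extend (\<lambda>s. if s \<in> S' (n0 + int n) - S (n0 + int n)
      then pick (n0 + int n) (frag_of s - k (d (n0 + int n) (frag_of s))) else 0))"
  define h where "h q = H (nat (q - n0 + 1))" for q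
  have h_low: "h q = (\<lambda>_. 0)" if "q < n0" for q
    using that by (simp add: h_def H_def)
  have h_rec: "h q = frag_extend (\<lambda>s. if s \<in> S' q - S q then pick q (frag_of s - h (q - 1) (d q (frag_of s))) else 0)"
    if "n0 \<le> q" for q
  proof -
    define n where "n = nat (q - n0)"
    have n: "q = n0 + int n" using that by (simp add: n_def)
    have e: "nat (q - n0 + 1) = Suc n" "nat (q - 1 - n0 + 1) = n" using n by simp_all
    show ?thesis unfolding h_def e unfolding n H_def by (simp only: nat.rec)
  qed
  have ha: "additive (h q)" for q
  proof (cases "q < n0")
    case True then show ?thesis by (simp add: h_low additive_def)
  next
    case False then show ?thesis by (simp only: h_rec[OF leI[OF False]] additive_frag_extend)
  qed
  have h0: "h q (frag_of s) = 0" if "s \<notin> S' q - S q" for q s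
    using that by (cases "q < n0") (auto simp: h_low h_rec)
  have hS: "h q x = 0" if "x \<in> frag_on (S q)" for q x
  proof (rule additive_eq_on[OF ha _ _ that])
    show "additive (\<lambda>x :: 'a \<Rightarrow>\<^sub>0 int. 0 :: 'a \<Rightarrow>\<^sub>0 int)" by (simp add: additive_def)
  qed (simp add: h0)
  have low_case: "(\<forall>x\<in>frag_on (S' q). h q x \<in> frag_on (S' (q + 1)) \<and> x - d (q + 1) (h q x) - h (q - 1) (d q x) \<in> frag_on (S q))
     \<and> (\<forall>x\<in>frag_on (T' q). h q x \<in> frag_on (T' (q + 1)))" if "S' q = {}" "T' q = {}" for q
  proof -
    have "x = 0" if "x \<in> frag_on (S' q) \<or> x \<in> frag_on (T' q)" for x
      using that \<open>S' q = {}\<close> \<open>T' q = {}\<close> frag_on_empty[of x] by auto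
    moreover have "h q 0 = 0" "h (q - 1) 0 = 0" "d q 0 = 0" "d (q + 1) 0 = 0"
      by (rule additive.zero[OF ha] additive.zero[OF s'(1)])+
    ultimately show ?thesis by (metis diff_zero frag_on_zero)
  qed
  have main: "(\<forall>x\<in>frag_on (S' q). h q x \<in> frag_on (S' (q + 1)) \<and> x - d (q + 1) (h q x) - h (q - 1) (d q x) \<in> frag_on (S q))
     \<and> (\<forall>x\<in>frag_on (T' q). h q x \<in> frag_on (T' (q + 1)))" (is "?P q") if "n0 - 1 \<le> q" for q
    using that
  proof (induction q rule: int_ge_induct)
    case base
    have "S' (n0 - 1) = {}" "T' (n0 - 1) = {}" using low[of "n0 - 1"] TS'[of "n0 - 1"] by auto
    then show ?case using low_case by blast
  next
    case (step p)
    define q where "q = p + 1"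
    have q: "n0 \<le> q" "p = q - 1" using step(1) by (auto simp: q_def)
    note IH = step(2)[unfolded q(2)]
    \<comment> \<open>The chain to be filled is \<open>s - h (d s)\<close>, whose boundary \<open>d s - d (h (d s))\<close> equals \<open>h (d (d s)) = 0\<close>
        modulo \<open>S\<close> by the induction hypothesis.\<close>
    have key: "pick q (frag_of s - h (q - 1) (d q (frag_of s))) \<in> frag_on (S' (q + 1))"
       "frag_of s - h (q - 1) (d q (frag_of s)) - d (q + 1) (pick q (frag_of s - h (q - 1) (d q (frag_of s)))) \<in> frag_on (S q)"
       "s \<in> T' q \<Longrightarrow> pick q (frag_of s - h (q - 1) (d q (frag_of s))) \<in> frag_on (T' (q + 1))"
      if s: "s \<in> S' q" for s
    proof -
      let ?x = "frag_of s - h (q - 1) (d q (frag_of s))"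
      have ds: "d q (frag_of s) \<in> frag_on (S' (q - 1))" using s'(2) s by simp
      have 1: "h (q - 1) (d q (frag_of s)) \<in> frag_on (S' q)"
        and 2: "d q (frag_of s) - d q (h (q - 1) (d q (frag_of s))) - h (q - 1 - 1) (d (q - 1) (d q (frag_of s))) \<in> frag_on (S (q - 1))"
        using IH ds by auto
      have x: "?x \<in> frag_on (S' q)" using 1 s by (simp add: frag_on_diff)
      have "d (q - 1) (d q (frag_of s)) = 0" using s'(3) s by simp
      then have dx: "d q ?x \<in> frag_on (S (q - 1))"
        using 2 by (simp add: additive.diff[OF s'(1)] additive.zero[OF ha])
      show "pick q ?x \<in> frag_on (S' (q + 1))" "?x - d (q + 1) (pick q ?x) \<in> frag_on (S q)"
        using pick[OF x dx] by auto
      assume "s \<in> T' q"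
      then have "d q (frag_of s) \<in> frag_on (T' (q - 1))" using t(2) by simp
      then have "h (q - 1) (d q (frag_of s)) \<in> frag_on (T' (q - 1 + 1))" using IH by blast
      then have "?x \<in> frag_on (T' q)" using \<open>s \<in> T' q\<close> by (simp add: frag_on_diff)
      then show "pick q ?x \<in> frag_on (T' (q + 1))" using pick[OF x dx] by blast
    qed
    have "h q x \<in> frag_on (S' (q + 1))" if "x \<in> frag_on (S' q)" for x
      by (rule frag_on_hom[OF ha _ that]) (auto simp: h_rec[OF q(1)] key)
    moreover have "h q x \<in> frag_on (T' (q + 1))" if "x \<in> frag_on (T' q)" for x
      by (rule frag_on_hom[OF ha _ that]) (use TS' in \<open>auto simp: h_rec[OF q(1)] key\<close>)
    moreover have "x - d (q + 1) (h q x) - h (q - 1) (d q x) \<in> frag_on (S q)" if "x \<in> frag_on (S' q)" for x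
    proof (rule frag_on_hom[OF _ _ that])
      show "additive (\<lambda>x. x - d (q + 1) (h q x) - h (q - 1) (d q x))"
        by (intro additive_minus additive_id additive_compose[OF s'(1) ha] additive_compose[OF ha s'(1)])
      fix s assume sq: "s \<in> S' q"
      show "frag_of s - d (q + 1) (h q (frag_of s)) - h (q - 1) (d q (frag_of s)) \<in> frag_on (S q)"
      proof (cases "s \<in> S q")
        case True
        then have "d q (frag_of s) \<in> frag_on (S (q - 1))" using s(2) by simp
        then show ?thesis using True hS h0[of s q] by (simp add: additive.zero[OF s'(1)])
      next
        case False
        then have "h q (frag_of s) = pick q (frag_of s - h (q - 1) (d q (frag_of s)))"
          using sq by (simp add: h_rec[OF q(1)])
        then show ?thesis using key(2)[OF sq] by (simp add: algebra_simps)
      qed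
    qed
    ultimately show ?case unfolding q_def by blast
  qed
  have all: "?P q" for q
  proof (cases "n0 - 1 \<le> q")
    case False
    then have "S' q = {}" "T' q = {}" using low[of q] TS'[of q] by auto
    then show ?thesis using low_case by blast
  qed (rule main)
  show thesis
    by (rule that[of h]) (use ha h0 all in auto)
qed

text \<open>The map \<open>id - d h - h d\<close> commutes with \<open>d\<close>, lands in the smaller pair and is homotopic to the
  identity on both pairs through \<open>h\<close>; so it is inverse to the inclusion.\<close>

lemma deformation_equivalence:
  assumes S': "free_cx S' d" and T': "free_cx T' d" and S: "free_cx S d" and T: "free_cx T d"
    and sub: "\<And>q. T q \<subseteq> S q" "\<And>q. T' q \<subseteq> S' q" "\<And>q. S q \<subseteq> S' q" "\<And>q. T q \<subseteq> T' q"
    and h: "\<And>q. additive (h q)"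
    and hS': "\<And>q x. x \<in> frag_on (S' q) \<Longrightarrow> h q x \<in> frag_on (S' (q + 1))"
    and hT': "\<And>q x. x \<in> frag_on (T' q) \<Longrightarrow> h q x \<in> frag_on (T' (q + 1))"
    and hS: "\<And>q x. x \<in> frag_on (S q) \<Longrightarrow> h q x \<in> frag_on (S (q + 1))"
    and hT: "\<And>q x. x \<in> frag_on (T q) \<Longrightarrow> h q x \<in> frag_on (T (q + 1))"
    and rS: "\<And>q x. x \<in> frag_on (S' q) \<Longrightarrow> x - d (q + 1) (h q x) - h (q - 1) (d q x) \<in> frag_on (S q)"
    and rT: "\<And>q x. x \<in> frag_on (T' q) \<Longrightarrow> x - d (q + 1) (h q x) - h (q - 1) (d q x) \<in> frag_on (T q)"
  shows "\<exists>f. chain_equivalence (pair_cx S T d) (pair_cx S' T' d) f"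
proof -
  note da = free_cxD(1)[OF S']
  have zero: "d q 0 = 0" "h q 0 = 0" for q using additive.zero[OF da] additive.zero[OF h] by auto
  have aux: "x - d (q + 1) (h q x) - h (q - 1) (d q x) - (x + (d (q + 1) (- h q x) + - h (q - 1) (d q x))) = 0" for q x
    by (simp add: additive.minus[OF da])
  have "chain_equivalence (pair_cx S T d) (pair_cx S' T' d) (\<lambda>q X. \<Union>x\<in>X. cls (S' q) (T' q) x)"
  proof (rule pair_chain_equivalence[OF S T sub(1) S' T' sub(2), where f = "\<lambda>q x. x"
      and g = "\<lambda>q x. x - d (q + 1) (h q x) - h (q - 1) (d q x)" and h = "\<lambda>q x. - h q x" and k = "\<lambda>q x. - h q x"])
    show "additive (\<lambda>x. x - d (q + 1) (h q x) - h (q - 1) (d q x))" for q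
      by (intro additive_minus additive_id additive_compose[OF da h] additive_compose[OF h da])
    fix q x assume x: "x \<in> frag_on (S' q)"
    have "d q (d (q + 1) (h q x)) = 0" by (rule free_cxD(5)[OF S' hS'[OF x]])
    then have "d q x - d (q - 1 + 1) (h (q - 1) (d q x)) - h (q - 1 - 1) (d (q - 1) (d q x))
      = d q (x - d (q + 1) (h q x) - h (q - 1) (d q x))"
      using free_cxD(3)[OF S' x] by (simp add: additive.diff[OF da] zero)
    then show "d q x - d (q - 1 + 1) (h (q - 1) (d q x)) - h (q - 1 - 1) (d (q - 1) (d q x))
      - d q (x - d (q + 1) (h q x) - h (q - 1) (d q x)) \<in> frag_on (T (q - 1))" by simp
  qed (simp_all only: additive_id additive_uminus[OF h] aux frag_on_zero diff_self frag_on_minus hS' hT' hS hT rS rT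
      frag_on_mono[OF sub(3)] frag_on_mono[OF sub(4)])
  then show ?thesis by blast
qed

lemma frag_extend_zero_on:
  assumes "additive f" "\<And>s. s \<in> S \<Longrightarrow> f (frag_of s) = 0" "x \<in> frag_on S"
  shows "f x = 0"
proof (rule additive_eq_on[OF assms(1) _ _ assms(3)])
  show "additive (\<lambda>x :: 'a \<Rightarrow>\<^sub>0 int. 0 :: 'b)" by (simp add: additive_def)
qed (simp add: assms(2))

text \<open>Enlarging both members of a pair. Since \<open>h\<close> respects \<open>T'\<close> and retracts onto \<open>S\<close>, it retracts \<open>T'\<close>
  onto \<open>T' \<inter> S\<close>, which is why this is the subcomplex of the smaller pair.\<close>

theorem acyclic_inclusion_equivalence:
  assumes S': "free_cx S' d" and S: "free_cx S d" and T': "free_cx T' d"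
    and SS': "\<And>q. S q \<subseteq> S' q" and TS': "\<And>q. T' q \<subseteq> S' q"
    and low: "\<And>q. q < n0 \<Longrightarrow> S' q = {}"
    and acS: "rel_acyclic S' S d" and acT: "rel_acyclic T' (\<lambda>q. T' q \<inter> S q) d"
  shows "\<exists>f. chain_equivalence (pair_cx S (\<lambda>q. T' q \<inter> S q) d) (pair_cx S' T' d) f"
proof -
  obtain h where h: "\<And>q. additive (h q)" "\<And>q s. s \<notin> S' q - S q \<Longrightarrow> h q (frag_of s) = 0"
    "\<And>q x. x \<in> frag_on (S' q) \<Longrightarrow> h q x \<in> frag_on (S' (q + 1))"
    "\<And>q x. x \<in> frag_on (T' q) \<Longrightarrow> h q x \<in> frag_on (T' (q + 1))"
    "\<And>q x. x \<in> frag_on (S' q) \<Longrightarrow> x - d (q + 1) (h q x) - h (q - 1) (d q x) \<in> frag_on (S q)"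
    using relative_contraction[OF assms] by blast
  have hS: "h q x = 0" if "x \<in> frag_on (S q)" for q x
    by (rule frag_extend_zero_on[OF h(1) _ that]) (simp add: h(2))
  note t = free_cxD[OF T']
  show ?thesis
  proof (rule deformation_equivalence[OF S' T' S free_cx_Int[OF T' S] _ TS' SS' _ h(1) h(3,4)])
    fix q x assume x: "x \<in> frag_on (T' q)"
    have "h (q - 1) (d q x) \<in> frag_on (T' (q - 1 + 1))" by (rule h(4)[OF t(2)[OF x]])
    then show "x - d (q + 1) (h q x) - h (q - 1) (d q x) \<in> frag_on (T' q \<inter> S q)"
      using h(5)[OF frag_on_mono[OF TS' x]] t(4)[OF h(4)[OF x]] x
      by (simp add: frag_on_Int frag_on_diff)
  qed (auto simp: hS frag_on_Int h(5))
qed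

text \<open>Enlarging only the subcomplex: a contraction of \<open>T'\<close> onto \<open>T\<close>, extended by zero to the other
  generators of \<open>S\<close>, also provides the inverse on the quotients of \<open>S\<close>.\<close>

theorem acyclic_quotient_equivalence:
  assumes S: "free_cx S d" and T': "free_cx T' d" and T: "free_cx T d"
    and TS: "\<And>q. T' q \<subseteq> S q" and TT: "\<And>q. T q \<subseteq> T' q"
    and low: "\<And>q. q < n0 \<Longrightarrow> T' q = {}"
    and ac: "rel_acyclic T' T d"
  shows "\<exists>f. chain_equivalence (pair_cx S T d) (pair_cx S T' d) f"
proof -
  have e: "free_cx (\<lambda>_. {}) d" by (rule free_cxI) (use free_cxD(1)[OF S] in auto)
  have "rel_acyclic (\<lambda>_. {}) (\<lambda>q. {} \<inter> T q) d"
    by (auto simp: rel_acyclic_def dest!: frag_on_empty intro!: bexI[of _ 0] simp: additive.zero[OF free_cxD(1)[OF S]])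
  note rc = relative_contraction[OF T' T e TT empty_subsetI low ac this]
  obtain h where h: "\<And>q. additive (h q)" "\<And>q s. s \<notin> T' q - T q \<Longrightarrow> h q (frag_of s) = 0"
    "\<And>q x. x \<in> frag_on (T' q) \<Longrightarrow> h q x \<in> frag_on (T' (q + 1))"
    "\<And>q x. x \<in> frag_on (T' q) \<Longrightarrow> x - d (q + 1) (h q x) - h (q - 1) (d q x) \<in> frag_on (T q)"
    by (rule rc) blast+
  have hT: "h q x = 0" if "x \<in> frag_on (T q)" for q x
    by (rule frag_extend_zero_on[OF h(1) _ that]) (simp add: h(2))
  have hS: "h q x \<in> frag_on (S (q + 1))" for q and x :: "'a \<Rightarrow>\<^sub>0 int"
  proof (rule frag_on_hom[OF h(1), of UNIV])
    fix s show "h q (frag_of s) \<in> frag_on (S (q + 1))"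
      using h(2)[of s q] frag_on_mono[OF TS h(3)[of "frag_of s" q]] by (cases "s \<in> T' q - T q") auto
  qed (simp add: frag_on_def)
  note s = free_cxD[OF S]
  show ?thesis
  proof (rule deformation_equivalence[OF S T' S T _ TS order_refl TT h(1) hS h(3) hS _ _ h(4)])
    fix q x assume x: "x \<in> frag_on (S q)"
    show "x - d (q + 1) (h q x) - h (q - 1) (d q x) \<in> frag_on (S q)"
      using x s(4)[OF hS] hS[of "q - 1"] by (simp add: frag_on_diff)
  qed (use TS TT hT in \<open>auto intro: subset_trans\<close>)
qed

lemma additive_const_zero: "additive (\<lambda>_. 0)"
  by (simp add: additive_def)

text \<open>An edge of the double complex below is isomorphic to the complex it stands for, but its
  generators are pairs.\<close>

lemma rename_equivalence:
  fixes \<iota> :: "'b \<Rightarrow> 'c"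
  assumes S: "free_cx S d" and T: "free_cx T d" and TS: "\<And>q. T q \<subseteq> S q"
    and S': "free_cx (\<lambda>q. \<iota> ` S q) d'" and inj: "inj \<iota>"
    and d: "\<And>q s. s \<in> S q \<Longrightarrow> d' q (frag_of (\<iota> s)) = frag_extend (frag_of \<circ> \<iota>) (d q (frag_of s))"
  shows "\<exists>f. chain_equivalence (pair_cx S T d) (pair_cx (\<lambda>q. \<iota> ` S q) (\<lambda>q. \<iota> ` T q) d') f"
    and "free_cx (\<lambda>q. \<iota> ` T q) d'"
proof -
  note s = free_cxD[OF S] and t = free_cxD[OF T] and s' = free_cxD[OF S']
  let ?f = "frag_extend (frag_of \<circ> \<iota>)" and ?g = "frag_extend (frag_of \<circ> inv_into UNIV \<iota>)"
  have fa: "additive ?f" and ga: "additive ?g" by (rule additive_frag_extend)+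
  have f_on: "?f x \<in> frag_on (\<iota> ` U)" if "x \<in> frag_on U" for x U
    by (rule frag_on_hom[OF fa _ that]) simp
  have g_on: "?g x \<in> frag_on U" if "x \<in> frag_on (\<iota> ` U)" for x U
    by (rule frag_on_hom[OF ga _ that]) (auto simp: inv_f_f[OF inj])
  have gf: "?g (?f x) = x" for x
    by (rule additive_eq_on[OF additive_compose[OF ga fa] additive_id, of UNIV])
      (simp_all add: inv_f_f[OF inj] frag_on_def)
  have fg: "?f (?g x) = x" if "x \<in> frag_on (\<iota> ` U)" for x U
    by (rule additive_eq_on[OF additive_compose[OF fa ga] additive_id _ that])
      (auto simp: inv_f_f[OF inj])
  have df: "d' q (?f x) = ?f (d q x)" if "x \<in> frag_on (S q)" for q x
    by (rule additive_eq_on[OF additive_compose[OF s'(1) fa] additive_compose[OF fa s(1)] _ that])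
      (simp add: d)
  show T': "free_cx (\<lambda>q. \<iota> ` T q) d'"
  proof (rule free_cxI[OF s'(1)])
    fix q u assume "u \<in> \<iota> ` T q"
    then obtain r where r: "r \<in> T q" "u = \<iota> r" by blast
    then have "r \<in> S q" using TS by blast
    then show "d' q (frag_of u) \<in> frag_on (\<iota> ` T (q - 1))"
      using f_on[OF t(2)[of "frag_of r" q]] r by (simp add: d)
    show "d' (q - 1) (d' q (frag_of u)) = 0"
      using s'(3)[of "frag_of u" q] \<open>r \<in> S q\<close> r by simp
  qed
  have "chain_equivalence (pair_cx S T d) (pair_cx (\<lambda>q. \<iota> ` S q) (\<lambda>q. \<iota> ` T q) d')
    (\<lambda>q X. \<Union>x\<in>X. cls (\<iota> ` S q) (\<iota> ` T q) (?f x))"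
  proof (rule pair_chain_equivalence[OF S T TS S' T' image_mono[OF TS], where g = "\<lambda>q. ?g"
        and h = "\<lambda>q x. 0" and k = "\<lambda>q x. 0"])
    fix q x
    show "x \<in> frag_on (S q) \<Longrightarrow> ?f (d q x) - d' q (?f x) \<in> frag_on (\<iota> ` T (q - 1))"
      by (simp add: df)
  next
    fix q x assume x: "x \<in> frag_on (\<iota> ` S q)"
    have "?f (d q (?g x)) = d' q x" using df[OF g_on[OF x]] fg[OF x] by simp
    then have "?g (d' q x) = d q (?g x)" by (metis gf)
    then show "?g (d' q x) - d q (?g x) \<in> frag_on (T (q - 1))" by simp
    show "?f (?g x) - (x + (d' (q + 1) 0 + 0)) \<in> frag_on (\<iota> ` T q)"
      using fg[OF x] by (simp add: additive.zero[OF s'(1)])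
  qed (auto simp: fa ga f_on g_on gf additive.zero[OF s(1)] additive_const_zero)
  then show "\<exists>f. chain_equivalence (pair_cx S T d) (pair_cx (\<lambda>q. \<iota> ` S q) (\<lambda>q. \<iota> ` T q) d') f" by blast
qed

text \<open>If a contraction exists up to terms of lower filtration, then iterating it pushes every
  relative cycle down to the bottom of the filtration.\<close>

lemma rel_acyclic_filtration:
  assumes S': "free_cx S' d" and F0: "\<And>q. F 0 q = S q" and Fs: "\<And>q. S' q = (\<Union>p. F p q)"
    and mono: "\<And>p q. F p q \<subseteq> F (Suc p) q"
    and h: "\<And>q. additive (h q)" "\<And>q x. x \<in> frag_on (S' q) \<Longrightarrow> h q x \<in> frag_on (S' (q + 1))"
      "\<And>q x. x \<in> frag_on (S q) \<Longrightarrow> h q x \<in> frag_on (S (q + 1))"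
    and low: "\<And>p q s. s \<in> F (Suc p) q \<Longrightarrow>
       frag_of s - d (q + 1) (h q (frag_of s)) - h (q - 1) (d q (frag_of s)) \<in> frag_on (F p q)"
  shows "rel_acyclic S' S d"
proof -
  note s' = free_cxD[OF S']
  have mono': "F p q \<subseteq> F p' q" if "p \<le> p'" for p p' q
    using lift_Suc_mono_le[of "\<lambda>p. F p q", OF mono that] .
  have red: "\<exists>y\<in>frag_on (S' (q + 1)). x - d (q + 1) y \<in> frag_on (S q)"
    if "x \<in> frag_on (F p q)" "d q x \<in> frag_on (S (q - 1))" for p q x
    using that
  proof (induction p arbitrary: x)
    case 0
    then show ?case by (intro bexI[of _ 0]) (simp_all add: additive.zero[OF s'(1)] F0)
  next
    case (Suc p)
    have x: "x \<in> frag_on (S' q)" using Suc.prems(1) frag_on_mono[of "F (Suc p) q" "S' q" x] Fs by auto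
    have "x - d (q + 1) (h q x) - h (q - 1) (d q x) \<in> frag_on (F p q)"
    proof (rule frag_on_hom[OF _ _ Suc.prems(1)])
      fix s assume "s \<in> F (Suc p) q"
      then show "frag_of s - d (q + 1) (h q (frag_of s)) - h (q - 1) (d q (frag_of s)) \<in> frag_on (F p q)"
        by (rule low)
    next
      show "additive (\<lambda>x. x - d (q + 1) (h q x) - h (q - 1) (d q x))"
        by (intro additive_minus additive_id additive_compose[OF s'(1) h(1)] additive_compose[OF h(1) s'(1)])
    qed
    moreover have "h (q - 1) (d q x) \<in> frag_on (F p q)"
      using h(3)[OF Suc.prems(2)] mono'[of 0 p q] F0 frag_on_mono by simp blast
    ultimately have "x - d (q + 1) (h q x) \<in> frag_on (F p q)"
      using frag_on_add by fastforce
    moreover have "d q (x - d (q + 1) (h q x)) \<in> frag_on (S (q - 1))"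
      using Suc.prems(2) s'(5)[OF h(2)[OF x]] by (simp add: additive.diff[OF s'(1)])
    ultimately obtain y where y: "y \<in> frag_on (S' (q + 1))" "x - d (q + 1) (h q x) - d (q + 1) y \<in> frag_on (S q)"
      using Suc.IH by blast
    then have "h q x + y \<in> frag_on (S' (q + 1))" "x - d (q + 1) (h q x + y) \<in> frag_on (S q)"
      using h(2)[OF x] by (simp_all add: frag_on_add additive.add[OF s'(1)] diff_diff_eq)
    then show ?case by blast
  qed
  have "\<exists>p. x \<in> frag_on (F p q)" if "x \<in> frag_on (S' q)" for x q
    using that
  proof (induction x rule: frag_on_induct)
    case (diff x y)
    then obtain p p' where "x \<in> frag_on (F p q)" "y \<in> frag_on (F p' q)" by blast
    then have "x - y \<in> frag_on (F (max p p') q)"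
      by (meson frag_on_diff frag_on_mono mono' max.cobounded1 max.cobounded2)
    then show ?case by blast
  qed (use Fs in auto)
  then show ?thesis unfolding rel_acyclic_def using red by blast
qed

section \<open>The link of a simplex\<close>

definition down_closed :: "'v set set \<Rightarrow> bool" where
  "down_closed \<Sigma> \<longleftrightarrow> (\<forall>s\<in>\<Sigma>. \<forall>t. t \<subseteq> s \<longrightarrow> t \<in> \<Sigma>)"

definition prefix_vertex :: "'v \<Rightarrow> ('v list \<Rightarrow>\<^sub>0 int) \<Rightarrow> ('v list \<Rightarrow>\<^sub>0 int)" where
  "prefix_vertex v = frag_extend (\<lambda>vs. frag_of (v # vs))"

lemma additive_prefix_vertex: "additive (prefix_vertex v)"
  by (simp add: prefix_vertex_def additive_frag_extend)

lemma prefix_vertex_of [simp]: "prefix_vertex v (frag_of vs) = frag_of (v # vs)"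
  by (simp add: prefix_vertex_def)

lemma additive_ordered_boundary: "additive ordered_boundary"
  by (simp add: ordered_boundary_def additive_frag_extend)

lemma frag_on_UNIV [simp]: "c \<in> frag_on UNIV"
  by (simp add: frag_on_def)

text \<open>The recursion behind all computations with ordered chains: deleting the first vertex leaves \<open>vs\<close>,
  and every later deletion keeps \<open>v\<close> in front with the opposite sign.\<close>

lemma ordered_boundary_Cons:
  "ordered_boundary (frag_of (v # vs)) = frag_of vs - prefix_vertex v (ordered_boundary (frag_of vs))"
proof -
  have "ordered_boundary (frag_of (v # vs)) = frag_of vs +
     (\<Sum>k<length vs. frag_cmul ((-1) ^ Suc k) (frag_of (v # take k vs @ drop (Suc k) vs)))"
    unfolding ordered_boundary_def frag_extend_of length_Cons
    by (subst sum.lessThan_Suc_shift) simp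
  also have "(\<Sum>k<length vs. frag_cmul ((-1) ^ Suc k) (frag_of (v # take k vs @ drop (Suc k) vs)))
    = - prefix_vertex v (ordered_boundary (frag_of vs))"
    unfolding ordered_boundary_def frag_extend_of prefix_vertex_def
    by (simp add: frag_extend_sum frag_extend_cmul o_def flip: sum_negf)
  finally show ?thesis by simp
qed

lemma ordered_boundary_Nil [simp]: "ordered_boundary (frag_of []) = 0"
  by (simp add: ordered_boundary_def)

lemma ordered_boundary_prefix_vertex:
  "ordered_boundary (prefix_vertex v c) = c - prefix_vertex v (ordered_boundary c)"
proof (rule additive_eq_on[where f = "\<lambda>c. ordered_boundary (prefix_vertex v c)"
      and g = "\<lambda>c. c - prefix_vertex v (ordered_boundary c)" and S = UNIV])
  show "additive (\<lambda>x. ordered_boundary (prefix_vertex v x))"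
    by (rule additive_compose[OF additive_ordered_boundary additive_prefix_vertex])
  show "additive (\<lambda>c. c - prefix_vertex v (ordered_boundary c))"
    by (intro additive_minus additive_id additive_compose[OF additive_prefix_vertex additive_ordered_boundary])
qed (simp_all add: ordered_boundary_Cons)

lemma ordered_boundary_boundary: "ordered_boundary (ordered_boundary c) = 0"
proof (rule additive_eq_on[where f = "\<lambda>c. ordered_boundary (ordered_boundary c)"
      and g = "\<lambda>c. 0" and S = UNIV])
  show "additive (\<lambda>x. ordered_boundary (ordered_boundary x))"
    by (rule additive_compose[OF additive_ordered_boundary additive_ordered_boundary])
  show "additive (\<lambda>c. 0 :: 'a list \<Rightarrow>\<^sub>0 int)" by (simp add: additive_def)
  show "ordered_boundary (ordered_boundary (frag_of s)) = 0" for s :: "'a list"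
  proof (induction s)
    case Nil
    then show ?case by (simp add: additive.zero[OF additive_ordered_boundary])
  next
    case (Cons v vs)
    then show ?case
      by (simp add: ordered_boundary_Cons additive.diff[OF additive_ordered_boundary]
          ordered_boundary_prefix_vertex additive.zero[OF additive_prefix_vertex])
  qed
qed simp

lemma ordered_boundary_on:
  assumes "\<And>k. k < length vs \<Longrightarrow> take k vs @ drop (Suc k) vs \<in> S"
  shows "ordered_boundary (frag_of vs) \<in> frag_on S"
  unfolding ordered_boundary_def frag_extend_of
  by (intro frag_on_sum frag_on_cmul) (simp add: assms)

lemma set_delete_subset: "set (take k vs @ drop (Suc k) vs) \<subseteq> set vs"
  using set_take_subset[of k vs] set_drop_subset[of "Suc k" vs] by auto

lemma free_cx_ordered:
  assumes "down_closed \<Sigma>"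
  shows "free_cx (ordered_simplices \<Sigma>) (\<lambda>q. ordered_boundary)"
proof (rule free_cxI[OF additive_ordered_boundary])
  show "ordered_boundary (ordered_boundary (frag_of s)) = 0" for s :: "'a list"
    by (rule ordered_boundary_boundary)
  fix q vs assume vs: "vs \<in> ordered_simplices \<Sigma> q"
  show "ordered_boundary (frag_of vs) \<in> frag_on (ordered_simplices \<Sigma> (q - 1))"
  proof (rule ordered_boundary_on)
    fix k assume "k < length vs"
    moreover have "set (take k vs @ drop (Suc k) vs) \<in> \<Sigma>"
      using assms vs set_delete_subset[of k vs] unfolding down_closed_def ordered_simplices_def by blast
    ultimately show "take k vs @ drop (Suc k) vs \<in> ordered_simplices \<Sigma> (q - 1)"
      using vs by (auto simp: ordered_simplices_def)
  qed
qed

lemma simplicial_pair_eq: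
  "simplicial_pair \<Sigma>1 \<Sigma>2 = pair_cx (ordered_simplices \<Sigma>1) (ordered_simplices \<Sigma>2) (\<lambda>q. ordered_boundary)"
  by (simp add: simplicial_pair_def simplicial_chains_def)

lemma ordered_simplices_mono: "\<Sigma>1 \<subseteq> \<Sigma>2 \<Longrightarrow> ordered_simplices \<Sigma>1 q \<subseteq> ordered_simplices \<Sigma>2 q"
  by (auto simp: ordered_simplices_def)

lemma is_complex_simplicial_pair:
  assumes "down_closed \<Sigma>1" "down_closed \<Sigma>2" "\<Sigma>2 \<subseteq> \<Sigma>1"
  shows "is_complex (simplicial_pair \<Sigma>1 \<Sigma>2)"
  unfolding simplicial_pair_eq
  by (rule is_complex_pair[OF free_cx_ordered[OF assms(1)] free_cx_ordered[OF assms(2)] ordered_simplices_mono[OF assms(3)]])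

lemma down_closed_cost: "down_closed \<Sigma> \<Longrightarrow> down_closed (cost \<Sigma> \<sigma>)"
  by (auto simp: down_closed_def cost_def)

lemma down_closed_link:
  assumes "down_closed \<Sigma>" shows "down_closed (link \<Sigma> \<sigma>)"
  unfolding down_closed_def
proof (intro ballI allI impI)
  fix s t assume s: "s \<in> link \<Sigma> \<sigma>" "t \<subseteq> s"
  moreover have "\<sigma> \<union> t \<subseteq> \<sigma> \<union> s" using s by blast
  ultimately show "t \<in> link \<Sigma> \<sigma>"
    using assms by (auto simp: down_closed_def link_def)
qed

lemma cost_subset: "cost \<Sigma> \<sigma> \<subseteq> \<Sigma>"
  by (auto simp: cost_def)

lemma shift_pair: "shift n (pair_cx S T d) = pair_cx (\<lambda>q. S (q - n)) (\<lambda>q. T (q - n)) (\<lambda>q. d (q - n))"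
  by (simp add: shift_def quot_complex_def free_complex_def diff_right_commute)

text \<open>Prefixing with \<open>v\<close> anticommutes with the boundary modulo chains without \<open>v\<close>; the sign \<open>sg\<close> turns
  it into a chain map. With \<open>\<pi>\<close> the projection to lists without \<open>v\<close>, the inverse sends a list that
  contains \<open>v\<close> to \<open>\<pi>\<close> of its boundary. Prefixing such a list once more is the homotopy, because the boundary of
  \<open>v # vs\<close> is \<open>vs\<close> minus the prefixed boundary of \<open>vs\<close>.\<close>

lemma vertex_link_equivalence:
  fixes v :: 'v
  assumes dc: "down_closed \<Sigma>" and v: "v \<notin> \<sigma>"
  shows "\<exists>f. chain_equivalence (shift 1 (simplicial_pair (link \<Sigma> {v}) (cost (link \<Sigma> {v}) \<sigma>)))
     (simplicial_pair \<Sigma> (cost \<Sigma> (insert v \<sigma>))) f"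
proof -
  define L where "L = link \<Sigma> {v}"
  define sg where "sg q = (if even q then 1 else - 1 :: int)" for q :: int
  have sg1: "sg (q - 1) = - sg q" for q by (simp add: sg_def)
  have sgsg: "frag_cmul (sg q) (frag_cmul (sg q) c) = c" for q and c :: "'v list \<Rightarrow>\<^sub>0 int"
    by (simp add: sg_def)
  have sg2: "sg q * sg q = 1" for q by (simp add: sg_def)
  have cm: "additive (frag_cmul n :: ('v list \<Rightarrow>\<^sub>0 int) \<Rightarrow> _)" for n
    by (simp add: additive_def frag_cmul_distrib2)
  have fc: "frag_cmul n (x - y) = frag_cmul n x - frag_cmul n y" "frag_cmul (- n) x = - frag_cmul n x"
    for n and x y :: "'v list \<Rightarrow>\<^sub>0 int"
    using additive.diff[OF cm] by simp_all
  define \<pi> :: "('v list \<Rightarrow>\<^sub>0 int) \<Rightarrow> ('v list \<Rightarrow>\<^sub>0 int)" where "\<pi> = frag_extend (\<lambda>vs. if v \<in> set vs then 0 else frag_of vs)"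
  let ?d = ordered_boundary and ?p = "prefix_vertex v"
  have pa: "additive \<pi>" by (simp add: \<pi>_def additive_frag_extend)
  note da = additive_ordered_boundary and va = additive_prefix_vertex
  have z: "\<pi> 0 = 0" "?d 0 = 0" "?p 0 = 0"
    by (rule additive.zero[OF pa] additive.zero[OF da] additive.zero[OF va])+
  have mi: "\<pi> (- x) = - \<pi> x" "?d (- x) = - ?d x" "?p (- x) = - ?p x" for x
    by (rule additive.minus[OF pa] additive.minus[OF da] additive.minus[OF va])+
  have df: "\<pi> (x - y) = \<pi> x - \<pi> y" "?d (x - y) = ?d x - ?d y" "?p (x - y) = ?p x - ?p y" for x y
    by (rule additive.diff[OF pa] additive.diff[OF da] additive.diff[OF va])+
  have cmul: "\<pi> (frag_cmul n x) = frag_cmul n (\<pi> x)" "?d (frag_cmul n x) = frag_cmul n (?d x)"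
    "?p (frag_cmul n x) = frag_cmul n (?p x)" for n x
    by (simp_all add: \<pi>_def ordered_boundary_def prefix_vertex_def frag_extend_cmul)
  have p_on: "\<pi> x \<in> frag_on {vs. v \<notin> set vs}" for x
    by (rule frag_on_hom[OF pa, of UNIV]) (auto simp: \<pi>_def)
  have p_id: "\<pi> x = x" if "x \<in> frag_on {vs. v \<notin> set vs}" for x
    by (rule additive_eq_on[OF pa additive_id _ that]) (simp add: \<pi>_def)
  have d_on: "?d x \<in> frag_on {vs. v \<notin> set vs}" if "x \<in> frag_on {vs. v \<notin> set vs}" for x
    by (rule frag_on_hom[OF da ordered_boundary_on that]) (use set_delete_subset in fastforce)
  have pdp: "\<pi> (?d (\<pi> x)) = ?d (\<pi> x)" for x
    by (rule p_id[OF d_on[OF p_on]])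
  have pv: "\<pi> (?p x) = 0" for x
    by (rule frag_extend_zero_on[OF additive_compose[OF pa va], of UNIV]) (simp_all add: \<pi>_def)
  have p_in: "\<pi> x \<in> frag_on (S \<inter> {vs. v \<notin> set vs})" if "x \<in> frag_on S" for x S
    by (rule frag_on_hom[OF pa _ that]) (auto simp: \<pi>_def)
  let ?S = "\<lambda>q. ordered_simplices L (q - 1)" and ?T = "\<lambda>q. ordered_simplices (cost L \<sigma>) (q - 1)"
  let ?S' = "ordered_simplices \<Sigma>" and ?T' = "ordered_simplices (cost \<Sigma> (insert v \<sigma>))"
  have dL: "down_closed L" unfolding L_def by (rule down_closed_link[OF dc])
  have sh: "free_cx (\<lambda>q. S (q - 1)) (\<lambda>q. ?d)" if "free_cx S (\<lambda>q. ?d)" for S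
  proof -
    show ?thesis using that unfolding free_cx_def by blast
  qed
  have cS: "free_cx ?S (\<lambda>q. ?d)" "free_cx ?T (\<lambda>q. ?d)"
    by (rule sh free_cx_ordered down_closed_cost dL)+
  have cS': "free_cx ?S' (\<lambda>q. ?d)" "free_cx ?T' (\<lambda>q. ?d)"
    by (rule free_cx_ordered down_closed_cost dc)+
  have TS: "?T q \<subseteq> ?S q" "?T' q \<subseteq> ?S' q" for q
    by (rule ordered_simplices_mono[OF cost_subset])+
  have mS: "vs \<in> ?S' q \<longleftrightarrow> set vs \<in> \<Sigma> \<and> int (length vs) = q + 1" for vs q
    by (auto simp: ordered_simplices_def)
  have mL: "vs \<in> ordered_simplices L q \<longleftrightarrow> v \<notin> set vs \<and> set vs \<in> \<Sigma> \<and> insert v (set vs) \<in> \<Sigma> \<and> int (length vs) = q + 1" for vs q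
    by (auto simp: ordered_simplices_def L_def link_def)
  have mcL: "vs \<in> ordered_simplices (cost L \<sigma>) q \<longleftrightarrow> vs \<in> ordered_simplices L q \<and> \<not> \<sigma> \<subseteq> set vs" for vs q
    by (auto simp: ordered_simplices_def cost_def)
  have mc: "vs \<in> ?T' q \<longleftrightarrow> vs \<in> ?S' q \<and> \<not> insert v \<sigma> \<subseteq> set vs" for vs q
    by (auto simp: ordered_simplices_def cost_def)
  have nov: "x \<in> frag_on (?T' q)" if "x \<in> frag_on (?S' q)" "x \<in> frag_on {vs. v \<notin> set vs}" for x q
  proof -
    have "x \<in> frag_on (?S' q \<inter> {vs. v \<notin> set vs})" using that by (simp add: frag_on_Int)
    then show ?thesis by (rule frag_on_mono[rotated]) (auto simp: mc)
  qed
  have L_nov: "x \<in> frag_on {vs. v \<notin> set vs}" "x \<in> frag_on (?S' q)" if "x \<in> frag_on (ordered_simplices L q)" for x q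
    by (rule frag_on_mono[OF _ that], use mL mS in blast)+
  let ?f = "\<lambda>q x. frag_cmul (sg q) (?p x)"
  let ?g = "\<lambda>q x. frag_cmul (sg q) (\<pi> (?d (x - \<pi> x)))"
  let ?k = "\<lambda>q x. - ?p (x - \<pi> x)"
  have ya: "additive (\<lambda>x. x - \<pi> x)" by (intro additive_minus additive_id pa)
  have fa: "additive (?f q)" for q by (rule additive_compose[OF cm va])
  have ga: "additive (?g q)" for q
    by (rule additive_compose[OF cm additive_compose[OF pa additive_compose[OF da ya]]])
  have ka: "additive (?k q)" for q :: int
    by (rule additive_uminus[OF additive_compose[OF va ya]])
  \<comment> \<open>A list loses \<open>v\<close> by one deletion only if \<open>v\<close> was the deleted entry; so the face lies in the link.\<close>
  have del: "ws \<in> ordered_simplices L (q - 1)" 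
    if vs: "vs \<in> ?S' q" "v \<in> set vs" and ws: "ws = take k vs @ drop (Suc k) vs" "k < length vs" "v \<notin> set ws" for vs ws q k
  proof -
    have "set vs = insert (vs ! k) (set ws)"
      unfolding ws(1) using id_take_nth_drop[OF ws(2)] by (metis Un_insert_right list.simps(15) set_append)
    then have "set vs = insert v (set ws)" using vs(2) ws(3) by auto
    moreover have "set ws \<in> \<Sigma>"
      using dc vs(1) set_delete_subset[of k vs] unfolding ws(1) down_closed_def mS by blast
    ultimately show ?thesis using vs ws by (auto simp: mL mS)
  qed
  have "chain_equivalence (pair_cx ?S ?T (\<lambda>q. ?d)) (pair_cx ?S' ?T' (\<lambda>q. ?d))
     (\<lambda>q X. \<Union>x\<in>X. cls (?S' q) (?T' q) (?f q x))"
  proof (rule pair_chain_equivalence[OF cS TS(1) cS' TS(2) fa _ _ _ ga _ _ _ _ _ _ ka, where h = "\<lambda>q x. 0"])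
    fix q x assume x: "x \<in> frag_on (?S q)"
    show "?f q x \<in> frag_on (?S' q)"
      by (rule frag_on_hom[OF fa _ x]) (auto intro!: frag_on_cmul simp: mL mS)
    have "?f (q - 1) (?d x) - ?d (?f q x) = - frag_cmul (sg q) x"
      unfolding sg1 cmul ordered_boundary_prefix_vertex fc by (simp del: minus_frag_cmul)
    then show "?f (q - 1) (?d x) - ?d (?f q x) \<in> frag_on (?T' (q - 1))"
      using frag_on_minus[OF frag_on_cmul[OF nov[OF L_nov(2)[OF x] L_nov(1)[OF x]]]] by simp
    show "?g q (?f q x) - (x + (?d 0 + 0)) \<in> frag_on (?T q)"
      using p_id[OF L_nov(1)[OF x]] by (simp add: cmul pv z sg2 ordered_boundary_prefix_vertex df)
  next
    fix q x assume x: "x \<in> frag_on (?T q)"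
    show "?f q x \<in> frag_on (?T' q)"
      by (rule frag_on_hom[OF fa _ x])
        (use v in \<open>auto intro!: frag_on_cmul simp: mL mcL mc mS subset_insert\<close>)
  next
    fix q x assume x: "x \<in> frag_on (?S' q)"
    show "?g q x \<in> frag_on (?S q)"
    proof (rule frag_on_hom[OF ga _ x])
      fix vs assume vs: "vs \<in> ?S' q"
      show "?g q (frag_of vs) \<in> frag_on (?S q)"
      proof (cases "v \<in> set vs")
        case True
        have "?d (frag_of vs) \<in> frag_on {ws. v \<notin> set ws \<longrightarrow> ws \<in> ?S q}"
          by (rule ordered_boundary_on) (use del[OF vs True refl] in blast)
        from p_in[OF this] have "\<pi> (?d (frag_of vs)) \<in> frag_on (?S q)"
          by (rule frag_on_mono[rotated]) auto
        then show ?thesis using True by (simp add: \<pi>_def frag_on_cmul)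
      qed (simp add: \<pi>_def z[unfolded \<pi>_def])
    qed
    have 1: "?d (?d y) = 0" for y :: "'v list \<Rightarrow>\<^sub>0 int" by (rule ordered_boundary_boundary)
    have "?g (q - 1) (?d x) - ?d (?g q x) = 0"
      unfolding sg1 cmul df 1 z pdp mi fc by (simp add: mi z del: minus_frag_cmul)
    then show "?g (q - 1) (?d x) - ?d (?g q x) \<in> frag_on (?T (q - 1))" by simp
    show "?k q x \<in> frag_on (?S' (q + 1))"
      by (rule frag_on_hom[OF ka _ x]) (auto intro!: frag_on_minus simp: \<pi>_def z mS insert_absorb)
    have "?f q (?g q x) - (x + (?d (?k q x) + ?k (q - 1) (?d x))) = - \<pi> x"
      by (simp add: cmul sg2 mi ordered_boundary_prefix_vertex df pdp)
    then show "?f q (?g q x) - (x + (?d (?k q x) + ?k (q - 1) (?d x))) \<in> frag_on (?T' q)"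
      using nov[of "\<pi> x" q] p_on[of x] p_in[OF x] by (simp add: frag_on_minus frag_on_Int)
  next
    fix q x assume x: "x \<in> frag_on (?T' q)"
    show "?g q x \<in> frag_on (?T q)"
    proof (rule frag_on_hom[OF ga _ x])
      fix vs assume vs: "vs \<in> ?T' q"
      then have vs': "vs \<in> ?S' q" by (simp add: mc)
      show "?g q (frag_of vs) \<in> frag_on (?T q)"
      proof (cases "v \<in> set vs")
        case True
        have nsub: "\<not> \<sigma> \<subseteq> set (take k vs @ drop (Suc k) vs)" for k
          using vs True set_delete_subset[of k vs] by (auto simp: mc)
        have "?d (frag_of vs) \<in> frag_on {ws. v \<notin> set ws \<longrightarrow> ws \<in> ?T q}"
          by (rule ordered_boundary_on) (use del[OF vs' True refl] nsub mcL in blast)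
        from p_in[OF this] have "\<pi> (?d (frag_of vs)) \<in> frag_on (?T q)"
          by (rule frag_on_mono[rotated]) auto
        then show ?thesis using True by (simp add: \<pi>_def frag_on_cmul)
      qed (simp add: \<pi>_def z[unfolded \<pi>_def])
    qed
    show "?k q x \<in> frag_on (?T' (q + 1))"
      by (rule frag_on_hom[OF ka _ x]) (auto intro!: frag_on_minus simp: mc \<pi>_def z mS insert_absorb)
  qed (simp_all add: additive_def)
  then show ?thesis
    unfolding simplicial_pair_eq shift_pair L_def by blast
qed

lemma chain_equivalence_refl:
  assumes "is_complex C" shows "chain_equivalence C C (\<lambda>q. id)"
proof -
  note c = is_complexD[OF assms]
  have "cchain_homotopic C C (\<lambda>q. id) (\<lambda>q. id)"
    unfolding cchain_homotopic_def
  proof (intro exI[of _ "\<lambda>q _. \<one>\<^bsub>chains C (q + 1)\<^esub>"] allI conjI ballI)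
    fix q
    interpret K: comm_group "chains C (q + 1)" by (rule c(1))
    interpret L: comm_group "chains C q" by (rule c(1))
    show "(\<lambda>_. \<one>\<^bsub>chains C (q + 1)\<^esub>) \<in> hom (chains C q) (chains C (q + 1))"
      by (simp add: hom_def)
    have "bd C (q + 1) \<one>\<^bsub>chains C (q + 1)\<^esub> = \<one>\<^bsub>chains C q\<^esub>"
      by (rule hom_one[OF c(3) K.is_group L.is_group])
    then show "id x = id x \<otimes>\<^bsub>chains C q\<^esub> (bd C (q + 1) \<one>\<^bsub>chains C (q + 1)\<^esub> \<otimes>\<^bsub>chains C q\<^esub> \<one>\<^bsub>chains C (q - 1 + 1)\<^esub>)"
      if "x \<in> carrier (chains C q)" for x using that by simp
  qed
  moreover have "cchain_map C C (\<lambda>q. id)"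
    by (simp add: cchain_map_def hom_def)
  ultimately show ?thesis unfolding chain_equivalence_def
    by (intro conjI exI[of _ "\<lambda>q. id"]) simp_all
qed

lemma chain_equivalence_shift:
  assumes "chain_equivalence C D f"
  shows "chain_equivalence (shift n C) (shift n D) (\<lambda>q. f (q - n))"
proof -
  have m: "cchain_map (shift n C) (shift n D) (\<lambda>q. f (q - n))" if "cchain_map C D f"
    for C :: "'x ab_complex" and D :: "'y ab_complex" and f
  proof -
    have e: "q - 1 - n = q - n - 1" for q by simp
    show ?thesis using that unfolding cchain_map_def shift_def ab_complex.simps e by blast
  qed
  have h: "cchain_homotopic (shift n C) (shift n C) (\<lambda>q. f (q - n)) (\<lambda>q. id)" if f: "cchain_homotopic C C f (\<lambda>q. id)"
    for C :: "'x ab_complex" and f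
  proof -
    obtain h where h: "\<And>q. h q \<in> hom (chains C q) (chains C (q + 1))"
      "\<And>q x. x \<in> carrier (chains C q) \<Longrightarrow>
             f q x = id x \<otimes>\<^bsub>chains C q\<^esub> (bd C (q + 1) (h q x) \<otimes>\<^bsub>chains C q\<^esub> h (q - 1) (bd C q x))"
      using f unfolding cchain_homotopic_def by blast
    have e: "q + 1 - n = q - n + 1" "q - 1 - n = q - n - 1" for q by simp_all
    show ?thesis unfolding cchain_homotopic_def shift_def ab_complex.simps e
      by (intro exI[of _ "\<lambda>q. h (q - n)"] allI conjI ballI, rule h(1), unfold e, rule h(2))
  qed
  from assms obtain g where g: "cchain_map C D f" "cchain_map D C g"
    "cchain_homotopic C C (\<lambda>q. g q \<circ> f q) (\<lambda>q. id)" "cchain_homotopic D D (\<lambda>q. f q \<circ> g q) (\<lambda>q. id)"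
    by (auto simp: chain_equivalence_def)
  show ?thesis
    unfolding chain_equivalence_def
    using m[OF g(1)] m[OF g(2)] h[OF g(3)] h[OF g(4)] by blast
qed

lemma link_link:
  assumes "down_closed \<Sigma>" "v \<notin> \<sigma>"
  shows "link (link \<Sigma> {v}) \<sigma> = link \<Sigma> (insert v \<sigma>)"
proof -
  have dc: "t \<in> \<Sigma>" if "s \<in> \<Sigma>" "t \<subseteq> s" for s t
    using assms(1) that by (auto simp: down_closed_def)
  show ?thesis
  proof
    show "link (link \<Sigma> {v}) \<sigma> \<subseteq> link \<Sigma> (insert v \<sigma>)"
      by (auto simp: link_def)
    show "link \<Sigma> (insert v \<sigma>) \<subseteq> link (link \<Sigma> {v}) \<sigma>"
    proof
      fix \<tau> assume \<tau>: "\<tau> \<in> link \<Sigma> (insert v \<sigma>)"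
      then have *: "insert v (\<sigma> \<union> \<tau>) \<in> \<Sigma>" "v \<notin> \<tau>" "\<sigma> \<inter> \<tau> = {}" by (auto simp: link_def)
      then have "insert v \<tau> \<in> \<Sigma>" "\<sigma> \<union> \<tau> \<in> \<Sigma>" "\<tau> \<in> \<Sigma>" by (auto intro: dc[OF *(1)])
      then show "\<tau> \<in> link (link \<Sigma> {v}) \<sigma>" using * assms(2) by (auto simp: link_def)
    qed
  qed
qed

text \<open>The link of \<open>\<sigma>\<close> with a vertex added is the link of \<open>\<sigma>\<close> in the link of that vertex, and each vertex
  shifts the degree by one.\<close>

theorem link_equivalence:
  assumes "finite \<sigma>" "down_closed \<Sigma>"
  shows "\<exists>f. chain_equivalence (shift (int (card \<sigma>)) (simplicial_pair (link \<Sigma> \<sigma>) {}))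
     (simplicial_pair \<Sigma> (cost \<Sigma> \<sigma>)) f"
  using assms
proof (induction \<sigma> arbitrary: \<Sigma> rule: finite_induct)
  case empty
  have "link \<Sigma> {} = \<Sigma>" "cost \<Sigma> {} = {}" by (auto simp: link_def cost_def)
  moreover have "shift 0 C = C" for C :: "('a list \<Rightarrow>\<^sub>0 int) set ab_complex" by (simp add: shift_def)
  moreover have "is_complex (simplicial_pair \<Sigma> {})"
    by (rule is_complex_simplicial_pair[OF empty]) (auto simp: down_closed_def)
  ultimately show ?case using chain_equivalence_refl[of "simplicial_pair \<Sigma> {}"]
    by (intro exI[of _ "\<lambda>q. id"]) (simp add: id_def)
next
  case (insert v \<sigma>)
  let ?L = "link \<Sigma> {v}"
  have dL: "down_closed ?L" by (rule down_closed_link[OF insert.prems])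
  have e: "down_closed {}" by (simp add: down_closed_def)
  obtain f where "chain_equivalence (shift (int (card \<sigma>)) (simplicial_pair (link ?L \<sigma>) {}))
      (simplicial_pair ?L (cost ?L \<sigma>)) f" using insert.IH[OF dL] by blast
  from chain_equivalence_shift[OF this, of 1]
  have 1: "chain_equivalence (shift (int (card (insert v \<sigma>))) (simplicial_pair (link \<Sigma> (insert v \<sigma>)) {}))
      (shift 1 (simplicial_pair ?L (cost ?L \<sigma>))) (\<lambda>q. f (q - 1))"
    using insert.hyps by (simp add: link_link[OF insert.prems insert.hyps(2)] shift_def algebra_simps)
  obtain f' where 2: "chain_equivalence (shift 1 (simplicial_pair ?L (cost ?L \<sigma>)))
      (simplicial_pair \<Sigma> (cost \<Sigma> (insert v \<sigma>))) f'"
    using vertex_link_equivalence[OF insert.prems insert.hyps(2)] by blast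
  have "is_complex (shift (int (card (insert v \<sigma>))) (simplicial_pair (link \<Sigma> (insert v \<sigma>)) {}))"
    by (intro is_complex_shift is_complex_simplicial_pair down_closed_link insert.prems e) simp
  moreover have "is_complex (shift 1 (simplicial_pair ?L (cost ?L \<sigma>)))"
    by (intro is_complex_shift is_complex_simplicial_pair dL down_closed_cost cost_subset)
  moreover have "is_complex (simplicial_pair \<Sigma> (cost \<Sigma> (insert v \<sigma>)))"
    by (intro is_complex_simplicial_pair insert.prems down_closed_cost cost_subset)
  ultimately show ?case using chain_equivalence_trans[OF _ _ _ 1 2] by blast
qed

section \<open>Topology of the realization\<close>

definition support :: "('v \<Rightarrow> real) \<Rightarrow> 'v set" where
  "support \<alpha> = {v. \<alpha> v \<noteq> 0}"

lemma classical_points_iff: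
  "\<alpha> \<in> classical_points \<Sigma> \<longleftrightarrow> (\<forall>v. 0 \<le> \<alpha> v \<and> \<alpha> v \<le> 1) \<and> support \<alpha> \<in> \<Sigma> \<and> (\<Sum>v\<in>support \<alpha>. \<alpha> v) = 1"
  by (simp add: classical_points_def support_def)

lemma closed_cell_iff: "\<alpha> \<in> closed_cell \<Sigma> s \<longleftrightarrow> \<alpha> \<in> classical_points \<Sigma> \<and> support \<alpha> \<subseteq> s"
  by (auto simp: closed_cell_def support_def)

lemma topspace_classical_realization: "topspace (classical_realization \<Sigma>) = classical_points \<Sigma>"
proof (rule subset_antisym)
  show "topspace (classical_realization \<Sigma>) \<subseteq> classical_points \<Sigma>"
    using openin_topspace[of "classical_realization \<Sigma>"]
    unfolding openin_classical_realization by (rule conjunct1)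
  have "openin (classical_realization \<Sigma>) (classical_points \<Sigma>)"
    unfolding openin_classical_realization
  proof (intro conjI ballI)
    fix s
    have "classical_points \<Sigma> \<inter> closed_cell \<Sigma> s = topspace (subtopology (powertop_real UNIV) (closed_cell \<Sigma> s))"
      by (auto simp: closed_cell_def)
    then show "openin (subtopology (powertop_real UNIV) (closed_cell \<Sigma> s))
      (classical_points \<Sigma> \<inter> closed_cell \<Sigma> s)"
      by (metis openin_topspace)
  qed simp
  then show "classical_points \<Sigma> \<subseteq> topspace (classical_realization \<Sigma>)"
    by (rule openin_subset)
qed

lemma openin_classical_realization_Int:
  assumes "openin (powertop_real UNIV) U"
  shows "openin (classical_realization \<Sigma>) (U \<inter> classical_points \<Sigma>)"
  unfolding openin_classical_realization
proof (intro conjI ballI)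
  fix s
  have "U \<inter> classical_points \<Sigma> \<inter> closed_cell \<Sigma> s = closed_cell \<Sigma> s \<inter> U" by (auto simp: closed_cell_def)
  then show "openin (subtopology (powertop_real UNIV) (closed_cell \<Sigma> s)) (U \<inter> classical_points \<Sigma> \<inter> closed_cell \<Sigma> s)"
    using assms by (simp add: openin_subtopology_Int2)
qed simp

lemma continuous_map_classical_imp_powertop:
  fixes \<Sigma> :: "'v set set"
  assumes "continuous_map X (classical_realization \<Sigma>) f"
  shows "continuous_map X (powertop_real UNIV) f"
proof -
  have "continuous_map (classical_realization \<Sigma>) (powertop_real UNIV) (\<lambda>x. x)"
    unfolding continuous_map_def
  proof (intro conjI allI impI)
    fix U :: "('v \<Rightarrow> real) set" assume U: "openin (powertop_real UNIV) U"
    have "{x \<in> topspace (classical_realization \<Sigma>). x \<in> U} = U \<inter> classical_points \<Sigma>"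
      by (auto simp: topspace_classical_realization)
    then show "openin (classical_realization \<Sigma>) {x \<in> topspace (classical_realization \<Sigma>). x \<in> U}"
      using openin_classical_realization_Int[OF U] by simp
  qed simp
  from continuous_map_compose[OF assms this] show ?thesis by (simp add: o_def)
qed

lemma closedin_closed_cell:
  assumes s: "s \<in> \<Sigma>" "finite s" and dc: "\<And>t. t \<subseteq> s \<Longrightarrow> t \<in> \<Sigma>"
  shows "closedin (powertop_real UNIV) (closed_cell \<Sigma> s)"
proof -
  have eq: "closed_cell \<Sigma> s = {\<alpha> \<in> topspace (powertop_real UNIV). (\<Sum>v\<in>s. \<alpha> v) \<in> {1}} \<inter>
      (\<Inter>v. {\<alpha> \<in> topspace (powertop_real UNIV). \<alpha> v \<in> {0..1}}) \<inter>
      (\<Inter>v. {\<alpha> \<in> topspace (powertop_real UNIV). \<alpha> v \<in> (if v \<in> s then UNIV else {0})})" (is "_ = ?R")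
  proof (rule Set.set_eqI)
    fix \<alpha> :: "'a \<Rightarrow> real"
    have R: "\<alpha> \<in> ?R \<longleftrightarrow> (\<Sum>v\<in>s. \<alpha> v) = 1 \<and> (\<forall>v. 0 \<le> \<alpha> v \<and> \<alpha> v \<le> 1) \<and> (\<forall>v. v \<notin> s \<longrightarrow> \<alpha> v = 0)"
      by (simp add: if_distrib[of "\<lambda>A. _ \<in> A"] cong: if_cong)
    have sub: "support \<alpha> \<subseteq> s \<longleftrightarrow> (\<forall>v. v \<notin> s \<longrightarrow> \<alpha> v = 0)"
      by (auto simp: support_def)
    show "\<alpha> \<in> closed_cell \<Sigma> s \<longleftrightarrow> \<alpha> \<in> ?R"
    proof (cases "support \<alpha> \<subseteq> s")
      case True
      have "(\<Sum>v\<in>s. \<alpha> v) = (\<Sum>v\<in>support \<alpha>. \<alpha> v)"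
        by (rule sum.mono_neutral_right) (use True s in \<open>auto simp: support_def\<close>)
      then show ?thesis
        using dc[OF True] True sub unfolding R closed_cell_iff classical_points_iff by simp blast
    next
      case False
      then show ?thesis using sub unfolding R closed_cell_iff by blast
    qed
  qed
  have proj: "continuous_map (powertop_real UNIV) euclideanreal (\<lambda>\<alpha>. \<alpha> v)" for v :: 'a
    by (intro continuous_map_product_projection) simp
  have 1: "closedin (powertop_real UNIV) {\<alpha> \<in> topspace (powertop_real UNIV). (\<Sum>v\<in>s. \<alpha> v) \<in> {1}}"
    by (rule closedin_continuous_map_preimage[of _ euclideanreal]) (auto intro!: continuous_map_sum proj s)
  have 2: "closedin (powertop_real UNIV) (\<Inter>v::'a. {\<alpha> \<in> topspace (powertop_real UNIV). \<alpha> v \<in> {0..1}})"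
  proof (rule closedin_Inter)
    fix M assume "M \<in> range (\<lambda>v::'a. {\<alpha> \<in> topspace (powertop_real UNIV). \<alpha> v \<in> {0..1}})"
    then obtain v where M: "M = {\<alpha> \<in> topspace (powertop_real UNIV). \<alpha> v \<in> {0..1}}" by blast
    show "closedin (powertop_real UNIV) M"
      unfolding M by (rule closedin_continuous_map_preimage[OF proj]) simp
  qed blast
  have 3: "closedin (powertop_real UNIV) (\<Inter>v::'a. {\<alpha> \<in> topspace (powertop_real UNIV). \<alpha> v \<in> (if v \<in> s then UNIV else {0})})"
  proof (rule closedin_Inter)
    fix M assume "M \<in> range (\<lambda>v::'a. {\<alpha> \<in> topspace (powertop_real UNIV). \<alpha> v \<in> (if v \<in> s then UNIV else {0})})"
    then obtain v where M: "M = {\<alpha> \<in> topspace (powertop_real UNIV). \<alpha> v \<in> (if v \<in> s then UNIV else {0})}" by blast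
    show "closedin (powertop_real UNIV) M"
      unfolding M by (rule closedin_continuous_map_preimage[OF proj]) simp
  qed blast
  show ?thesis unfolding eq using 1 2 3 by (intro closedin_Int)
qed

lemma closedin_classical_realization_cell:
  assumes C: "closedin (classical_realization \<Sigma>) C" and s: "s \<in> \<Sigma>" "finite s" "\<And>t. t \<subseteq> s \<Longrightarrow> t \<in> \<Sigma>"
  shows "closedin (powertop_real UNIV) (C \<inter> closed_cell \<Sigma> s)"
proof -
  let ?P = "powertop_real UNIV" and ?c = "closed_cell \<Sigma> s"
  have "openin (classical_realization \<Sigma>) (classical_points \<Sigma> - C)"
    using C by (simp add: closedin_def topspace_classical_realization)
  then have "openin (subtopology ?P ?c) ((classical_points \<Sigma> - C) \<inter> ?c)"
    using s(1) by (simp add: openin_classical_realization)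
  moreover have "(classical_points \<Sigma> - C) \<inter> ?c = topspace (subtopology ?P ?c) - C \<inter> ?c"
    by (auto simp: closed_cell_def)
  ultimately have "closedin (subtopology ?P ?c) (C \<inter> ?c)"
    by (simp add: closedin_def)
  then show ?thesis
    using closedin_closed_cell[OF s] by (rule closedin_trans_full)
qed

text \<open>A closed set of the realization meets finitely many closed cells in a set that is closed for the
  coordinates, being a finite union of closed pieces.\<close>

lemma continuous_map_into_classical_realization:
  assumes f: "continuous_map X (powertop_real UNIV) f" and F: "finite F" "F \<subseteq> \<Sigma>"
    and fin: "\<And>s. s \<in> \<Sigma> \<Longrightarrow> finite s" and dc: "\<And>s t. s \<in> \<Sigma> \<Longrightarrow> t \<subseteq> s \<Longrightarrow> t \<in> \<Sigma>"
    and im: "\<And>x. x \<in> topspace X \<Longrightarrow> \<exists>s\<in>F. f x \<in> closed_cell \<Sigma> s"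
  shows "continuous_map X (classical_realization \<Sigma>) f"
  unfolding continuous_map_closedin
proof (intro conjI allI impI)
  show "f \<in> topspace X \<rightarrow> topspace (classical_realization \<Sigma>)"
    using im by (auto simp: topspace_classical_realization closed_cell_def)
  fix C assume C: "closedin (classical_realization \<Sigma>) C"
  have "{x \<in> topspace X. f x \<in> C} = (\<Union>s\<in>F. {x \<in> topspace X. f x \<in> C \<inter> closed_cell \<Sigma> s})"
    using im by auto
  moreover have "closedin X {x \<in> topspace X. f x \<in> C \<inter> closed_cell \<Sigma> s}" if "s \<in> F" for s
    by (rule closedin_continuous_map_preimage[OF f closedin_classical_realization_cell[OF C]])
      (use that F fin dc in auto)
  ultimately show "closedin X {x \<in> topspace X. f x \<in> C}"
    using F by (auto intro: closedin_Union)
qed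

text \<open>Choosing one point in every open cell that the set meets gives a subset all of whose subsets
  are closed; inside a compact set it must be finite.\<close>

lemma compactin_classical_realization_finite:
  assumes S: "compactin (classical_realization \<Sigma>) S"
    and fin: "\<And>s. s \<in> \<Sigma> \<Longrightarrow> finite s"
  shows "finite (support ` S)"
proof -
  let ?K = "classical_realization \<Sigma>" and ?P = "powertop_real UNIV :: ('a \<Rightarrow> real) topology"
  have SK: "S \<subseteq> classical_points \<Sigma>"
    using S compactin_subset_topspace topspace_classical_realization by metis
  define p where "p t = (SOME \<alpha>. \<alpha> \<in> S \<and> support \<alpha> = t)" for t
  have p: "p t \<in> S" "support (p t) = t" if "t \<in> support ` S" for t
    using someI_ex[of "\<lambda>\<alpha>. \<alpha> \<in> S \<and> support \<alpha> = t"] that by (auto simp: p_def)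
  define T where "T = p ` (support ` S)"
  have closed: "closedin ?K T'" if T'T: "T' \<subseteq> T" for T'
  proof -
    have T'pts: "T' \<subseteq> classical_points \<Sigma>" using that p(1) SK by (auto simp: T_def)
    have "openin ?K (classical_points \<Sigma> - T')"
      unfolding openin_classical_realization
    proof (intro conjI ballI)
      fix s assume s: "s \<in> \<Sigma>"
      have "T' \<inter> closed_cell \<Sigma> s \<subseteq> p ` Pow s"
      proof
        fix \<alpha> assume \<alpha>: "\<alpha> \<in> T' \<inter> closed_cell \<Sigma> s"
        then have "\<alpha> \<in> T" using T'T by blast
        then have "\<alpha> \<in> p ` (support ` S)" unfolding T_def .
        then obtain t where t: "t \<in> support ` S" "\<alpha> = p t" by (rule imageE)
        then have "t \<subseteq> s" using \<alpha> p(2)[OF t(1)] by (simp add: closed_cell_iff)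
        then show "\<alpha> \<in> p ` Pow s" using t(2) by blast
      qed
      then have "finite (T' \<inter> closed_cell \<Sigma> s)"
        by (rule finite_subset) (simp add: fin[OF s])
      moreover have "t1_space ?P"
        by (rule Hausdorff_imp_t1_space) (simp add: Hausdorff_space_product_topology)
      ultimately have "closedin ?P (T' \<inter> closed_cell \<Sigma> s)"
        by (simp add: t1_space_closedin_finite)
      then have "openin (subtopology ?P (closed_cell \<Sigma> s)) (closed_cell \<Sigma> s \<inter> (UNIV - T' \<inter> closed_cell \<Sigma> s))"
        by (intro openin_subtopology_Int2) (simp add: closedin_def)
      moreover have "closed_cell \<Sigma> s \<inter> (UNIV - T' \<inter> closed_cell \<Sigma> s) = (classical_points \<Sigma> - T') \<inter> closed_cell \<Sigma> s"
        by (auto simp: closed_cell_def)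
      ultimately show "openin (subtopology ?P (closed_cell \<Sigma> s)) ((classical_points \<Sigma> - T') \<inter> closed_cell \<Sigma> s)"
        by simp
    qed blast
    then show ?thesis using T'pts by (simp add: closedin_def topspace_classical_realization)
  qed
  \<comment> \<open>Each of these open sets contains exactly one of the chosen points, so a finite subcover bounds
    their number.\<close>
  define U where "U t = classical_points \<Sigma> - (T - {p t})" for t
  have "openin ?K (U t)" for t
    using closed[of "T - {p t}"] by (auto simp: U_def closedin_def topspace_classical_realization)
  moreover have "S \<subseteq> \<Union> (U ` (support ` S))"
  proof
    fix \<alpha> assume \<alpha>: "\<alpha> \<in> S"
    show "\<alpha> \<in> \<Union> (U ` (support ` S))"
    proof (cases "\<alpha> \<in> T")
      case True
      then obtain t where "t \<in> support ` S" "\<alpha> = p t" by (auto simp: T_def)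
      then show ?thesis using \<alpha> SK by (auto simp: U_def)
    next
      case False
      then show ?thesis using \<alpha> SK by (auto simp: U_def)
    qed
  qed
  ultimately obtain \<F> where \<F>: "finite \<F>" "\<F> \<subseteq> U ` (support ` S)" "S \<subseteq> \<Union> \<F>"
    using S[unfolded compactin_def, THEN conjunct2, rule_format, of "U ` (support ` S)"] by blast
  obtain J where J: "finite J" "J \<subseteq> support ` S" "\<F> = U ` J"
    using finite_subset_image[OF \<F>(1,2)] by blast
  have "support ` S \<subseteq> J"
  proof
    fix t assume t: "t \<in> support ` S"
    then obtain j where j: "j \<in> J" "p t \<in> U j" using p(1) \<F>(3) J(3) by blast
    then have "p t = p j" using t by (auto simp: U_def T_def)
    then show "t \<in> J" using p(2)[OF t] p(2)[of j] j J(2) by (metis subsetD)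
  qed
  then show ?thesis using J(1) finite_subset by blast
qed

lemma compactin_singular_simplex_image:
  assumes s: "singular_simplex q X s"
  shows "compactin X (s ` standard_simplex q)"
proof -
  have "compactin (subtopology (powertop_real UNIV) (standard_simplex q)) (standard_simplex q)"
    by (simp add: compactin_subtopology compactin_standard_simplex)
  then show ?thesis
    using s image_compactin unfolding singular_simplex_def by blast
qed

text \<open>The image of a singular simplex is compact, hence lies in finitely many cells, and there the weak
  topologies of both complexes are the topology of the coordinates.\<close>

lemma singular_simplex_realization_transfer:
  assumes s: "singular_simplex q (classical_realization \<Sigma>1) s"
    and fin1: "\<And>s. s \<in> \<Sigma>1 \<Longrightarrow> finite s"
    and fin2: "\<And>s. s \<in> \<Sigma>2 \<Longrightarrow> finite s" and dc2: "\<And>s t. s \<in> \<Sigma>2 \<Longrightarrow> t \<subseteq> s \<Longrightarrow> t \<in> \<Sigma>2"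
    and im: "s ` standard_simplex q \<subseteq> classical_points \<Sigma>2"
  shows "singular_simplex q (classical_realization \<Sigma>2) s"
proof -
  have "finite (support ` (s ` standard_simplex q))"
    by (rule compactin_classical_realization_finite[OF compactin_singular_simplex_image[OF s] fin1])
  moreover have "support ` (s ` standard_simplex q) \<subseteq> \<Sigma>2"
    using im by (auto simp: classical_points_iff)
  moreover have "continuous_map (subtopology (powertop_real UNIV) (standard_simplex q)) (powertop_real UNIV) s"
    using s continuous_map_classical_imp_powertop unfolding singular_simplex_def by blast
  ultimately have "continuous_map (subtopology (powertop_real UNIV) (standard_simplex q)) (classical_realization \<Sigma>2) s"
    using im fin2 dc2
    by (intro continuous_map_into_classical_realization[where F = "support ` (s ` standard_simplex q)"])
      (auto simp: closed_cell_iff)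
  then show ?thesis using s by (simp add: singular_simplex_def)
qed

text \<open>A homotopy of subsets of the realization only has to be continuous for the product topology
  on coordinates, provided that it enlarges supports by a fixed finite set: singular chains have
  compact support, and there the two topologies agree.\<close>

lemma realization_deformation_relboundary:
  fixes H :: "real \<Rightarrow> ('v \<Rightarrow> real) \<Rightarrow> ('v \<Rightarrow> real)"
  assumes fin: "\<And>s. s \<in> \<Sigma> \<Longrightarrow> finite s" and dc: "\<And>s t. s \<in> \<Sigma> \<Longrightarrow> t \<subseteq> s \<Longrightarrow> t \<in> \<Sigma>"
    and Y: "Y \<subseteq> classical_points \<Sigma>"
    and H: "continuous_map (prod_topology (top_of_set {0..1}) (subtopology (powertop_real UNIV) Y)) (powertop_real UNIV) (\<lambda>(t, x). H t x)"
    and HY: "\<And>t x. t \<in> {0..1} \<Longrightarrow> x \<in> Y \<Longrightarrow> H t x \<in> Y"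
    and HY': "\<And>t x. t \<in> {0..1} \<Longrightarrow> x \<in> Y' \<Longrightarrow> H t x \<in> Y'"
    and H0: "\<And>x. x \<in> Y \<Longrightarrow> H 0 x = x" and H1: "\<And>x. x \<in> Y \<Longrightarrow> H 1 x \<in> Y'"
    and supp: "finite \<tau>" "\<And>t x. t \<in> {0..1} \<Longrightarrow> x \<in> Y \<Longrightarrow> support (H t x) \<subseteq> support x \<union> \<tau>"
    and c: "singular_relcycle q (subtopology (classical_realization \<Sigma>) Y) Y' c"
  shows "singular_relboundary q (subtopology (classical_realization \<Sigma>) Y) Y' c"
proof -
  let ?K = "classical_realization \<Sigma>" and ?P = "powertop_real UNIV :: ('v \<Rightarrow> real) topology"
  let ?KY = "subtopology ?K Y"
  have c1: "singular_chain q ?KY c" and c2: "singular_chain (q - 1) (subtopology ?KY Y') (chain_boundary q c)"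
    using c by (auto simp: singular_relcycle)
  \<comment> \<open>Restricted to the compact union of the images, the homotopy is continuous for the weak topology
    and homotopy invariance of singular homology applies.\<close>
  define C where "C = (\<Union>s\<in>Poly_Mapping.keys c. s ` standard_simplex q)"
  have simp: "singular_simplex q ?K s" "s ` standard_simplex q \<subseteq> Y" if "s \<in> Poly_Mapping.keys c" for s
    using c1 that by (auto simp: singular_chain_def singular_simplex_subtopology subset_iff image_subset_iff)
  have CY: "C \<subseteq> Y" using simp(2) by (auto simp: C_def)
  have "compactin ?K C"
    unfolding C_def
  proof (rule compactin_Union)
    fix M assume "M \<in> (\<lambda>s. s ` standard_simplex q) ` Poly_Mapping.keys c"
    then obtain s where s: "s \<in> Poly_Mapping.keys c" "M = s ` standard_simplex q" by blast
    show "compactin ?K M"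
      unfolding s(2) by (rule compactin_singular_simplex_image[OF simp(1)[OF s(1)]])
  qed simp
  then have finC: "finite (support ` C)"
    by (rule compactin_classical_realization_finite[OF _ fin])
  let ?X = "subtopology ?KY C"
  have XC: "topspace ?X = C"
    using CY Y by (auto simp: topspace_classical_realization)
  have cX: "singular_chain q ?X c"
    using c1 by (auto simp: singular_chain_subtopology C_def)
  have rel: "singular_relcycle q ?X Y' c"
    unfolding singular_relcycle
    using cX singular_chain_boundary[OF cX] c2 by (simp add: singular_chain_subtopology)
  have contX: "continuous_map ?X (subtopology ?P Y) (\<lambda>x. x)"
  proof -
    have "continuous_map ?K ?P (\<lambda>x. x)"
      by (rule continuous_map_classical_imp_powertop[of ?K \<Sigma>]) simp
    then show ?thesis
      by (auto simp: continuous_map_in_subtopology topspace_classical_realization intro!: continuous_map_from_subtopology)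
  qed
  let ?Q = "prod_topology (top_of_set {0..1::real}) ?X"
  have h1: "continuous_map ?Q ?P (\<lambda>(t, x). H t x)"
  proof -
    have "continuous_map ?Q (prod_topology (top_of_set {0..1}) (subtopology ?P Y)) (\<lambda>(t, x). (t, x))"
      unfolding case_prod_unfold
      by (intro continuous_map_pairedI continuous_map_fst continuous_map_compose[OF continuous_map_snd contX, unfolded o_def])
    from continuous_map_compose[OF this H] show ?thesis by (simp add: o_def case_prod_unfold)
  qed
  have h2: "continuous_map ?Q ?K (\<lambda>(t, x). H t x)"
  proof (rule continuous_map_into_classical_realization[OF h1 _ _ fin dc])
    let ?F = "{u \<in> \<Sigma>. u \<subseteq> (\<Union>(support ` C) \<union> \<tau>)}"
    have "finite (\<Union>(support ` C) \<union> \<tau>)"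
    proof (intro finite_UnI finite_Union finC supp(1))
      fix M assume "M \<in> support ` C"
      then show "finite M" using CY Y fin by (auto simp: classical_points_iff)
    qed
    then show "finite ?F" by (rule rev_finite_subset[OF finite_Pow_iff[THEN iffD2]]) blast
    show "?F \<subseteq> \<Sigma>" by blast
    fix z assume "z \<in> topspace ?Q"
    then obtain t x where z: "z = (t, x)" "t \<in> {0..1}" "x \<in> C" using XC by auto
    then have "H t x \<in> classical_points \<Sigma>" using HY CY Y by blast
    moreover have "support (H t x) \<subseteq> \<Union>(support ` C) \<union> \<tau>"
      using supp(2)[OF z(2), of x] z CY by blast
    ultimately show "\<exists>s\<in>?F. (case z of (t, x) \<Rightarrow> H t x) \<in> closed_cell \<Sigma> s"
      using z(1) by (intro bexI[of _ "support (H t x)"]) (auto simp: closed_cell_iff classical_points_iff)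
  qed
  have h3: "continuous_map ?Q ?KY (\<lambda>(t, x). H t x)"
    using h2 HY CY XC by (auto simp: continuous_map_in_subtopology)
  have "homotopic_with (\<lambda>h. h \<in> Y' \<rightarrow> Y') ?X ?KY (H 0) (H 1)"
    unfolding homotopic_with_def
    by (intro exI[of _ "\<lambda>(t, x). H t x"] conjI h3) (use HY' in auto)
  from homotopic_imp_homologous_rel_chain_maps[OF this rel]
  have "homologous_rel q ?KY Y' (chain_map q (H 0) c) (chain_map q (H 1) c)" .
  moreover have "chain_map q (H 0) c = c"
    by (rule chain_map_id_gen[OF cX]) (use H0 CY XC in auto)
  moreover have "singular_relboundary q ?KY Y' (chain_map q (H 1) c)"
  proof (rule singular_chain_imp_relboundary)
    have "continuous_map ?X ?KY (H 1)"
    proof -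
      have "continuous_map ?X ?Q (\<lambda>x. (1, x))"
        by (intro continuous_map_pairedI) (auto simp: continuous_map_in_subtopology)
      from continuous_map_compose[OF this h3] show ?thesis by (simp add: o_def)
    qed
    then have "continuous_map ?X (subtopology ?KY Y') (H 1)"
      using H1 CY XC by (auto simp: continuous_map_in_subtopology)
    then show "singular_chain q (subtopology ?KY Y') (chain_map q (H 1) c)"
      by (rule singular_chain_chain_map[OF cX])
  qed
  ultimately show ?thesis
    unfolding homologous_rel_def using singular_relboundary_add[of q ?KY Y' "c - chain_map q (H 1) c" "chain_map q (H 1) c"]
    by simp
qed

section \<open>Augmented singular chains of the realization\<close>

abbreviation aug_simplices :: "'v set set \<Rightarrow> int \<Rightarrow> ((nat \<Rightarrow> real) \<Rightarrow> ('v \<Rightarrow> real)) set" where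
  "aug_simplices \<Sigma> \<equiv> aug_singular_simplices alpha0 (realization \<Sigma>)"

abbreviation aug_bd :: "int \<Rightarrow> ('v \<Rightarrow> real) chain \<Rightarrow> ('v \<Rightarrow> real) chain" where
  "aug_bd \<equiv> aug_singular_boundary alpha0"

lemma alpha0_not_classical: "alpha0 \<notin> classical_points \<Sigma>"
  by (simp add: alpha0_def classical_points_def)

lemma forget_add_point:
  assumes "p \<notin> topspace A" shows "forget_point p (add_point p A) = A"
proof -
  have 1: "topspace (add_point p A) - {p} = topspace A"
    using assms by (auto simp: topspace_add_point)
  show ?thesis
    unfolding forget_point_def 1 topology_eq
  proof (intro allI iffI)
    fix U assume "openin (subtopology (add_point p A) (topspace A)) U"
    then show "openin A U" by (auto simp: openin_subtopology openin_add_point)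
  next
    fix U assume U: "openin A U"
    then have "U \<subseteq> topspace A" by (rule openin_subset)
    then have "U \<inter> topspace A = U" by blast
    then show "openin (subtopology (add_point p A) (topspace A)) U"
      using U by (auto simp: openin_subtopology openin_add_point intro!: exI[of _ U])
  qed
qed

lemma aug_singular_simplices_add_point:
  assumes "p \<notin> topspace A"
  shows "aug_singular_simplices p (add_point p A) q =
    (if q < -1 then {} else if q = -1 then {\<lambda>_. p} else singular_simplex_set (nat q) A)"
  by (simp add: aug_singular_simplices_def topspace_add_point forget_add_point[OF assms])

lemma aug_simplices_eq:
  "aug_simplices \<Sigma> q = (if \<Sigma> = {} \<or> q < -1 then {} else if q = -1 then {\<lambda>_. alpha0}
     else singular_simplex_set (nat q) (classical_realization \<Sigma>))"
proof (cases "\<Sigma> = {}")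
  case True
  then show ?thesis by (simp add: realization_def aug_singular_simplices_def)
next
  case False
  then show ?thesis
    by (simp add: realization_def aug_singular_simplices_add_point topspace_classical_realization alpha0_not_classical)
qed

lemma additive_aug_bd: "additive (aug_singular_boundary p q)"
  by (simp add: aug_singular_boundary_def additive_def frag_extend_add chain_boundary_add)

lemma aug_bd_neg: "q < 0 \<Longrightarrow> aug_singular_boundary p q c = 0"
  by (simp add: aug_singular_boundary_def chain_boundary_def)

lemma aug_bd_Suc: "aug_singular_boundary p (int (Suc n)) = chain_boundary (Suc n)"
  by (simp add: aug_singular_boundary_def nat_int del: of_nat_Suc)

lemma aug_bd_aug_bd: 
  assumes "q \<ge> 1 \<Longrightarrow> singular_simplex (nat q) X s"
  shows "aug_singular_boundary p (q - 1) (aug_singular_boundary p q (frag_of s)) = 0"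
proof -
  consider "q \<le> 0" | "q = 1" | n where "q = int (Suc (Suc n))"
    by (metis int_one_le_iff_zero_less linorder_not_less nat_int not0_implies_Suc of_nat_1 of_nat_Suc One_nat_def zero_less_imp_eq_int zero_less_Suc Suc_leI le_less_trans neq0_conv)
  then show ?thesis
  proof cases
    case 1
    then show ?thesis by (simp add: aug_bd_neg)
  next
    case 2
    have "aug_singular_boundary p 0 (chain_boundary 1 (frag_of s)) = 0"
      by (simp add: aug_singular_boundary_def chain_boundary_of frag_extend_add frag_extend_minus frag_extend_diff atMost_Suc)
    then show ?thesis using 2 aug_bd_Suc[of p 0] by simp
  next
    case 3
    then have "singular_chain (Suc (Suc n)) X (frag_of s)"
      using assms nat_int[of "Suc (Suc n)"] by (simp add: singular_chain_of del: of_nat_Suc)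
    from chain_boundary_boundary[OF this]
    have "chain_boundary (Suc n) (chain_boundary (Suc (Suc n)) (frag_of s)) = 0" by simp
    moreover have "q - 1 = int (Suc n)" using 3 by simp
    ultimately show ?thesis unfolding 3 \<open>q - 1 = int (Suc n)\<close> 
      by (metis aug_bd_Suc 3 \<open>q - 1 = int (Suc n)\<close>)
  qed
qed

text \<open>Stated for an arbitrary family because it serves all simplices, the small ones, those in an open
  star and those that avoid a point.\<close>

lemma free_cx_singular_family:
  assumes low: "\<And>q. q < -1 \<Longrightarrow> S q = {}"
    and aug: "S (-1) \<subseteq> {\<lambda>_. p}" "S 0 \<noteq> {} \<Longrightarrow> S (-1) = {\<lambda>_. p}"
    and sing: "\<And>n s. s \<in> S (int n) \<Longrightarrow> singular_simplex n X s"
    and face: "\<And>n k s. s \<in> S (int (Suc n)) \<Longrightarrow> k \<le> Suc n \<Longrightarrow> singular_face (Suc n) k s \<in> S (int n)"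
  shows "free_cx S (aug_singular_boundary p)"
proof (rule free_cxI[OF additive_aug_bd])
  fix q s assume s: "s \<in> S q"
  show "aug_singular_boundary p (q - 1) (aug_singular_boundary p q (frag_of s)) = 0"
    by (rule aug_bd_aug_bd[of q X]) (use s sing[of s "nat q"] in auto)
  consider "q < 0" | "q = 0" | n where "q = int (Suc n)"
    by (metis int_nat_eq linorder_neqE_linordered_idom linorder_not_less nat_0_iff not0_implies_Suc not_less_iff_gr_or_eq)
  then show "aug_singular_boundary p q (frag_of s) \<in> frag_on (S (q - 1))"
  proof cases
    case 1 then show ?thesis by (simp add: aug_bd_neg)
  next
    case 2 then show ?thesis using aug(2) s by (auto simp: aug_singular_boundary_def)
  next
    case 3
    have "chain_boundary (Suc n) (frag_of s) \<in> frag_on (S (int n))"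
      unfolding chain_boundary_of using face s 3
      by (auto intro!: frag_on_sum frag_on_cmul simp del: sum.atMost_Suc of_nat_Suc)
    then show ?thesis unfolding 3 aug_bd_Suc by simp
  qed
qed

text \<open>Small simplices lie in the open star of a vertex. The condition speaks only about coordinates, so
  the small simplices of a subcomplex are its simplices that are small in the whole complex. There is no
  condition in degree \<open>-1\<close>: these are augmented complexes.\<close>

definition small_simplices :: "'v set set \<Rightarrow> int \<Rightarrow> ((nat \<Rightarrow> real) \<Rightarrow> ('v \<Rightarrow> real)) set" where
  "small_simplices \<Sigma> q = {s \<in> aug_simplices \<Sigma> q. 0 \<le> q \<longrightarrow> (\<exists>v. \<forall>x\<in>standard_simplex (nat q). 0 < s x v)}"

definition star_simplices :: "'v set set \<Rightarrow> 'v list \<Rightarrow> int \<Rightarrow> ((nat \<Rightarrow> real) \<Rightarrow> ('v \<Rightarrow> real)) set" where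
  "star_simplices \<Sigma> vs q = {s \<in> small_simplices \<Sigma> q. 0 \<le> q \<longrightarrow> (\<forall>v\<in>set vs. \<forall>x\<in>standard_simplex (nat q). 0 < s x v)}"

lemma aug_simplices_nat: 
  "s \<in> aug_simplices \<Sigma> (int n) \<longleftrightarrow> singular_simplex n (classical_realization \<Sigma>) s"
proof -
  have "\<Sigma> \<noteq> {}" if "singular_simplex n (classical_realization \<Sigma>) s"
    using that singular_simplex_empty[of "classical_realization \<Sigma>"]
    by (auto simp: topspace_classical_realization classical_points_def)
  then show ?thesis by (auto simp: aug_simplices_eq)
qed

lemma singular_face_value:
  assumes "x \<in> standard_simplex n" "k \<le> Suc n"
  shows "singular_face (Suc n) k s x = s (simplical_face k x)" "simplical_face k x \<in> standard_simplex (Suc n)"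
  using assms simplical_face_in_standard_simplex[of "Suc n" k x] by (auto simp: singular_face_def)

lemma free_cx_aug: "free_cx (aug_simplices \<Sigma>) aug_bd"
  by (rule free_cx_singular_family[where X = "classical_realization \<Sigma>"])
    (use singular_simplex_singular_face[of "Suc _" "classical_realization \<Sigma>"] in
      \<open>auto simp: aug_simplices_nat simp del: of_nat_Suc\<close>, auto simp: aug_simplices_eq split: if_splits)

lemma free_cx_star: "free_cx (star_simplices \<Sigma> vs) aug_bd"
proof (rule free_cx_singular_family[where X = "classical_realization \<Sigma>"])
  show "star_simplices \<Sigma> vs q = {}" if "q < -1" for q
    using that by (auto simp: star_simplices_def small_simplices_def aug_simplices_eq)
  show "star_simplices \<Sigma> vs (-1) \<subseteq> {\<lambda>_. alpha0}"
    by (auto simp: star_simplices_def small_simplices_def aug_simplices_eq split: if_splits)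
  show "star_simplices \<Sigma> vs (-1) = {\<lambda>_. alpha0}" if "star_simplices \<Sigma> vs 0 \<noteq> {}"
    using that by (auto simp: star_simplices_def small_simplices_def aug_simplices_eq split: if_splits)
  show "singular_simplex n (classical_realization \<Sigma>) s" if "s \<in> star_simplices \<Sigma> vs (int n)" for n s
    using that by (auto simp: star_simplices_def small_simplices_def aug_simplices_nat)
  fix n k s assume s: "s \<in> star_simplices \<Sigma> vs (int (Suc n))" and k: "k \<le> Suc n"
  have "singular_simplex n (classical_realization \<Sigma>) (singular_face (Suc n) k s)"
    using singular_simplex_singular_face[of "Suc n" "classical_realization \<Sigma>" s k] s k
    by (auto simp: star_simplices_def small_simplices_def aug_simplices_nat simp del: of_nat_Suc)
  moreover have pos: "0 < singular_face (Suc n) k s x v"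
    if "\<forall>x\<in>standard_simplex (Suc n). 0 < s x v" "x \<in> standard_simplex n" for x v
    using that singular_face_value(1)[OF that(2) k, of s] singular_face_value(2)[OF that(2) k] by simp
  ultimately show "singular_face (Suc n) k s \<in> star_simplices \<Sigma> vs (int n)"
    using s by (fastforce simp: star_simplices_def small_simplices_def aug_simplices_nat nat_int simp del: of_nat_Suc)
qed

lemma star_simplices_Nil: "star_simplices \<Sigma> [] = small_simplices \<Sigma>"
  by (auto simp: star_simplices_def)

lemma free_cx_small: "free_cx (small_simplices \<Sigma>) aug_bd"
  using free_cx_star[where vs = "[]"] by (simp add: star_simplices_Nil)

section \<open>Small simplices suffice\<close>

lemma openin_open_star: "openin (classical_realization \<Sigma>) {\<alpha> \<in> classical_points \<Sigma>. 0 < \<alpha> v}"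
proof -
  have "continuous_map (powertop_real UNIV) euclideanreal (\<lambda>\<alpha>. \<alpha> v)"
    by (intro continuous_map_product_projection) simp
  then have "openin (powertop_real UNIV) {\<alpha> \<in> topspace (powertop_real UNIV). \<alpha> v \<in> {0<..}}"
    by (rule openin_continuous_map_preimage) auto
  from openin_classical_realization_Int[OF this, of \<Sigma>] show ?thesis
    by (rule back_subst[of "openin _"]) auto
qed

text \<open>Iterated subdivision makes a chain small. The homotopy between subdivision and the identity is
  natural in the space, so it keeps a small boundary inside the stars that contain it.\<close>

lemma rel_acyclic_small: "rel_acyclic (aug_simplices \<Sigma>) (small_simplices \<Sigma>) aug_bd"
  unfolding rel_acyclic_def
proof (intro allI ballI impI)
  fix q c assume c: "c \<in> frag_on (aug_simplices \<Sigma> q)" and dc: "aug_bd q c \<in> frag_on (small_simplices \<Sigma> (q - 1))"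
  let ?K = "classical_realization \<Sigma>"
  show "\<exists>y\<in>frag_on (aug_simplices \<Sigma> (q + 1)). c - aug_bd (q + 1) y \<in> frag_on (small_simplices \<Sigma> q)"
  proof (cases "q < 0")
    case True
    then have "small_simplices \<Sigma> q = aug_simplices \<Sigma> q" by (auto simp: small_simplices_def)
    then show ?thesis using c
      by (intro bexI[of _ 0]) (simp_all add: additive.zero[OF additive_aug_bd])
  next
    case False
    then obtain n where n: "q = int n" by (metis linorder_not_less nonneg_int_cases)
    define U where "U v = {\<alpha> \<in> classical_points \<Sigma>. 0 < \<alpha> v}" for v
    have aug: "x \<in> frag_on (aug_simplices \<Sigma> (int m)) \<longleftrightarrow> singular_chain m ?K x" for m x
      by (auto simp: frag_on_def singular_chain_def aug_simplices_nat subset_iff)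
    have small: "s \<in> small_simplices \<Sigma> (int m) \<longleftrightarrow> (\<exists>v. singular_simplex m (subtopology ?K (U v)) s)" for m s
    proof -
      have "s x \<in> classical_points \<Sigma>" if "singular_simplex m ?K s" "x \<in> standard_simplex m" for x
        using that by (auto simp: singular_simplex_def continuous_map_def topspace_classical_realization Pi_iff)
      then show ?thesis
        by (auto simp: small_simplices_def aug_simplices_nat singular_simplex_subtopology U_def image_subset_iff)
    qed
    have cs: "singular_chain n ?K c" using c unfolding n aug .
    have cover: "topspace ?K \<subseteq> \<Union> (range U)"
    proof
      fix \<alpha> assume "\<alpha> \<in> topspace ?K"
      then have \<alpha>: "\<alpha> \<in> classical_points \<Sigma>" by (simp add: topspace_classical_realization)
      then have "support \<alpha> \<noteq> {}" by (auto simp: classical_points_iff)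
      then obtain v where "\<alpha> v \<noteq> 0" by (auto simp: support_def)
      moreover have "0 \<le> \<alpha> v" using \<alpha> by (simp add: classical_points_iff)
      ultimately show "\<alpha> \<in> \<Union> (range U)" using \<alpha> by (auto simp: U_def intro!: exI[of _ v])
    qed
    have op: "openin ?K V" if "V \<in> range U" for V
      using that openin_open_star by (auto simp: U_def)
    obtain m where m: "\<And>f. f \<in> Poly_Mapping.keys ((singular_subdivision n ^^ m) c)
          \<Longrightarrow> \<exists>V \<in> range U. f \<in> standard_simplex n \<rightarrow> V"
      using sufficient_iterated_singular_subdivision_exists[OF op cover cs] by (metis order_refl)
    obtain h :: "nat \<Rightarrow> ('a \<Rightarrow> real) chain \<Rightarrow> ('a \<Rightarrow> real) chain" where h: "\<And>p. h p 0 = 0" "\<And>p c1 c2. h p (c1-c2) = h p c1 - h p c2"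
        "\<And>p X c. singular_chain p X c \<Longrightarrow> singular_chain (Suc p) X (h p c)"
        "\<And>p X c. singular_chain p X c
                 \<Longrightarrow> chain_boundary (Suc p) (h p c) + h (p - Suc 0) (chain_boundary p c)
                   = (singular_subdivision p ^^ m) c - c"
      by (rule chain_homotopic_iterated_singular_subdivision[of m]) blast
    have sdc: "singular_chain n ?K ((singular_subdivision n ^^ m) c)"
    proof (induction m)
      case (Suc m) then show ?case by (simp add: singular_chain_singular_subdivision)
    qed (simp add: cs)
    have sd_small: "(singular_subdivision n ^^ m) c \<in> frag_on (small_simplices \<Sigma> q)"
      unfolding frag_on_def n
    proof (intro CollectI subsetI)
      fix s assume s: "s \<in> Poly_Mapping.keys ((singular_subdivision n ^^ m) c)"
      then obtain v where "s \<in> standard_simplex n \<rightarrow> U v" using m by blast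
      then show "s \<in> small_simplices \<Sigma> (int n)"
        using s sdc unfolding small by (auto simp: singular_chain_def singular_simplex_subtopology image_subset_iff Pi_iff)
    qed
    have "h (n - 1) (chain_boundary n c) \<in> frag_on (small_simplices \<Sigma> q)"
    proof (cases n)
      case 0
      then show ?thesis by (simp add: chain_boundary_def h(1))
    next
      case (Suc k)
      have "chain_boundary n c \<in> frag_on (small_simplices \<Sigma> (int k))"
        using dc unfolding n Suc aug_bd_Suc by simp
      then have "h k (chain_boundary n c) \<in> frag_on (small_simplices \<Sigma> (int (Suc k)))"
      proof (induction rule: frag_on_induct)
        case (of s)
        then obtain v where "singular_simplex k (subtopology ?K (U v)) s" unfolding small by blast
        then have "singular_chain (Suc k) (subtopology ?K (U v)) (h k (frag_of s))"
          by (intro h(3)) (simp add: singular_chain_of)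
        then show ?case
          unfolding frag_on_def singular_chain_def using small[of _ "Suc k"] by blast
      qed (auto simp: h(1,2) frag_on_diff)
      then show ?thesis unfolding n Suc by simp
    qed
    moreover have "chain_boundary (Suc n) (h n c) = (singular_subdivision n ^^ m) c - c - h (n - 1) (chain_boundary n c)"
      using h(4)[OF cs] by (simp add: algebra_simps)
    moreover have "aug_bd (q + 1) (- h n c) = - chain_boundary (Suc n) (h n c)"
    proof -
      have "aug_bd (q + 1) (- h n c) = - aug_bd (q + 1) (h n c)" by (rule additive.minus[OF additive_aug_bd])
      moreover have "q + 1 = int (Suc n)" using n by simp
      ultimately show ?thesis by (simp only: aug_bd_Suc)
    qed
    ultimately have "c - aug_bd (q + 1) (- h n c) \<in> frag_on (small_simplices \<Sigma> q)"
      using frag_on_diff[OF sd_small] by simp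
    moreover have "- h n c \<in> frag_on (aug_simplices \<Sigma> (q + 1))"
      using h(3)[OF cs] aug[of _ "Suc n"] n by (auto intro!: frag_on_minus simp: add.commute)
    ultimately show ?thesis by blast
  qed
qed

section \<open>Stars are acyclic\<close>

text \<open>Moving linearly towards \<open>b\<close> stays in the realization as long as no coordinate outside the support
  of the starting point is created.\<close>

lemma classical_points_convex:
  assumes dc: "\<And>s t. s \<in> \<Sigma> \<Longrightarrow> t \<subseteq> s \<Longrightarrow> t \<in> \<Sigma>" and fin: "\<And>s. s \<in> \<Sigma> \<Longrightarrow> finite s"
    and x: "x \<in> classical_points \<Sigma>" and b: "b \<in> classical_points \<Sigma>" "support b \<subseteq> support x" and t: "t \<in> {0..1}"
  shows "(\<lambda>v. (1 - t) * x v + t * b v) \<in> classical_points \<Sigma>"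
    and "support (\<lambda>v. (1 - t) * x v + t * b v) \<subseteq> support x"
proof -
  let ?y = "\<lambda>v. (1 - t) * x v + t * b v"
  have sx: "support x \<in> \<Sigma>" using x by (simp add: classical_points_iff)
  have sum_eq: "(\<Sum>v\<in>support z. z v) = (\<Sum>v\<in>support x. z v)" if "support z \<subseteq> support x" for z
    by (rule sum.mono_neutral_left) (use that fin[OF sx] in \<open>auto simp: support_def\<close>)
  show sy: "support ?y \<subseteq> support x" using b(2) by (auto simp: support_def)
  have "(\<Sum>v\<in>support ?y. ?y v) = (\<Sum>v\<in>support x. ?y v)" by (rule sum_eq[OF sy])
  also have "\<dots> = (1 - t) * (\<Sum>v\<in>support x. x v) + t * (\<Sum>v\<in>support x. b v)"
    by (simp add: sum.distrib sum_distrib_left)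
  also have "\<dots> = 1" using x b sum_eq[OF b(2)] by (simp add: classical_points_iff)
  finally have "(\<Sum>v\<in>support ?y. ?y v) = 1" .
  moreover have "0 \<le> ?y v \<and> ?y v \<le> 1" for v
  proof -
    have "0 \<le> x v" "x v \<le> 1" "0 \<le> b v" "b v \<le> 1" using x b by (auto simp: classical_points_iff)
    then have "0 \<le> (1 - t) * x v" "(1 - t) * x v \<le> (1 - t) * 1" "0 \<le> t * b v" "t * b v \<le> t * 1"
      using t by (auto intro!: mult_left_mono mult_nonneg_nonneg simp del: mult_1_right)
    then show ?thesis by simp
  qed
  ultimately show "?y \<in> classical_points \<Sigma>" using dc[OF sx sy] by (simp add: classical_points_iff)
qed

text \<open>The open star contracts linearly onto the barycentre \<open>b\<close> of the simplex spanned by \<open>vs\<close>. A cycle is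
  thus homologous to a multiple of the constant simplex at \<open>b\<close>; as a cycle of the augmented complex
  this multiple is a boundary or zero.\<close>

lemma rel_acyclic_star:
  assumes dc: "\<And>s t. s \<in> \<Sigma> \<Longrightarrow> t \<subseteq> s \<Longrightarrow> t \<in> \<Sigma>" and fin: "\<And>s. s \<in> \<Sigma> \<Longrightarrow> finite s"
    and vs: "set vs \<in> \<Sigma>" "vs \<noteq> []"
  shows "rel_acyclic (star_simplices \<Sigma> vs) (\<lambda>_. {}) aug_bd"
  unfolding rel_acyclic_def
proof (intro allI ballI impI)
  let ?K = "classical_realization \<Sigma>"
  define Y where "Y = {\<beta> \<in> classical_points \<Sigma>. \<forall>v\<in>set vs. 0 < \<beta> v}"
  define b where "b v = (if v \<in> set vs then 1 / real (card (set vs)) else 0)" for v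
  let ?KY = "subtopology ?K Y"
  have card: "card (set vs) > 0" using vs(2) by (simp add: card_gt_0_iff)
  have sb: "support b = set vs" using card by (auto simp: support_def b_def)
  have "b \<in> classical_points \<Sigma>"
    unfolding classical_points_iff sb using vs(1) card by (auto simp: b_def)
  then have bY: "b \<in> Y" using card by (auto simp: Y_def b_def)
  have star: "s \<in> star_simplices \<Sigma> vs (int n) \<longleftrightarrow> singular_simplex n ?KY s" for n s
  proof -
    have "s x \<in> classical_points \<Sigma>" if "singular_simplex n ?K s" "x \<in> standard_simplex n" for x
      using that by (auto simp: singular_simplex_def continuous_map_def topspace_classical_realization Pi_iff)
    moreover obtain v where "v \<in> set vs" using vs(2) by (cases vs) auto
    ultimately show ?thesis
      by (auto simp: star_simplices_def small_simplices_def aug_simplices_nat singular_simplex_subtopology Y_def image_subset_iff)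
  qed
  then have starc: "x \<in> frag_on (star_simplices \<Sigma> vs (int n)) \<longleftrightarrow> singular_chain n ?KY x" for n x
    by (auto simp: frag_on_def singular_chain_def subset_iff)
  have supp: "support b \<subseteq> support x" if "x \<in> Y" for x
    using that unfolding sb by (auto simp: Y_def support_def)
  have key: "singular_relboundary n ?KY {b} c" if "singular_relcycle n ?KY {b} c" for n c
  proof (rule realization_deformation_relboundary[OF fin dc _ _ _ _ _ _ finite.emptyI _ that,
        where H = "\<lambda>t x v. (1 - t) * x v + t * b v"])
    show "Y \<subseteq> classical_points \<Sigma>" by (auto simp: Y_def)
    show "(\<lambda>v. (1 - t) * x v + t * b v) \<in> Y" if t: "t \<in> {0..1}" and x: "x \<in> Y" for t x
    proof -
      have "0 < (1 - t) * x v + t * b v" if v: "v \<in> set vs" for v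
      proof (cases "t = 1")
        case True then show ?thesis using bY v by (simp add: Y_def)
      next
        case False
        then have "0 < (1 - t) * x v" using t x v by (simp add: Y_def)
        moreover have "0 \<le> t * b v" using t bY v by (intro mult_nonneg_nonneg) (auto simp: Y_def less_imp_le)
        ultimately show ?thesis by simp
      qed
      moreover have "x \<in> classical_points \<Sigma>" "b \<in> classical_points \<Sigma>" using x bY by (auto simp: Y_def)
      ultimately show ?thesis using classical_points_convex(1)[OF dc fin _ _ supp[OF x] t] by (simp add: Y_def)
    qed
    show "support (\<lambda>v. (1 - t) * x v + t * b v) \<subseteq> support x \<union> {}" if t: "t \<in> {0..1}" and x: "x \<in> Y" for t x
      using supp[OF x] by (auto simp: support_def)
    show "continuous_map (prod_topology (top_of_set {0..1}) (subtopology (powertop_real UNIV) Y)) (powertop_real UNIV)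
        (\<lambda>(t, x). \<lambda>v. (1 - t) * x v + t * b v)"
      unfolding continuous_map_componentwise_UNIV case_prod_unfold
    proof
      fix v
      let ?Z = "prod_topology (top_of_set {0..1::real}) (subtopology (powertop_real UNIV) Y)"
      have p1: "continuous_map ?Z euclideanreal fst"
        by (rule continuous_map_into_fulltopology[OF continuous_map_fst])
      have "continuous_map ?Z (powertop_real UNIV) snd"
        by (rule continuous_map_into_fulltopology[OF continuous_map_snd])
      then have p2: "continuous_map ?Z euclideanreal (\<lambda>z. snd z v)"
        by (simp add: continuous_map_componentwise_UNIV)
      show "continuous_map ?Z euclideanreal (\<lambda>z. (1 - fst z) * snd z v + fst z * b v)"
        by (intro continuous_intros p1 p2)
    qed
  qed (auto simp: algebra_simps)
  fix q c assume c: "c \<in> frag_on (star_simplices \<Sigma> vs q)" and "aug_bd q c \<in> frag_on {}"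
  then have dc: "aug_bd q c = 0" by (blast intro: frag_on_empty)
  have "\<exists>y\<in>frag_on (star_simplices \<Sigma> vs (q + 1)). c = aug_bd (q + 1) y"
  proof -
    consider "q < -1" | "q = -1" | "0 \<le> q" by linarith
    then show ?thesis
    proof cases
      case 1
      then have "star_simplices \<Sigma> vs q = {}" by (auto simp: star_simplices_def small_simplices_def aug_simplices_eq)
      then show ?thesis using c frag_on_empty[of c]
        by (intro bexI[of _ 0]) (auto simp: additive.zero[OF additive_aug_bd])
    next
      case 2
      let ?pt = "\<lambda>x\<in>standard_simplex 0. b"
      have pt: "singular_simplex 0 ?KY ?pt"
        using bY by (auto simp: singular_simplex_def topspace_classical_realization Y_def)
      have "\<exists>y\<in>frag_on (star_simplices \<Sigma> vs 0). c = aug_bd 0 y"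
        using c
      proof (induction rule: frag_on_induct)
        case zero then show ?case by (intro bexI[of _ 0]) (auto simp: additive.zero[OF additive_aug_bd])
      next
        case (diff x y)
        then show ?case by (metis additive.diff[OF additive_aug_bd] frag_on_diff)
      next
        case (of s)
        then have "s = (\<lambda>_. alpha0)"
          by (auto simp: 2 star_simplices_def small_simplices_def aug_simplices_eq split: if_splits)
        moreover have "frag_of ?pt \<in> frag_on (star_simplices \<Sigma> vs 0)"
          using pt star[of _ 0] by simp
        ultimately show ?case by (intro bexI[of _ "frag_of ?pt"]) (simp_all add: aug_singular_boundary_def)
      qed
      then show ?thesis using 2 by simp
    next
      case 3
      define n where "n = nat q"
      have 3: "q = int n" using 3 by (simp add: n_def)
      have cs: "singular_chain n ?KY c" using c starc 3 by simp
      have bdc: "chain_boundary n c = 0"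
      proof (cases n)
        case (Suc k) then show ?thesis using dc unfolding 3 Suc aug_bd_Suc by simp
      qed (simp add: chain_boundary_def)
      have "singular_relcycle n ?KY {b} c" using cs bdc by (simp add: singular_relcycle)
      from key[OF this, unfolded singular_relboundary] obtain d e where d: "singular_chain (Suc n) ?KY d"
        and e: "singular_chain n (subtopology ?KY {b}) e" and de: "chain_boundary (Suc n) d + e = c"
        by blast
      have tb: "topspace (subtopology ?KY {b}) = {b}" using bY by (auto simp: topspace_classical_realization Y_def)
      have bde: "chain_boundary n e = 0"
        using de bdc chain_boundary_boundary_alt[OF d] by (metis add_0 chain_boundary_add)
      \<comment> \<open>Over a point, cycles of positive degree bound; in degree \<open>0\<close> the augmentation forces \<open>e = 0\<close>.\<close>
      have "singular_relboundary n (subtopology ?KY {b}) {} e"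
      proof (cases "n = 0")
        case False
        have "singular_relcycle n (subtopology ?KY {b}) {} e" using e bde by (simp add: singular_cycle)
        then have "odd n \<or> e = 0" using iffD1[OF singular_cycle_singleton[OF tb]] False by blast
        then show ?thesis using e iffD2[OF singular_boundary_singleton[OF tb], of n e] by simp
      next
        case True
        have dd: "aug_bd 0 (chain_boundary (Suc 0) d) = 0"
        proof -
          have "d \<in> frag_on (star_simplices \<Sigma> vs (0 + 1))" using d True starc[of d 1] by simp
          from free_cxD(5)[OF free_cx_star this] show ?thesis by (simp add: aug_bd_Suc[of _ 0, simplified])
        qed
        have "aug_bd 0 e = 0"
          using dc de dd 3 True additive.add[OF additive_aug_bd, of alpha0 0 "chain_boundary (Suc 0) d" e] by simp
        moreover obtain k where k: "e = frag_cmul k (frag_of (\<lambda>x\<in>standard_simplex n. b))"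
          using singular_chain_singleton[OF tb] e by blast
        ultimately have "frag_cmul k (frag_of (\<lambda>_. alpha0)) = (0 :: ((nat \<Rightarrow> real) \<Rightarrow> ('a \<Rightarrow> real)) \<Rightarrow>\<^sub>0 int)"
          by (simp add: aug_singular_boundary_def frag_extend_cmul)
        then have "e = 0" using k by simp
        then show ?thesis by simp
      qed
      then obtain d' where d': "singular_chain (Suc n) (subtopology ?KY {b}) d'" "chain_boundary (Suc n) d' = e"
        by (auto simp: singular_boundary)
      have "singular_chain (Suc n) ?KY (d + d')"
        using d singular_chain_subtopology[of "Suc n" ?KY "{b}" d'] d'(1) by (blast intro: singular_chain_add)
      moreover have "chain_boundary (Suc n) (d + d') = c" using de d'(2) by (simp add: chain_boundary_add)
      moreover have "q + 1 = int (Suc n)" using 3 by simp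
      ultimately show ?thesis
        using starc[of "d + d'" "Suc n"] by (intro bexI[of _ "d + d'"]) (simp_all only: aug_bd_Suc)
    qed
  qed
  then show "\<exists>y\<in>frag_on (star_simplices \<Sigma> vs (q + 1)). c - aug_bd (q + 1) y \<in> frag_on {}"
    by (metis cancel_comm_monoid_add_class.diff_cancel frag_on_zero)
qed

section \<open>The double complex of small simplices and vertices\<close>

text \<open>The tensor product of two free groups, realized on pairs of generators.\<close>

definition frag_times :: "('a \<Rightarrow>\<^sub>0 int) \<Rightarrow> ('b \<Rightarrow>\<^sub>0 int) \<Rightarrow> ('a \<times> 'b \<Rightarrow>\<^sub>0 int)" where
  "frag_times c e = frag_extend (\<lambda>s. frag_extend (\<lambda>vs. frag_of (s, vs)) e) c"

lemma additive_frag_times_left: "additive (\<lambda>c. frag_times c e)"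
  by (simp add: frag_times_def additive_frag_extend)

lemma frag_times_of_left: "frag_times (frag_of s) e = frag_extend (\<lambda>vs. frag_of (s, vs)) e"
  by (simp add: frag_times_def)

lemma frag_times_of [simp]: "frag_times (frag_of s) (frag_of vs) = frag_of (s, vs)"
  by (simp add: frag_times_def)

lemma frag_times_of_right: "frag_times c (frag_of vs) = frag_extend (\<lambda>s. frag_of (s, vs)) c"
  by (simp add: frag_times_def)

lemma additive_frag_times_right:
  fixes c :: "'a \<Rightarrow>\<^sub>0 int"
  shows "additive (\<lambda>e :: 'b \<Rightarrow>\<^sub>0 int. frag_times c e)"
proof
  fix e1 e2 :: "'b \<Rightarrow>\<^sub>0 int"
  show "frag_times c (e1 + e2) = frag_times c e1 + frag_times c e2"
    by (rule additive_eq_on[where f = "\<lambda>c. frag_times c (e1 + e2)"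
          and g = "\<lambda>c. frag_times c e1 + frag_times c e2" and S = UNIV])
      (simp_all add: additive_frag_times_left additive_plus frag_times_of_left frag_extend_add)
qed

lemma frag_times_on:
  assumes "c \<in> frag_on P" "e \<in> frag_on Q" "\<And>s vs. s \<in> P \<Longrightarrow> vs \<in> Q \<Longrightarrow> (s, vs) \<in> R"
  shows "frag_times c e \<in> frag_on R"
proof (rule frag_on_hom[OF additive_frag_times_left _ assms(1)])
  fix s assume s: "s \<in> P"
  show "frag_times (frag_of s) e \<in> frag_on R"
    by (rule frag_on_hom[OF additive_frag_times_right _ assms(2)]) (simp add: assms(3)[OF s])
qed

lemma frag_times_zero [simp]: "frag_times 0 e = 0" "frag_times c 0 = 0"
  by (rule additive.zero[OF additive_frag_times_left] additive.zero[OF additive_frag_times_right])+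

definition parity_sign :: "int \<Rightarrow> int" where
  "parity_sign q = (if even q then 1 else - 1)"

lemma parity_sign_simps: "parity_sign (q + 1) = - parity_sign q" "parity_sign q * parity_sign q = 1"
  "parity_sign 0 = 1"
  by (simp_all add: parity_sign_def)

lemma additive_frag_cmul: "additive (frag_cmul n)"
  by (simp add: additive_def frag_cmul_distrib2)

lemma frag_cmul_neg: "frag_cmul (- n) x = - frag_cmul n x"
  by simp

text \<open>A pair \<open>(s, vs)\<close> with \<open>s\<close> of degree \<open>q\<close> has total degree \<open>n = q + length vs\<close>, one more than the sum
  of both degrees. Counted this way, the row \<open>q = -1\<close> and the column \<open>vs = []\<close> sit in their own
  degrees, and the sign \<open>(-1)^(q+1)\<close> is trivial on the row. The degree of \<open>s\<close> is recovered from \<open>n\<close>.\<close>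

definition join_bd :: "int \<Rightarrow> (((nat \<Rightarrow> real) \<Rightarrow> ('v \<Rightarrow> real)) \<times> 'v list \<Rightarrow>\<^sub>0 int) \<Rightarrow>
    (((nat \<Rightarrow> real) \<Rightarrow> ('v \<Rightarrow> real)) \<times> 'v list \<Rightarrow>\<^sub>0 int)" where
  "join_bd n = frag_extend (\<lambda>(s, vs).
     frag_times (aug_bd (n - int (length vs)) (frag_of s)) (frag_of vs) +
     frag_cmul (parity_sign (n - int (length vs) + 1)) (frag_times (frag_of s) (ordered_boundary (frag_of vs))))"

lemma additive_join_bd: "additive (join_bd n)"
  by (simp add: join_bd_def additive_frag_extend)

lemma join_bd_times:
  assumes e: "e \<in> frag_on {vs. int (length vs) = n - q}"
  shows "join_bd n (frag_times c e) =
    frag_times (aug_bd q c) e + frag_cmul (parity_sign (q + 1)) (frag_times c (ordered_boundary e))"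
proof (rule additive_eq_on[where f = "\<lambda>c. join_bd n (frag_times c e)"
      and g = "\<lambda>c. frag_times (aug_bd q c) e + frag_cmul (parity_sign (q + 1)) (frag_times c (ordered_boundary e))" and S = UNIV])
  show "additive (\<lambda>c. join_bd n (frag_times c e))"
    by (rule additive_compose[OF additive_join_bd additive_frag_times_left])
  show "additive (\<lambda>c. frag_times (aug_bd q c) e + frag_cmul (parity_sign (q + 1)) (frag_times c (ordered_boundary e)))"
    by (rule additive_plus[OF additive_compose[OF additive_frag_times_left additive_aug_bd]
          additive_compose[OF additive_frag_cmul additive_frag_times_left]])
  fix s :: "(nat \<Rightarrow> real) \<Rightarrow> ('a \<Rightarrow> real)"
  show "join_bd n (frag_times (frag_of s) e) = frag_times (aug_bd q (frag_of s)) e +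
      frag_cmul (parity_sign (q + 1)) (frag_times (frag_of s) (ordered_boundary e))"
  proof (rule additive_eq_on[OF _ _ _ e, where f = "\<lambda>e. join_bd n (frag_times (frag_of s) e)"
      and g = "\<lambda>e. frag_times (aug_bd q (frag_of s)) e + frag_cmul (parity_sign (q + 1)) (frag_times (frag_of s) (ordered_boundary e))"])
    show "additive (\<lambda>e. join_bd n (frag_times (frag_of s) e))"
      by (rule additive_compose[OF additive_join_bd additive_frag_times_right])
    show "additive (\<lambda>e. frag_times (aug_bd q (frag_of s)) e + frag_cmul (parity_sign (q + 1)) (frag_times (frag_of s) (ordered_boundary e)))"
      by (rule additive_plus[OF additive_frag_times_right additive_compose[OF additive_frag_cmul
            additive_compose[OF additive_frag_times_right additive_ordered_boundary]]])
    fix vs :: "'a list" assume "vs \<in> {vs. int (length vs) = n - q}"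
    then have "n - int (length vs) = q" by simp
    then show "join_bd n (frag_times (frag_of s) (frag_of vs)) = frag_times (aug_bd q (frag_of s)) (frag_of vs) +
      frag_cmul (parity_sign (q + 1)) (frag_times (frag_of s) (ordered_boundary (frag_of vs)))"
      by (simp add: join_bd_def)
  qed
qed simp

definition join_simplices :: "'v set set \<Rightarrow> int \<Rightarrow> (((nat \<Rightarrow> real) \<Rightarrow> ('v \<Rightarrow> real)) \<times> 'v list) set" where
  "join_simplices \<Sigma> n = {(s, vs). set vs \<in> \<Sigma> \<and> s \<in> star_simplices \<Sigma> vs (n - int (length vs))}"

definition row_simplices :: "'v set set \<Rightarrow> int \<Rightarrow> (((nat \<Rightarrow> real) \<Rightarrow> ('v \<Rightarrow> real)) \<times> 'v list) set" where
  "row_simplices \<Sigma> n = (\<lambda>vs. (\<lambda>_. alpha0, vs)) ` ordered_simplices \<Sigma> n"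

definition column_simplices :: "'v set set \<Rightarrow> int \<Rightarrow> (((nat \<Rightarrow> real) \<Rightarrow> ('v \<Rightarrow> real)) \<times> 'v list) set" where
  "column_simplices \<Sigma> n = (\<lambda>s. (s, [])) ` small_simplices \<Sigma> n"

lemma star_simplices_low: "q < -1 \<Longrightarrow> star_simplices \<Sigma> vs q = {}"
  by (auto simp: star_simplices_def small_simplices_def aug_simplices_eq)

lemma star_simplices_aug: "set vs \<in> \<Sigma> \<Longrightarrow> star_simplices \<Sigma> vs (-1) = {\<lambda>_. alpha0}"
  by (auto simp: star_simplices_def small_simplices_def aug_simplices_eq)

lemma star_simplices_antimono: "set ws \<subseteq> set vs \<Longrightarrow> star_simplices \<Sigma> vs q \<subseteq> star_simplices \<Sigma> ws q"
  by (auto simp: star_simplices_def)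

lemma ordered_boundary_faces:
  "ordered_boundary (frag_of vs) \<in> frag_on {ws. set ws \<subseteq> set vs \<and> int (length ws) = int (length vs) - 1}"
  by (rule ordered_boundary_on) (use set_delete_subset in fastforce)

lemma row_eq: "row_simplices \<Sigma> n = {(s, vs) \<in> join_simplices \<Sigma> n. n - int (length vs) < 0}"
proof -
  have "s = (\<lambda>_. alpha0) \<and> q = -1" if "s \<in> star_simplices \<Sigma> vs q" "q < 0" "set vs \<in> \<Sigma>" for s vs q
  proof -
    have "q = -1" using that star_simplices_low[of q \<Sigma> vs] by fastforce
    then show ?thesis using that star_simplices_aug[OF that(3)] by simp
  qed
  note A = this
  show ?thesis
  proof (intro subset_antisym subsetI)
    fix x assume "x \<in> row_simplices \<Sigma> n"
    then obtain vs where vs: "x = (\<lambda>_. alpha0, vs)" "set vs \<in> \<Sigma>" "int (length vs) = n + 1"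
      by (auto simp: row_simplices_def ordered_simplices_def)
    then have "n - int (length vs) = -1" by simp
    then show "x \<in> {(s, vs) \<in> join_simplices \<Sigma> n. n - int (length vs) < 0}"
      using vs star_simplices_aug[OF vs(2)] by (simp add: join_simplices_def)
  next
    fix x assume "x \<in> {(s, vs) \<in> join_simplices \<Sigma> n. n - int (length vs) < 0}"
    then obtain s vs where x: "x = (s, vs)" "set vs \<in> \<Sigma>" "s \<in> star_simplices \<Sigma> vs (n - int (length vs))"
      "n - int (length vs) < 0" by (auto simp: join_simplices_def)
    then have "s = (\<lambda>_. alpha0)" "n - int (length vs) = -1" using A by blast+
    then show "x \<in> row_simplices \<Sigma> n" using x by (auto simp: row_simplices_def ordered_simplices_def)
  qed
qed

lemma column_eq:
  assumes "down_closed \<Sigma>"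
  shows "column_simplices \<Sigma> n = {(s, vs) \<in> join_simplices \<Sigma> n. vs = []}"
proof -
  have "{} \<in> \<Sigma>" if "s \<in> small_simplices \<Sigma> n" for s
  proof -
    have "\<Sigma> \<noteq> {}" using that by (auto simp: small_simplices_def aug_simplices_eq)
    then show ?thesis using assms by (auto simp: down_closed_def)
  qed
  then show ?thesis by (auto simp: column_simplices_def join_simplices_def star_simplices_Nil)
qed

lemma join_bd_of:
  assumes "q = n - int (length vs)"
  shows "join_bd n (frag_of (s, vs)) = frag_times (aug_bd q (frag_of s)) (frag_of vs) +
     frag_cmul (parity_sign (q + 1)) (frag_times (frag_of s) (ordered_boundary (frag_of vs)))"
  using assms by (simp add: join_bd_def)

lemma join_parts:
  assumes dc: "down_closed \<Sigma>" and J: "(s, vs) \<in> join_simplices \<Sigma> n" and q: "q = n - int (length vs)"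
  shows "frag_times (aug_bd q (frag_of s)) (frag_of vs)
      \<in> frag_on {(s', ws). ws = vs \<and> (s', ws) \<in> join_simplices \<Sigma> (n - 1)}"
    and "frag_times (frag_of s) (ordered_boundary (frag_of vs))
      \<in> frag_on {(s', ws). s' = s \<and> int (length ws) = int (length vs) - 1 \<and> (s', ws) \<in> join_simplices \<Sigma> (n - 1)}"
proof -
  have vs: "set vs \<in> \<Sigma>" "s \<in> star_simplices \<Sigma> vs q" using J q by (auto simp: join_simplices_def)
  show "frag_times (aug_bd q (frag_of s)) (frag_of vs)
      \<in> frag_on {(s', ws). ws = vs \<and> (s', ws) \<in> join_simplices \<Sigma> (n - 1)}"
    by (rule frag_times_on[of _ "star_simplices \<Sigma> vs (q - 1)" _ "{vs}"])
      (use vs free_cxD(2)[OF free_cx_star, of "frag_of s" \<Sigma> vs q] in \<open>auto simp: join_simplices_def q algebra_simps\<close>)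
  show "frag_times (frag_of s) (ordered_boundary (frag_of vs))
      \<in> frag_on {(s', ws). s' = s \<and> int (length ws) = int (length vs) - 1 \<and> (s', ws) \<in> join_simplices \<Sigma> (n - 1)}"
  proof (rule frag_times_on[OF _ ordered_boundary_faces, of _ "{s}"])
    fix s' ws assume "s' \<in> {s}" and ws: "ws \<in> {ws. set ws \<subseteq> set vs \<and> int (length ws) = int (length vs) - 1}"
    moreover have "set ws \<in> \<Sigma>" using dc vs(1) ws by (auto simp: down_closed_def)
    moreover have "n - 1 - int (length ws) = q" using ws q by simp
    ultimately show "(s', ws) \<in> {(s', ws). s' = s \<and> int (length ws) = int (length vs) - 1 \<and> (s', ws) \<in> join_simplices \<Sigma> (n - 1)}"
      using vs(2) star_simplices_antimono[of ws vs \<Sigma> q] by (auto simp: join_simplices_def)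
  qed simp
qed

lemma free_cx_join:
  assumes dc: "down_closed \<Sigma>"
  shows "free_cx (join_simplices \<Sigma>) join_bd"
proof (rule free_cxI[OF additive_join_bd])
  fix n x assume "x \<in> join_simplices \<Sigma> n"
  then obtain s vs where x: "x = (s, vs)" "(s, vs) \<in> join_simplices \<Sigma> n" by (cases x) auto
  define q where "q = n - int (length vs)"
  have s: "s \<in> star_simplices \<Sigma> vs q" using x(2) by (auto simp: join_simplices_def q_def)
  note bd = join_bd_of[OF q_def, of s]
  show "join_bd n (frag_of x) \<in> frag_on (join_simplices \<Sigma> (n - 1))"
    unfolding x(1) bd
    by (intro frag_on_add frag_on_cmul; rule frag_on_mono[OF _ join_parts(1)[OF dc x(2) q_def]] frag_on_mono[OF _ join_parts(2)[OF dc x(2) q_def]]) auto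
  have dd: "aug_bd (q - 1) (aug_bd q (frag_of s)) = 0"
    using free_cxD(3)[OF free_cx_star, of "frag_of s" \<Sigma> vs q] s by simp
  have 1: "join_bd (n - 1) (frag_times (aug_bd q (frag_of s)) (frag_of vs)) =
     frag_cmul (parity_sign q) (frag_times (aug_bd q (frag_of s)) (ordered_boundary (frag_of vs)))"
    using join_bd_times[of "frag_of vs" "n - 1" "q - 1" "aug_bd q (frag_of s)"] dd by (simp add: q_def)
  have "ordered_boundary (frag_of vs) \<in> frag_on {ws. int (length ws) = n - 1 - q}"
    by (rule frag_on_mono[OF _ ordered_boundary_faces]) (auto simp: q_def)
  from join_bd_times[OF this]
  have 2: "join_bd (n - 1) (frag_times (frag_of s) (ordered_boundary (frag_of vs))) =
     frag_times (aug_bd q (frag_of s)) (ordered_boundary (frag_of vs))"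
    by (simp add: ordered_boundary_boundary)
  have cm: "join_bd (n - 1) (frag_cmul k y) = frag_cmul k (join_bd (n - 1) y)" for k y
    by (simp add: join_bd_def frag_extend_cmul)
  show "join_bd (n - 1) (join_bd n (frag_of x)) = 0"
    unfolding x(1) bd additive.add[OF additive_join_bd] cm 1 2 parity_sign_simps(1) frag_cmul_neg
      additive.minus[OF additive_join_bd] by (simp add: cm 2 del: minus_frag_cmul)
qed

lemma free_cx_row: assumes "down_closed \<Sigma>" shows "free_cx (row_simplices \<Sigma>) join_bd"
proof (rule free_cxI[OF additive_join_bd])
  note J = free_cxD[OF free_cx_join[OF assms]]
  fix n x assume "x \<in> row_simplices \<Sigma> n"
  then obtain s vs where x: "x = (s, vs)" "(s, vs) \<in> join_simplices \<Sigma> n" "n - int (length vs) < 0"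
    by (auto simp: row_eq)
  show "join_bd (n - 1) (join_bd n (frag_of x)) = 0" using J(3)[of "frag_of x" n] x by simp
  have "frag_times (aug_bd (n - int (length vs)) (frag_of s)) (frag_of vs) = 0"
    using x(3) by (simp add: aug_bd_neg)
  then show "join_bd n (frag_of x) \<in> frag_on (row_simplices \<Sigma> (n - 1))"
    unfolding x(1) join_bd_of[OF refl] 
    by (simp only: add_0) (rule frag_on_cmul, rule frag_on_mono[OF _ join_parts(2)[OF assms x(2) refl]], use x(3) in \<open>auto simp: row_eq\<close>)
qed

lemma free_cx_column: assumes "down_closed \<Sigma>" shows "free_cx (column_simplices \<Sigma>) join_bd"
proof (rule free_cxI[OF additive_join_bd])
  note J = free_cxD[OF free_cx_join[OF assms]]
  fix n x assume "x \<in> column_simplices \<Sigma> n"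
  then obtain s where x: "x = (s, [])" "(s, []) \<in> join_simplices \<Sigma> n"
    by (auto simp: column_eq[OF assms])
  show "join_bd (n - 1) (join_bd n (frag_of x)) = 0" using J(3)[of "frag_of x" n] x by simp
  show "join_bd n (frag_of x) \<in> frag_on (column_simplices \<Sigma> (n - 1))"
    unfolding x(1) join_bd_of[OF refl] 
    by (simp only: ordered_boundary_Nil frag_times_zero frag_cmul_zero2 add_0_right)
      (rule frag_on_mono[OF _ join_parts(1)[OF assms x(2) refl]], auto simp: column_eq[OF assms])
qed

text \<open>A small simplex \<open>s\<close> lies in the open star of some vertex, and prefixing with that vertex contracts
  its row. The chosen vertex depends on \<open>s\<close>, so the contraction disturbs the other part of the
  boundary; but that part has lower singular degree, by which the total complex is filtered.\<close>

lemma rel_acyclic_row: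
  assumes dc: "down_closed \<Sigma>"
  shows "rel_acyclic (join_simplices \<Sigma>) (row_simplices \<Sigma>) join_bd"
proof -
  define l where "l q s = (SOME v. \<forall>x\<in>standard_simplex (nat q). 0 < s x v)"
    for q :: int and s :: "(nat \<Rightarrow> real) \<Rightarrow> ('a \<Rightarrow> real)"
  have ls: "set (l q s # vs) \<in> \<Sigma>" "s \<in> star_simplices \<Sigma> (l q s # vs) q"
    if s: "s \<in> star_simplices \<Sigma> vs q" and q: "0 \<le> q" for s vs q
  proof -
    have ex: "\<exists>v. \<forall>x\<in>standard_simplex (nat q). 0 < s x v"
      using s q by (simp add: star_simplices_def small_simplices_def)
    have l: "\<forall>x\<in>standard_simplex (nat q). 0 < s x (l q s)"
      using someI_ex[OF ex] by (simp add: l_def)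
    show "s \<in> star_simplices \<Sigma> (l q s # vs) q"
      using s l by (simp add: star_simplices_def)
    obtain x where x: "x \<in> standard_simplex (nat q)" using nonempty_standard_simplex by blast
    have "q = int (nat q)" using q by simp
    then have "singular_simplex (nat q) (classical_realization \<Sigma>) s"
      using s aug_simplices_nat[of s \<Sigma> "nat q"] by (simp add: star_simplices_def small_simplices_def)
    then have "s x \<in> classical_points \<Sigma>"
      using x by (auto simp: singular_simplex_def continuous_map_def topspace_classical_realization Pi_iff)
    then have "support (s x) \<in> \<Sigma>" by (simp add: classical_points_iff)
    moreover have "set (l q s # vs) \<subseteq> support (s x)"
      using l s q x by (fastforce simp: support_def star_simplices_def)
    ultimately show "set (l q s # vs) \<in> \<Sigma>" using dc by (auto simp: down_closed_def)
  qed
  define h where "h n = frag_extend (\<lambda>(s, vs). if n - int (length vs) < 0 then 0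
      else frag_cmul (parity_sign (n - int (length vs) + 1)) (frag_of (s, l (n - int (length vs)) s # vs)))" for n
  have ha: "additive (h n)" for n by (simp add: h_def additive_frag_extend)
  have h0: "h n (frag_of (s, vs)) = 0" if "n - int (length vs) < 0" for n s vs
    using that by (simp add: h_def)
  have h1: "h n (frag_of (s, vs)) = frag_cmul (parity_sign (q + 1)) (frag_of (s, l q s # vs))"
    if "q = n - int (length vs)" "0 \<le> q" for n s vs q
    using that by (simp add: h_def)
  \<comment> \<open>The filtration level \<open>p\<close> bounds the singular degree strictly, so level \<open>0\<close> is the row \<open>q = -1\<close>.\<close>
  define F where "F p n = {(s, vs) \<in> join_simplices \<Sigma> n. n - int (length vs) < int p}" for p n
  have hF: "h n x \<in> frag_on (F p (n + 1))" if "x \<in> frag_on (F p n)" for n p x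
  proof (rule frag_on_hom[OF ha _ that])
    fix y assume "y \<in> F p n"
    then obtain s vs where y: "y = (s, vs)" "(s, vs) \<in> join_simplices \<Sigma> n" "n - int (length vs) < int p"
      by (auto simp: F_def)
    show "h n (frag_of y) \<in> frag_on (F p (n + 1))"
    proof (cases "n - int (length vs) < 0")
      case True then show ?thesis by (simp add: y(1) h0)
    next
      case False
      define q where "q = n - int (length vs)"
      have "s \<in> star_simplices \<Sigma> vs q" using y(2) by (auto simp: join_simplices_def q_def)
      from ls[OF this] False have "(s, l q s # vs) \<in> F p (n + 1)"
        using y(3) by (auto simp: F_def join_simplices_def q_def)
      then show ?thesis using h1[OF q_def, of s] False by (simp add: y(1) q_def frag_on_cmul)
    qed
  qed
  have hrow: "h n x = 0" if "x \<in> frag_on (row_simplices \<Sigma> n)" for n x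
    by (rule frag_extend_zero_on[OF ha _ that]) (auto simp: row_eq h0)
  show ?thesis
  proof (rule rel_acyclic_filtration[OF free_cx_join[OF dc], where F = F and h = h])
    show "F 0 n = row_simplices \<Sigma> n" for n by (simp add: F_def row_eq)
    have "\<exists>p. m < int p" for m by (intro exI[of _ "nat (m + 1)"]) simp
    then show UF: "join_simplices \<Sigma> n = (\<Union>p. F p n)" for n
      by (auto simp: F_def)
    show "F p n \<subseteq> F (Suc p) n" for p n by (auto simp: F_def)
    show "h n x \<in> frag_on (row_simplices \<Sigma> (n + 1))" if "x \<in> frag_on (row_simplices \<Sigma> n)" for n x
      using hrow[OF that] by simp
    show "h n x \<in> frag_on (join_simplices \<Sigma> (n + 1))" if "x \<in> frag_on (join_simplices \<Sigma> n)" for n x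
    proof (rule frag_on_hom[OF ha _ that])
      fix y assume "y \<in> join_simplices \<Sigma> n"
      then obtain p where "y \<in> F p n" using UF by blast
      then show "h n (frag_of y) \<in> frag_on (join_simplices \<Sigma> (n + 1))"
        using frag_on_mono[OF _ hF[of "frag_of y" p n]] by (auto simp: F_def)
    qed
    fix p n y assume "y \<in> F (Suc p) n"
    then obtain s vs where y: "y = (s, vs)" "(s, vs) \<in> join_simplices \<Sigma> n" "n - int (length vs) < int (Suc p)"
      by (auto simp: F_def)
    define q where "q = n - int (length vs)"
    have s: "s \<in> star_simplices \<Sigma> vs q" using y(2) by (auto simp: join_simplices_def q_def)
    show "frag_of y - join_bd (n + 1) (h n (frag_of y)) - h (n - 1) (join_bd n (frag_of y)) \<in> frag_on (F p n)"
    proof (cases "q < 0")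
      case True
      then have r: "frag_of y \<in> frag_on (row_simplices \<Sigma> n)" using y by (auto simp: row_eq q_def)
      have "h (n - 1) (join_bd n (frag_of y)) = 0"
        by (rule hrow[OF free_cxD(2)[OF free_cx_row[OF dc] r]])
      moreover have "y \<in> F p n" using True y by (auto simp: F_def q_def)
      ultimately show ?thesis using hrow[OF r] by (simp add: additive.zero[OF additive_join_bd])
    next
      case False
      then have q0: "0 \<le> q" by simp
      define v where "v = l q s"
      define \<epsilon> where "\<epsilon> = parity_sign (q + 1)"
      have \<epsilon>: "frag_cmul \<epsilon> (frag_cmul \<epsilon> x) = x" for x :: "((nat \<Rightarrow> real) \<Rightarrow> 'a \<Rightarrow> real) \<times> 'a list \<Rightarrow>\<^sub>0 int"
        by (simp add: \<epsilon>_def parity_sign_def)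
      have cmJ: "join_bd m (frag_cmul k x) = frag_cmul k (join_bd m x)" for m k x
        by (simp add: join_bd_def frag_extend_cmul)
      have cmh: "h m (frag_cmul k x) = frag_cmul k (h m x)" for m k x
        by (simp add: h_def frag_extend_cmul)
      let ?s = "frag_of s" and ?vs = "frag_of vs" and ?ob = "ordered_boundary (frag_of vs)"
      have hx: "h n (frag_of y) = frag_cmul \<epsilon> (frag_times ?s (prefix_vertex v ?vs))"
        using h1[OF q_def q0] by (simp add: y(1) v_def \<epsilon>_def)
      have "prefix_vertex v ?vs \<in> frag_on {ws. int (length ws) = n + 1 - q}" by (simp add: q_def)
      from join_bd_times[OF this, of ?s]
      have "join_bd (n + 1) (h n (frag_of y)) = frag_cmul \<epsilon> (frag_times (aug_bd q ?s) (prefix_vertex v ?vs) +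
          frag_cmul \<epsilon> (frag_times ?s (?vs - prefix_vertex v ?ob)))"
        by (simp add: hx cmJ \<epsilon>_def ordered_boundary_Cons)
      also have "\<dots> = frag_cmul \<epsilon> (frag_times (aug_bd q ?s) (prefix_vertex v ?vs)) +
          (frag_of y - frag_times ?s (prefix_vertex v ?ob))"
        unfolding frag_cmul_distrib2 \<epsilon> additive.diff[OF additive_frag_times_right] by (simp add: y(1))
      finally have dh: "join_bd (n + 1) (h n (frag_of y)) =
          frag_cmul \<epsilon> (frag_times (aug_bd q ?s) (prefix_vertex v ?vs)) + (frag_of y - frag_times ?s (prefix_vertex v ?ob))" .
      have "h (n - 1) (frag_times ?s ?ob) = frag_cmul \<epsilon> (frag_times ?s (prefix_vertex v ?ob))"
      proof (rule additive_eq_on[OF _ _ _ ordered_boundary_faces, where f = "\<lambda>e. h (n - 1) (frag_times ?s e)"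
            and g = "\<lambda>e. frag_cmul \<epsilon> (frag_times ?s (prefix_vertex v e))"])
        show "additive (\<lambda>e. h (n - 1) (frag_times ?s e))"
          by (rule additive_compose[OF ha additive_frag_times_right])
        show "additive (\<lambda>e. frag_cmul \<epsilon> (frag_times ?s (prefix_vertex v e)))"
          by (rule additive_compose[OF additive_frag_cmul additive_compose[OF additive_frag_times_right additive_prefix_vertex]])
        fix ws assume "ws \<in> {ws. set ws \<subseteq> set vs \<and> int (length ws) = int (length vs) - 1}"
        then have "q = n - 1 - int (length ws)" by (simp add: q_def)
        from h1[OF this q0, of s] show "h (n - 1) (frag_times ?s (frag_of ws)) = frag_cmul \<epsilon> (frag_times ?s (prefix_vertex v (frag_of ws)))"
          by (simp add: \<epsilon>_def v_def)
      qed
      then have hd: "h (n - 1) (join_bd n (frag_of y)) =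
          h (n - 1) (frag_times (aug_bd q ?s) ?vs) + frag_times ?s (prefix_vertex v ?ob)"
        unfolding y(1) join_bd_of[OF q_def] additive.add[OF ha] cmh \<epsilon>_def[symmetric] by (simp only: \<epsilon>)
      have N: "frag_of y - join_bd (n + 1) (h n (frag_of y)) - h (n - 1) (join_bd n (frag_of y)) =
          - frag_cmul \<epsilon> (frag_times (aug_bd q ?s) (prefix_vertex v ?vs)) - h (n - 1) (frag_times (aug_bd q ?s) ?vs)"
        unfolding dh hd by (simp del: minus_frag_cmul)
      have J1: "(s, v # vs) \<in> join_simplices \<Sigma> (n + 1)"
        using ls[OF s q0] by (simp add: join_simplices_def v_def q_def)
      have "frag_times (aug_bd q ?s) (prefix_vertex v ?vs) \<in> frag_on (F p n)"
        unfolding prefix_vertex_of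
        by (rule frag_on_mono[OF _ join_parts(1)[OF dc J1, of q]]) (use y(3) in \<open>auto simp: F_def q_def\<close>)
      moreover have "frag_times (aug_bd q ?s) ?vs \<in> frag_on (F p (n - 1))"
        by (rule frag_on_mono[OF _ join_parts(1)[OF dc y(2) q_def]]) (use y(3) in \<open>auto simp: F_def\<close>)
      then have "h (n - 1) (frag_times (aug_bd q ?s) ?vs) \<in> frag_on (F p n)"
        using hF[of _ p "n - 1"] by simp
      ultimately show ?thesis unfolding N by (intro frag_on_diff frag_on_minus frag_on_cmul)
    qed
  qed (rule ha)
qed

text \<open>The column over a nonempty list of vertices is the augmented singular complex of an open star and
  so has a contraction. The contractions for different lists are unrelated; the error terms have
  shorter lists, and the total complex is filtered by their length.\<close>

lemma rel_acyclic_column: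
  assumes dc: "down_closed \<Sigma>" and fin: "\<And>s. s \<in> \<Sigma> \<Longrightarrow> finite s"
  shows "rel_acyclic (join_simplices \<Sigma>) (column_simplices \<Sigma>) join_bd"
proof -
  have dc': "t \<in> \<Sigma>" if "s \<in> \<Sigma>" "t \<subseteq> s" for s t using dc that by (auto simp: down_closed_def)
  have "\<exists>\<eta>. (\<forall>q. additive (\<eta> q)) \<and> (\<forall>q. \<forall>x\<in>frag_on (star_simplices \<Sigma> vs q).
      \<eta> q x \<in> frag_on (star_simplices \<Sigma> vs (q + 1)) \<and> x - aug_bd (q + 1) (\<eta> q x) - \<eta> (q - 1) (aug_bd q x) = 0)"
    if vs: "set vs \<in> \<Sigma>" "vs \<noteq> []" for vs
  proof -
    have e: "free_cx (\<lambda>_. {}) aug_bd" by (rule free_cxI) (auto simp: additive_aug_bd)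
    have "rel_acyclic (\<lambda>_. {}) (\<lambda>q. {} \<inter> {}) aug_bd"
      by (auto simp: rel_acyclic_def dest!: frag_on_empty intro!: bexI[of _ 0] simp: additive.zero[OF additive_aug_bd])
    note rc = relative_contraction[OF free_cx_star e e empty_subsetI empty_subsetI star_simplices_low
        rel_acyclic_star[OF dc' fin vs] this]
    obtain h where h: "\<And>q. additive (h q)" 
      "\<And>q x. x \<in> frag_on (star_simplices \<Sigma> vs q) \<Longrightarrow> h q x \<in> frag_on (star_simplices \<Sigma> vs (q + 1))"
      "\<And>q x. x \<in> frag_on (star_simplices \<Sigma> vs q) \<Longrightarrow> x - aug_bd (q + 1) (h q x) - h (q - 1) (aug_bd q x) \<in> frag_on {}"
      by (rule rc) blast+
    show ?thesis using h(1,2) frag_on_empty[OF h(3)] by (intro exI[of _ h]) blast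
  qed
  then have "\<exists>\<eta>. \<forall>vs. set vs \<in> \<Sigma> \<and> vs \<noteq> [] \<longrightarrow> (\<forall>q. additive (\<eta> vs q)) \<and> (\<forall>q. \<forall>x\<in>frag_on (star_simplices \<Sigma> vs q).
      \<eta> vs q x \<in> frag_on (star_simplices \<Sigma> vs (q + 1)) \<and> x - aug_bd (q + 1) (\<eta> vs q x) - \<eta> vs (q - 1) (aug_bd q x) = 0)"
    by (intro choice) blast
  then obtain \<eta> where \<eta>a: "\<And>vs q. set vs \<in> \<Sigma> \<Longrightarrow> vs \<noteq> [] \<Longrightarrow> additive (\<eta> vs q)"
    and \<eta>1: "\<And>vs q x. set vs \<in> \<Sigma> \<Longrightarrow> vs \<noteq> [] \<Longrightarrow> x \<in> frag_on (star_simplices \<Sigma> vs q) \<Longrightarrow> \<eta> vs q x \<in> frag_on (star_simplices \<Sigma> vs (q + 1))"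
    and \<eta>2: "\<And>vs q x. set vs \<in> \<Sigma> \<Longrightarrow> vs \<noteq> [] \<Longrightarrow> x \<in> frag_on (star_simplices \<Sigma> vs q) \<Longrightarrow>
        x - aug_bd (q + 1) (\<eta> vs q x) - \<eta> vs (q - 1) (aug_bd q x) = 0"
    by blast
  define h where "h n = frag_extend (\<lambda>(s, vs). if vs = [] then 0
      else frag_times (\<eta> vs (n - int (length vs)) (frag_of s)) (frag_of vs))" for n
  have ha: "additive (h n)" for n by (simp add: h_def additive_frag_extend)
  have h0: "h n (frag_of (s, [])) = 0" for n s by (simp add: h_def)
  have h1: "h n (frag_times c (frag_of vs)) = frag_times (\<eta> vs q c) (frag_of vs)"
    if "q = n - int (length vs)" "set vs \<in> \<Sigma>" "vs \<noteq> []" for n c vs q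
  proof (rule additive_eq_on[where f = "\<lambda>c. h n (frag_times c (frag_of vs))"
        and g = "\<lambda>c. frag_times (\<eta> vs q c) (frag_of vs)" and S = UNIV])
    show "additive (\<lambda>c. h n (frag_times c (frag_of vs)))"
      by (rule additive_compose[OF ha additive_frag_times_left])
    show "additive (\<lambda>c. frag_times (\<eta> vs q c) (frag_of vs))"
      by (rule additive_compose[OF additive_frag_times_left \<eta>a[OF that(2,3)]])
    show "h n (frag_times (frag_of s) (frag_of vs)) = frag_times (\<eta> vs q (frag_of s)) (frag_of vs)" for s
      using that by (simp add: h_def)
  qed simp
  define F where "F p n = {(s, vs) \<in> join_simplices \<Sigma> n. length vs \<le> p}" for p n
  have hF: "h n x \<in> frag_on (F p (n + 1))" if "x \<in> frag_on (F p n)" for n p x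
  proof (rule frag_on_hom[OF ha _ that])
    fix y assume "y \<in> F p n"
    then obtain s vs where y: "y = (s, vs)" "(s, vs) \<in> join_simplices \<Sigma> n" "length vs \<le> p"
      by (auto simp: F_def)
    show "h n (frag_of y) \<in> frag_on (F p (n + 1))"
    proof (cases "vs = []")
      case True then show ?thesis by (simp add: y(1) h0)
    next
      case False
      define q where "q = n - int (length vs)"
      have s: "set vs \<in> \<Sigma>" "frag_of s \<in> frag_on (star_simplices \<Sigma> vs q)" using y(2) by (auto simp: join_simplices_def q_def)
      have "frag_times (\<eta> vs q (frag_of s)) (frag_of vs) \<in> frag_on (F p (n + 1))"
        by (rule frag_times_on[OF \<eta>1[OF s(1) False s(2)], of _ "{vs}"])
          (use s(1) y(3) in \<open>auto simp: F_def join_simplices_def q_def algebra_simps\<close>)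
      then show ?thesis using h1[OF q_def s(1) False, of "frag_of s"] by (simp add: y(1))
    qed
  qed
  have F0: "F 0 n = column_simplices \<Sigma> n" for n by (auto simp: F_def column_eq[OF dc])
  have hcol: "h n x = 0" if "x \<in> frag_on (column_simplices \<Sigma> n)" for n x
    by (rule frag_extend_zero_on[OF ha _ that]) (auto simp: column_eq[OF dc] h0)
  show ?thesis
  proof (rule rel_acyclic_filtration[OF free_cx_join[OF dc], where F = F and h = h])
    show "F 0 n = column_simplices \<Sigma> n" for n by (rule F0)
    show UF: "join_simplices \<Sigma> n = (\<Union>p. F p n)" for n
      by (auto simp: F_def)
    show "F p n \<subseteq> F (Suc p) n" for p n by (auto simp: F_def)
    show "h n x \<in> frag_on (column_simplices \<Sigma> (n + 1))" if "x \<in> frag_on (column_simplices \<Sigma> n)" for n x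
      using hcol[OF that] by simp
    show "h n x \<in> frag_on (join_simplices \<Sigma> (n + 1))" if "x \<in> frag_on (join_simplices \<Sigma> n)" for n x
    proof (rule frag_on_hom[OF ha _ that])
      fix y assume "y \<in> join_simplices \<Sigma> n"
      then obtain p where "y \<in> F p n" using UF by blast
      then show "h n (frag_of y) \<in> frag_on (join_simplices \<Sigma> (n + 1))"
        using frag_on_mono[OF _ hF[of "frag_of y" p n]] by (auto simp: F_def)
    qed
    fix p n y assume "y \<in> F (Suc p) n"
    then obtain s vs where y: "y = (s, vs)" "(s, vs) \<in> join_simplices \<Sigma> n" "length vs \<le> Suc p"
      by (auto simp: F_def)
    define q where "q = n - int (length vs)"
    have s: "s \<in> star_simplices \<Sigma> vs q" and vs: "set vs \<in> \<Sigma>" using y(2) by (auto simp: join_simplices_def q_def)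
    show "frag_of y - join_bd (n + 1) (h n (frag_of y)) - h (n - 1) (join_bd n (frag_of y)) \<in> frag_on (F p n)"
    proof (cases "vs = []")
      case True
      then have r: "frag_of y \<in> frag_on (column_simplices \<Sigma> n)" using y by (auto simp: column_eq[OF dc])
      have "h (n - 1) (join_bd n (frag_of y)) = 0"
        by (rule hcol[OF free_cxD(2)[OF free_cx_column[OF dc] r]])
      moreover have "y \<in> F p n" using True y by (auto simp: F_def)
      ultimately show ?thesis using hcol[OF r] by (simp add: additive.zero[OF additive_join_bd])
    next
      case False
      have cmh: "h m (frag_cmul k x) = frag_cmul k (h m x)" for m k x
        by (simp add: h_def frag_extend_cmul)
      let ?s = "frag_of s" and ?vs = "frag_of vs" and ?ob = "ordered_boundary (frag_of vs)"
      let ?c = "\<eta> vs q ?s"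
      have hx: "h n (frag_of y) = frag_times ?c ?vs"
        using h1[OF q_def vs False, of ?s] by (simp add: y(1))
      have "?vs \<in> frag_on {ws. int (length ws) = n + 1 - (q + 1)}" by (simp add: q_def)
      from join_bd_times[OF this, of ?c]
      have dh: "join_bd (n + 1) (h n (frag_of y)) = frag_times (aug_bd (q + 1) ?c) ?vs +
          frag_cmul (parity_sign (q + 1 + 1)) (frag_times ?c ?ob)"
        unfolding hx .
      have hd: "h (n - 1) (join_bd n (frag_of y)) = frag_times (\<eta> vs (q - 1) (aug_bd q ?s)) ?vs +
          frag_cmul (parity_sign (q + 1)) (h (n - 1) (frag_times ?s ?ob))"
        unfolding y(1) join_bd_of[OF q_def] additive.add[OF ha] cmh
        using h1[of "q - 1" "n - 1" vs "aug_bd q ?s"] vs False by (simp add: q_def)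
      have "frag_times (?s - aug_bd (q + 1) ?c - \<eta> vs (q - 1) (aug_bd q ?s)) ?vs = 0"
        using \<eta>2[OF vs False, of ?s q] s by simp
      then have "frag_of y - frag_times (aug_bd (q + 1) ?c) ?vs - frag_times (\<eta> vs (q - 1) (aug_bd q ?s)) ?vs = 0"
        unfolding additive.diff[OF additive_frag_times_left] by (simp add: y(1))
      then have N: "frag_of y - join_bd (n + 1) (h n (frag_of y)) - h (n - 1) (join_bd n (frag_of y)) =
          - frag_cmul (parity_sign (q + 1 + 1)) (frag_times ?c ?ob) - frag_cmul (parity_sign (q + 1)) (h (n - 1) (frag_times ?s ?ob))"
        unfolding dh hd by (simp add: algebra_simps del: minus_frag_cmul)
      have c: "?c \<in> frag_on (star_simplices \<Sigma> vs (q + 1))" using \<eta>1[OF vs False, of ?s q] s by simp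
      have "frag_times ?c ?ob \<in> frag_on (F p n)"
      proof (rule frag_times_on[OF c ordered_boundary_faces])
        fix s' ws assume s': "s' \<in> star_simplices \<Sigma> vs (q + 1)"
          and ws: "ws \<in> {ws. set ws \<subseteq> set vs \<and> int (length ws) = int (length vs) - 1}"
        then have w: "set ws \<in> \<Sigma>" "n - int (length ws) = q + 1" "length ws \<le> p"
          using dc'[OF vs] y(3) by (auto simp: q_def)
        have "s' \<in> star_simplices \<Sigma> ws (q + 1)"
          using s' ws star_simplices_antimono[of ws vs \<Sigma> "q + 1"] by blast
        then show "(s', ws) \<in> F p n"
          using w(1,3) by (simp add: F_def join_simplices_def w(2))
      qed
      moreover have "frag_times ?s ?ob \<in> frag_on (F p (n - 1))"
        by (rule frag_on_mono[OF _ join_parts(2)[OF dc y(2) q_def]]) (use y(3) in \<open>auto simp: F_def\<close>)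
      then have "h (n - 1) (frag_times ?s ?ob) \<in> frag_on (F p n)"
        using hF[of _ p "n - 1"] by simp
      ultimately show ?thesis unfolding N by (intro frag_on_diff frag_on_minus frag_on_cmul)
    qed
  qed (rule ha)
qed

section \<open>Ordered simplicial chains compute augmental singular homology\<close>

lemma aug_simplices_mono:
  assumes dc: "down_closed \<Sigma>" "down_closed \<Delta>" and fin: "\<And>s. s \<in> \<Sigma> \<Longrightarrow> finite s" and sub: "\<Delta> \<subseteq> \<Sigma>"
  shows "aug_simplices \<Delta> q \<subseteq> aug_simplices \<Sigma> q"
proof (cases "q < 0")
  case True
  then show ?thesis using sub by (auto simp: aug_simplices_eq)
next
  case False
  define n where "n = nat q"
  have q: "q = int n" using False by (simp add: n_def)
  show ?thesis
  proof
    fix s assume "s \<in> aug_simplices \<Delta> q"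
    then have s: "singular_simplex n (classical_realization \<Delta>) s" unfolding q aug_simplices_nat .
    have "s ` standard_simplex n \<subseteq> classical_points \<Delta>"
      using s by (auto simp: singular_simplex_def continuous_map_def topspace_classical_realization Pi_iff)
    moreover have "classical_points \<Delta> \<subseteq> classical_points \<Sigma>"
      using sub by (auto simp: classical_points_iff)
    ultimately have "s ` standard_simplex n \<subseteq> classical_points \<Sigma>" by blast
    then have "singular_simplex n (classical_realization \<Sigma>) s"
      by (intro singular_simplex_realization_transfer[OF s]) (use dc fin sub in \<open>auto simp: down_closed_def\<close>)
    then show "s \<in> aug_simplices \<Sigma> q" unfolding q aug_simplices_nat .
  qed
qed

lemma row_equivalence:
  assumes dc: "down_closed \<Sigma>" "down_closed \<Delta>" and sub: "\<Delta> \<subseteq> \<Sigma>"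
  shows "\<exists>f. chain_equivalence (simplicial_pair \<Sigma> \<Delta>) (pair_cx (row_simplices \<Sigma>) (row_simplices \<Delta>) join_bd) f"
proof -
  have "free_cx (\<lambda>q. (\<lambda>vs. (\<lambda>_. alpha0, vs)) ` ordered_simplices \<Sigma> q) join_bd"
    using free_cx_row[OF dc(1)] unfolding row_simplices_def .
  moreover have "inj (\<lambda>vs :: 'a list. (\<lambda>_ :: nat \<Rightarrow> real. alpha0 :: 'a \<Rightarrow> real, vs))" by (simp add: inj_def)
  moreover have "join_bd q (frag_of (\<lambda>_. alpha0, vs)) =
      frag_extend (frag_of \<circ> (\<lambda>vs. (\<lambda>_. alpha0, vs))) (ordered_boundary (frag_of vs))"
    if "vs \<in> ordered_simplices \<Sigma> q" for q vs
  proof -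
    have "-1 = q - int (length vs)" using that by (simp add: ordered_simplices_def)
    from join_bd_of[OF this] show ?thesis
      by (simp add: aug_bd_neg parity_sign_def frag_times_of_left o_def)
  qed
  ultimately show ?thesis
    unfolding simplicial_pair_eq row_simplices_def
    by (rule rename_equivalence(1)[OF free_cx_ordered[OF dc(1)] free_cx_ordered[OF dc(2)] ordered_simplices_mono[OF sub]])
qed

lemma column_equivalence:
  assumes dc: "down_closed \<Sigma>" "down_closed \<Delta>" and sub: "\<And>q. small_simplices \<Delta> q \<subseteq> small_simplices \<Sigma> q"
  shows "\<exists>f. chain_equivalence (pair_cx (small_simplices \<Sigma>) (small_simplices \<Delta>) aug_bd)
    (pair_cx (column_simplices \<Sigma>) (column_simplices \<Delta>) join_bd) f"
proof -
  have "free_cx (\<lambda>q. (\<lambda>s. (s, [])) ` small_simplices \<Sigma> q) join_bd"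
    using free_cx_column[OF dc(1)] unfolding column_simplices_def .
  moreover have "inj (\<lambda>s :: (nat \<Rightarrow> real) \<Rightarrow> ('a \<Rightarrow> real). (s, [] :: 'a list))" by (simp add: inj_def)
  moreover have "join_bd q (frag_of (s, [])) = frag_extend (frag_of \<circ> (\<lambda>s. (s, []))) (aug_bd q (frag_of s))"
    if "s \<in> small_simplices \<Sigma> q" for q s
    using join_bd_of[of q q "[]" s] by (simp add: frag_times_of_right o_def)
  ultimately show ?thesis
    unfolding column_simplices_def
    by (rule rename_equivalence(1)[OF free_cx_small free_cx_small sub])
qed

text \<open>The zigzag of ordered chains, bottom row, total complex, first column, small chains and all singular
  chains. Every step also restricts to the subcomplex, hence applies to pairs.\<close>

theorem simplicial_singular_equivalence:
  assumes dc: "down_closed \<Sigma>" "down_closed \<Delta>" and fin: "\<And>s. s \<in> \<Sigma> \<Longrightarrow> finite s" and sub: "\<Delta> \<subseteq> \<Sigma>"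
  shows "\<exists>f. chain_equivalence (simplicial_pair \<Sigma> \<Delta>) (pair_cx (aug_simplices \<Sigma>) (aug_simplices \<Delta>) aug_bd) f"
proof -
  have fin': "\<And>s. s \<in> \<Delta> \<Longrightarrow> finite s" using fin sub by blast
  have aug: "aug_simplices \<Delta> q \<subseteq> aug_simplices \<Sigma> q" for q by (rule aug_simplices_mono[OF dc fin sub])
  have small_Int: "(\<lambda>q. aug_simplices \<Delta> q \<inter> small_simplices \<Sigma> q) = small_simplices \<Delta>"
    using aug by (auto simp: small_simplices_def fun_eq_iff)
  have small: "small_simplices \<Delta> q \<subseteq> small_simplices \<Sigma> q" for q
    using aug by (auto simp: small_simplices_def)
  have "star_simplices \<Delta> vs q \<subseteq> star_simplices \<Sigma> vs q" for vs q
    using small by (auto simp: star_simplices_def)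
  then have J: "join_simplices \<Delta> n \<subseteq> join_simplices \<Sigma> n" for n
    using sub by (auto simp: join_simplices_def)
  have row_Int: "(\<lambda>n. join_simplices \<Delta> n \<inter> row_simplices \<Sigma> n) = row_simplices \<Delta>"
    using J by (fastforce simp: row_eq fun_eq_iff)
  have col_Int: "(\<lambda>n. join_simplices \<Delta> n \<inter> column_simplices \<Sigma> n) = column_simplices \<Delta>"
    using J by (fastforce simp: column_eq[OF dc(1)] column_eq[OF dc(2)] fun_eq_iff)
  have row: "row_simplices \<Sigma> n \<subseteq> join_simplices \<Sigma> n" "row_simplices \<Delta> n \<subseteq> row_simplices \<Sigma> n" for n
    using J by (auto simp: row_eq)
  have col: "column_simplices \<Sigma> n \<subseteq> join_simplices \<Sigma> n" "column_simplices \<Delta> n \<subseteq> column_simplices \<Sigma> n" for n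
    using J by (auto simp: column_eq[OF dc(1)] column_eq[OF dc(2)])
  have lowJ: "join_simplices \<Sigma> n = {}" if "n < -1" for n
  proof -
    have "star_simplices \<Sigma> vs (n - int (length vs)) = {}" for vs
      by (rule star_simplices_low) (use that in simp)
    then show ?thesis by (simp add: join_simplices_def)
  qed
  have lowA: "aug_simplices \<Sigma> q = {}" if "q < -1" for q
    using that by (simp add: aug_simplices_eq)
  obtain f1 where f1: "chain_equivalence (simplicial_pair \<Sigma> \<Delta>) (pair_cx (row_simplices \<Sigma>) (row_simplices \<Delta>) join_bd) f1"
    using row_equivalence[OF dc sub] by blast
  obtain f2 where f2: "chain_equivalence (pair_cx (row_simplices \<Sigma>) (row_simplices \<Delta>) join_bd)
      (pair_cx (join_simplices \<Sigma>) (join_simplices \<Delta>) join_bd) f2"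
    using acyclic_inclusion_equivalence[OF free_cx_join[OF dc(1)] free_cx_row[OF dc(1)] free_cx_join[OF dc(2)]
        row(1) J lowJ rel_acyclic_row[OF dc(1)]] rel_acyclic_row[OF dc(2)] unfolding row_Int by blast
  obtain f3 where "chain_equivalence (pair_cx (column_simplices \<Sigma>) (column_simplices \<Delta>) join_bd)
      (pair_cx (join_simplices \<Sigma>) (join_simplices \<Delta>) join_bd) f3"
    using acyclic_inclusion_equivalence[OF free_cx_join[OF dc(1)] free_cx_column[OF dc(1)] free_cx_join[OF dc(2)]
        col(1) J lowJ rel_acyclic_column[OF dc(1) fin]] rel_acyclic_column[OF dc(2) fin'] unfolding col_Int by blast
  then obtain f3' where f3: "chain_equivalence (pair_cx (join_simplices \<Sigma>) (join_simplices \<Delta>) join_bd)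
      (pair_cx (column_simplices \<Sigma>) (column_simplices \<Delta>) join_bd) f3'"
    by (rule chain_equivalence_sym)
  obtain f4 where "chain_equivalence (pair_cx (small_simplices \<Sigma>) (small_simplices \<Delta>) aug_bd)
    (pair_cx (column_simplices \<Sigma>) (column_simplices \<Delta>) join_bd) f4"
    using column_equivalence[OF dc small] by blast
  then obtain f4' where f4: "chain_equivalence (pair_cx (column_simplices \<Sigma>) (column_simplices \<Delta>) join_bd)
      (pair_cx (small_simplices \<Sigma>) (small_simplices \<Delta>) aug_bd) f4'"
    by (rule chain_equivalence_sym)
  have small_aug: "small_simplices \<Sigma> q \<subseteq> aug_simplices \<Sigma> q" for q by (auto simp: small_simplices_def)
  obtain f5 where f5: "chain_equivalence (pair_cx (small_simplices \<Sigma>) (small_simplices \<Delta>) aug_bd)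
      (pair_cx (aug_simplices \<Sigma>) (aug_simplices \<Delta>) aug_bd) f5"
    using acyclic_inclusion_equivalence[OF free_cx_aug free_cx_small free_cx_aug small_aug aug lowA rel_acyclic_small]
      rel_acyclic_small[of \<Delta>] unfolding small_Int by blast
  note i0 = is_complex_simplicial_pair[OF dc sub]
  note i1 = is_complex_pair[OF free_cx_row[OF dc(1)] free_cx_row[OF dc(2)] row(2)]
  note i2 = is_complex_pair[OF free_cx_join[OF dc(1)] free_cx_join[OF dc(2)] J]
  note i3 = is_complex_pair[OF free_cx_column[OF dc(1)] free_cx_column[OF dc(2)] col(2)]
  note i4 = is_complex_pair[OF free_cx_small free_cx_small small]
  note i5 = is_complex_pair[OF free_cx_aug free_cx_aug aug]
  note g2 = chain_equivalence_trans[OF i0 i1 i2 f1 f2]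
  note g3 = chain_equivalence_trans[OF i0 i2 i3 g2 f3]
  note g4 = chain_equivalence_trans[OF i0 i3 i4 g3 f4]
  show ?thesis using chain_equivalence_trans[OF i0 i4 i5 g4 f5] by blast
qed

section \<open>Removing an interior point of a simplex\<close>

lemma continuous_map_Min:
  assumes "finite I" "I \<noteq> {}" "\<And>i. i \<in> I \<Longrightarrow> continuous_map X euclideanreal (f i)"
  shows "continuous_map X euclideanreal (\<lambda>x. Min ((\<lambda>i. f i x) ` I))"
  using assms
proof (induction rule: finite_ne_induct)
  case (insert i I)
  have "(\<lambda>x. Min ((\<lambda>i. f i x) ` insert i I)) = (\<lambda>x. min (f i x) (Min ((\<lambda>i. f i x) ` I)))"
    using insert.hyps by simp
  then show ?case using insert by (simp add: continuous_map_real_min)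
qed simp

text \<open>The largest multiple of \<open>\<alpha>\<close> that lies below \<open>\<beta>\<close> in every coordinate has coefficient
  \<open>ray_ratio \<alpha> \<beta>\<close>, which is one only for \<open>\<beta> = \<alpha>\<close>. Removing the proportion \<open>s\<close> of it and rescaling
  moves \<open>\<beta>\<close> along the ray from \<open>\<alpha>\<close>, at time \<open>1\<close> to a point where a vertex of \<open>\<alpha>\<close> is missing.\<close>

definition ray_ratio :: "('v \<Rightarrow> real) \<Rightarrow> ('v \<Rightarrow> real) \<Rightarrow> real" where
  "ray_ratio \<alpha> \<beta> = Min ((\<lambda>v. \<beta> v / \<alpha> v) ` support \<alpha>)"

definition ray_push :: "('v \<Rightarrow> real) \<Rightarrow> real \<Rightarrow> ('v \<Rightarrow> real) \<Rightarrow> ('v \<Rightarrow> real)" where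
  "ray_push \<alpha> s \<beta> = (\<lambda>v. (\<beta> v - s * ray_ratio \<alpha> \<beta> * \<alpha> v) / (1 - s * ray_ratio \<alpha> \<beta>))"

context
  fixes \<Sigma> :: "'v set set" and \<alpha> :: "'v \<Rightarrow> real"
  assumes dc: "\<And>s t. s \<in> \<Sigma> \<Longrightarrow> t \<subseteq> s \<Longrightarrow> t \<in> \<Sigma>" and fin: "\<And>s. s \<in> \<Sigma> \<Longrightarrow> finite s"
    and \<alpha>: "\<alpha> \<in> classical_points \<Sigma>"
begin

lemma support_alpha: "finite (support \<alpha>)" "support \<alpha> \<noteq> {}" "v \<in> support \<alpha> \<Longrightarrow> 0 < \<alpha> v"
proof -
  have *: "\<forall>v. 0 \<le> \<alpha> v" "support \<alpha> \<in> \<Sigma>" "(\<Sum>v\<in>support \<alpha>. \<alpha> v) = 1"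
    using \<alpha> by (simp_all add: classical_points_iff)
  show "finite (support \<alpha>)" by (rule fin[OF *(2)])
  show "support \<alpha> \<noteq> {}" using *(3) by auto
  show "v \<in> support \<alpha> \<Longrightarrow> 0 < \<alpha> v" using *(1) by (simp add: support_def less_le)
qed

lemma ray_ratio_nonneg:
  assumes "\<beta> \<in> classical_points \<Sigma>" shows "0 \<le> ray_ratio \<alpha> \<beta>"
proof -
  have "0 \<le> \<beta> v / \<alpha> v" for v using assms \<alpha> by (simp add: classical_points_iff)
  then show ?thesis
    unfolding ray_ratio_def using support_alpha(1,2) by (subst Min_ge_iff) auto
qed

lemma ray_ratio_le:
  assumes "\<beta> \<in> classical_points \<Sigma>"
  shows "ray_ratio \<alpha> \<beta> * \<alpha> v \<le> \<beta> v"
proof (cases "v \<in> support \<alpha>")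
  case True
  then have "ray_ratio \<alpha> \<beta> \<le> \<beta> v / \<alpha> v"
    unfolding ray_ratio_def using support_alpha(1) by (intro Min_le) auto
  then show ?thesis using support_alpha(3)[OF True] by (simp add: pos_le_divide_eq)
next
  case False
  then show ?thesis using assms by (simp add: support_def classical_points_iff)
qed

lemma ray_ratio_attained: "\<exists>v\<in>support \<alpha>. ray_ratio \<alpha> \<beta> * \<alpha> v = \<beta> v"
proof -
  have "ray_ratio \<alpha> \<beta> \<in> (\<lambda>v. \<beta> v / \<alpha> v) ` support \<alpha>"
    unfolding ray_ratio_def using support_alpha(1,2) by (intro Min_in) auto
  then obtain v where "v \<in> support \<alpha>" "ray_ratio \<alpha> \<beta> = \<beta> v / \<alpha> v" by blast
  then show ?thesis using support_alpha(3)[of v] by (intro bexI[of _ v]) simp_all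
qed

lemma ray_ratio_zero:
  assumes \<beta>: "\<beta> \<in> classical_points \<Sigma>" and n: "\<not> support \<alpha> \<subseteq> support \<beta>"
  shows "ray_ratio \<alpha> \<beta> = 0"
proof -
  obtain v where v: "v \<in> support \<alpha>" "\<beta> v = 0" using n by (auto simp: support_def)
  then have "ray_ratio \<alpha> \<beta> * \<alpha> v \<le> 0" using ray_ratio_le[OF \<beta>, of v] by simp
  then have "ray_ratio \<alpha> \<beta> \<le> 0" using support_alpha(3)[OF v(1)] by (simp add: mult_le_0_iff)
  then show ?thesis using ray_ratio_nonneg[OF \<beta>] by simp
qed

text \<open>If \<open>\<alpha> \<le> \<beta>\<close> in every coordinate, then \<open>\<alpha> = \<beta>\<close>, since both have coordinate sum one.\<close>

lemma ray_ratio_less_one: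
  assumes \<beta>: "\<beta> \<in> classical_points \<Sigma>" "\<beta> \<noteq> \<alpha>"
  shows "ray_ratio \<alpha> \<beta> < 1"
proof (rule ccontr)
  assume "\<not> ray_ratio \<alpha> \<beta> < 1"
  then have r: "1 \<le> ray_ratio \<alpha> \<beta>" by simp
  have ge: "\<alpha> v \<le> \<beta> v" for v
  proof -
    have "0 \<le> \<alpha> v" using \<alpha> by (simp add: classical_points_iff)
    then have "1 * \<alpha> v \<le> ray_ratio \<alpha> \<beta> * \<alpha> v" by (intro mult_right_mono r)
    then show ?thesis using ray_ratio_le[OF \<beta>(1), of v] by simp
  qed
  have b0: "0 \<le> \<alpha> v" "0 \<le> \<beta> v" for v using \<alpha> \<beta>(1) by (auto simp: classical_points_iff)
  have sub: "support \<alpha> \<subseteq> support \<beta>"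
  proof
    fix v assume "v \<in> support \<alpha>"
    then show "v \<in> support \<beta>" using ge[of v] b0[of v] by (auto simp: support_def)
  qed
  have fb: "finite (support \<beta>)" using \<beta>(1) fin by (simp add: classical_points_iff)
  have "(\<Sum>v\<in>support \<beta>. \<alpha> v) = (\<Sum>v\<in>support \<alpha>. \<alpha> v)"
    by (rule sum.mono_neutral_right) (use sub fb in \<open>auto simp: support_def\<close>)
  also have "\<dots> = (\<Sum>v\<in>support \<beta>. \<beta> v)" using \<alpha> \<beta>(1) by (simp add: classical_points_iff)
  finally have "(\<Sum>v\<in>support \<beta>. \<beta> v - \<alpha> v) = 0" by (simp add: sum_subtractf)
  then have "\<forall>v\<in>support \<beta>. \<beta> v - \<alpha> v = 0"
    using ge sum_nonneg_eq_0_iff[OF fb, of "\<lambda>v. \<beta> v - \<alpha> v"] by simp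
  moreover have "\<beta> v = \<alpha> v" if "v \<notin> support \<beta>" for v
    using that sub by (auto simp: support_def)
  ultimately have "\<beta> = \<alpha>" by (intro ext) force
  then show False using \<beta>(2) by simp
qed

lemma ray_push_denominator:
  assumes \<beta>: "\<beta> \<in> classical_points \<Sigma>" "\<beta> \<noteq> \<alpha>" and s: "s \<in> {0..1}"
  shows "0 < 1 - s * ray_ratio \<alpha> \<beta>"
proof -
  have "s * ray_ratio \<alpha> \<beta> \<le> 1 * ray_ratio \<alpha> \<beta>"
    using s ray_ratio_nonneg[OF \<beta>(1)] by (intro mult_right_mono) auto
  then show ?thesis using ray_ratio_less_one[OF \<beta>] by simp
qed

lemma support_ray_push:
  assumes \<beta>: "\<beta> \<in> classical_points \<Sigma>"
  shows "support (ray_push \<alpha> s \<beta>) \<subseteq> support \<beta>"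
proof
  fix v assume v: "v \<in> support (ray_push \<alpha> s \<beta>)"
  show "v \<in> support \<beta>"
  proof (rule ccontr)
    assume n: "v \<notin> support \<beta>"
    then have "ray_ratio \<alpha> \<beta> * \<alpha> v = 0"
      using ray_ratio_zero[OF \<beta>] by (cases "v \<in> support \<alpha>") (auto simp: support_def)
    then show False using v n by (simp add: support_def ray_push_def mult.assoc)
  qed
qed

lemma ray_push_classical:
  assumes \<beta>: "\<beta> \<in> classical_points \<Sigma>" "\<beta> \<noteq> \<alpha>" and s: "s \<in> {0..1}"
  shows "ray_push \<alpha> s \<beta> \<in> classical_points \<Sigma>"
proof -
  let ?t = "ray_ratio \<alpha> \<beta>" and ?y = "ray_push \<alpha> s \<beta>"
  note den = ray_push_denominator[OF assms]
  have fb: "finite (support \<beta>)" and sb: "support \<beta> \<in> \<Sigma>" and b1: "(\<Sum>v\<in>support \<beta>. \<beta> v) = 1"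
    using \<beta>(1) fin by (auto simp: classical_points_iff)
  note sub = support_ray_push[OF \<beta>(1), of s]
  have nn: "0 \<le> ?y v" for v
  proof -
    have "0 \<le> ?t * \<alpha> v" using ray_ratio_nonneg[OF \<beta>(1)] \<alpha> by (simp add: classical_points_iff)
    then have "s * (?t * \<alpha> v) \<le> 1 * (?t * \<alpha> v)" using s by (intro mult_right_mono) auto
    then have "0 \<le> \<beta> v - s * ?t * \<alpha> v" using ray_ratio_le[OF \<beta>(1), of v] by (simp add: mult.assoc)
    then show ?thesis using den by (simp add: ray_push_def)
  qed
  have "?t * (\<Sum>v\<in>support \<beta>. \<alpha> v) = ?t"
  proof (cases "support \<alpha> \<subseteq> support \<beta>")
    case True
    have "(\<Sum>v\<in>support \<beta>. \<alpha> v) = (\<Sum>v\<in>support \<alpha>. \<alpha> v)"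
      by (rule sum.mono_neutral_right) (use True fb in \<open>auto simp: support_def\<close>)
    then show ?thesis using \<alpha> by (simp add: classical_points_iff)
  next
    case False then show ?thesis using ray_ratio_zero[OF \<beta>(1)] by simp
  qed
  then have "(\<Sum>v\<in>support \<beta>. \<beta> v - s * ?t * \<alpha> v) = 1 - s * ?t"
    by (simp add: sum_subtractf b1 mult.assoc flip: sum_distrib_left)
  then have sum1: "(\<Sum>v\<in>support \<beta>. ?y v) = 1"
    using den by (simp add: ray_push_def flip: sum_divide_distrib)
  have "(\<Sum>v\<in>support ?y. ?y v) = (\<Sum>v\<in>support \<beta>. ?y v)"
    by (rule sum.mono_neutral_left) (use sub fb in \<open>auto simp: support_def\<close>)
  moreover have "?y v \<le> 1" for v
  proof (cases "v \<in> support \<beta>")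
    case True
    then show ?thesis using member_le_sum[of v "support \<beta>" ?y] nn fb sum1 by simp
  next
    case False
    then have "?y v = 0" using sub by (auto simp: support_def)
    then show ?thesis by simp
  qed
  ultimately show ?thesis using nn sum1 dc[OF sb sub] by (simp add: classical_points_iff)
qed

lemma ray_push_ne:
  assumes \<beta>: "\<beta> \<in> classical_points \<Sigma>" "\<beta> \<noteq> \<alpha>" and s: "s \<in> {0..1}"
  shows "ray_push \<alpha> s \<beta> \<noteq> \<alpha>"
proof
  assume e: "ray_push \<alpha> s \<beta> = \<alpha>"
  have "\<beta> v = \<alpha> v" for v
  proof -
    have "(\<beta> v - s * ray_ratio \<alpha> \<beta> * \<alpha> v) / (1 - s * ray_ratio \<alpha> \<beta>) = \<alpha> v"
      using fun_cong[OF e, of v] by (simp add: ray_push_def)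
    then have "\<beta> v - s * ray_ratio \<alpha> \<beta> * \<alpha> v = \<alpha> v * (1 - s * ray_ratio \<alpha> \<beta>)"
      using ray_push_denominator[OF assms] by (simp add: divide_eq_eq)
    then show ?thesis by (simp add: algebra_simps)
  qed
  then show False using \<beta>(2) by (auto simp: fun_eq_iff)
qed

lemma continuous_map_ray_push:
  "continuous_map (prod_topology (top_of_set {0..1}) (subtopology (powertop_real UNIV) (classical_points \<Sigma> - {\<alpha>})))
     (powertop_real UNIV) (\<lambda>(s, \<beta>). ray_push \<alpha> s \<beta>)"
  unfolding continuous_map_componentwise_UNIV case_prod_unfold
proof
  fix v
  let ?Z = "prod_topology (top_of_set {0..1::real}) (subtopology (powertop_real UNIV) (classical_points \<Sigma> - {\<alpha>}))"
  have p1: "continuous_map ?Z euclideanreal fst"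
    by (rule continuous_map_into_fulltopology[OF continuous_map_fst])
  have "continuous_map ?Z (powertop_real UNIV) snd"
    by (rule continuous_map_into_fulltopology[OF continuous_map_snd])
  then have p2: "continuous_map ?Z euclideanreal (\<lambda>z. snd z v)" for v
    by (simp add: continuous_map_componentwise_UNIV)
  have r: "continuous_map ?Z euclideanreal (\<lambda>z. ray_ratio \<alpha> (snd z))"
    unfolding ray_ratio_def
    by (rule continuous_map_Min[OF support_alpha(1,2)])
      (auto simp: support_def intro!: continuous_map_real_divide p2)
  show "continuous_map ?Z euclideanreal (\<lambda>z. ray_push \<alpha> (fst z) (snd z) v)"
    unfolding ray_push_def
  proof (rule continuous_map_real_divide)
    show "continuous_map ?Z euclideanreal (\<lambda>z. snd z v - fst z * ray_ratio \<alpha> (snd z) * \<alpha> v)"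
      by (intro continuous_map_diff continuous_map_real_mult p1 p2 r) simp
    show "continuous_map ?Z euclideanreal (\<lambda>z. 1 - fst z * ray_ratio \<alpha> (snd z))"
      by (intro continuous_map_diff continuous_map_real_mult p1 p2 r) simp
    fix z assume "z \<in> topspace ?Z"
    then show "1 - fst z * ray_ratio \<alpha> (snd z) \<noteq> 0"
      using ray_push_denominator[of "snd z" "fst z"] by auto
  qed
qed

text \<open>Radial deformation away from \<open>\<alpha>\<close> ends in the costar and fixes the costar pointwise, because there
  the ratio is zero. The two subcomplexes agree in degree \<open>-1\<close>, as the costar contains the empty
  simplex.\<close>

lemma rel_acyclic_point_removal:
  defines "\<Delta> \<equiv> cost \<Sigma> (support \<alpha>)"
  defines "T' \<equiv> aug_singular_simplices alpha0 (add_point alpha0 (subtopology (classical_realization \<Sigma>) (classical_points \<Sigma> - {\<alpha>})))"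
  shows "rel_acyclic T' (aug_simplices \<Delta>) aug_bd" "\<And>q. aug_simplices \<Delta> q \<subseteq> T' q"
    "\<And>q. T' q \<subseteq> aug_simplices \<Sigma> q" "free_cx T' aug_bd" "\<And>q. q < -1 \<Longrightarrow> T' q = {}"
proof -
  let ?K = "classical_realization \<Sigma>"
  let ?Y = "classical_points \<Sigma> - {\<alpha>}" and ?Y' = "classical_points \<Delta>"
  let ?KY = "subtopology ?K ?Y"
  have top: "topspace ?KY = ?Y" by (auto simp: topspace_classical_realization)
  have s\<alpha>: "support \<alpha> \<in> \<Sigma>" using \<alpha> by (simp add: classical_points_iff)
  have e\<Delta>: "{} \<in> \<Delta>" using dc[OF s\<alpha>, of "{}"] support_alpha(2) by (auto simp: \<Delta>_def cost_def)
  have T': "T' q = (if q < -1 then {} else if q = -1 then {\<lambda>_. alpha0} else singular_simplex_set (nat q) ?KY)" for q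
    unfolding T'_def by (rule aug_singular_simplices_add_point) (simp add: top alpha0_not_classical)
  have T'n: "s \<in> T' (int n) \<longleftrightarrow> singular_simplex n ?KY s" for s n by (simp add: T')
  have fin\<Delta>: "finite s" if "s \<in> \<Delta>" for s using that fin by (auto simp: \<Delta>_def cost_def)
  have dc\<Delta>: "t \<in> \<Delta>" if "s \<in> \<Delta>" "t \<subseteq> s" for s t using that dc by (auto simp: \<Delta>_def cost_def)
  have Y'Y: "?Y' \<subseteq> ?Y" by (auto simp: classical_points_iff \<Delta>_def cost_def)
  have sub: "singular_simplex n (classical_realization \<Delta>) s \<longleftrightarrow> singular_simplex n ?KY s \<and> s ` standard_simplex n \<subseteq> ?Y'" for n s
  proof
    assume s: "singular_simplex n (classical_realization \<Delta>) s"
    then have im: "s ` standard_simplex n \<subseteq> ?Y'"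
      by (auto simp: singular_simplex_def continuous_map_def topspace_classical_realization Pi_iff)
    moreover have "singular_simplex n ?K s"
      by (rule singular_simplex_realization_transfer[OF s fin\<Delta> fin dc]) (use im Y'Y in auto)
    ultimately show "singular_simplex n ?KY s \<and> s ` standard_simplex n \<subseteq> ?Y'"
      using Y'Y by (auto simp: singular_simplex_subtopology)
  next
    assume s: "singular_simplex n ?KY s \<and> s ` standard_simplex n \<subseteq> ?Y'"
    then have K: "singular_simplex n ?K s" by (simp add: singular_simplex_subtopology)
    show "singular_simplex n (classical_realization \<Delta>) s"
      by (rule singular_simplex_realization_transfer[OF K fin fin\<Delta> dc\<Delta>]) (use s in auto)
  qed
  have neg: "aug_simplices \<Delta> q = T' q" if "q < 0" for q
    using that e\<Delta> by (auto simp: T' aug_simplices_eq)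
  show sub1: "aug_simplices \<Delta> q \<subseteq> T' q" for q
  proof (cases "q < 0")
    case True then show ?thesis using neg by simp
  next
    case False
    define n where "n = nat q"
    have q: "q = int n" using False by (simp add: n_def)
    show ?thesis unfolding q using sub by (simp add: subset_iff T'n aug_simplices_nat)
  qed
  show "T' q \<subseteq> aug_simplices \<Sigma> q" for q
  proof (cases "q < 0")
    case True then show ?thesis using s\<alpha> by (auto simp: T' aug_simplices_eq)
  next
    case False
    define n where "n = nat q"
    have q: "q = int n" using False by (simp add: n_def)
    show ?thesis unfolding q by (simp add: subset_iff T'n aug_simplices_nat singular_simplex_subtopology)
  qed
  show "T' q = {}" if "q < -1" for q using that by (simp add: T')
  show "free_cx T' aug_bd"
  proof (rule free_cx_singular_family[where X = ?KY])
    show "singular_face (Suc n) k s \<in> T' (int n)" if "s \<in> T' (int (Suc n))" "k \<le> Suc n" for n k s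
      using that singular_simplex_singular_face[of "Suc n" ?KY s k] by (simp add: T'n del: of_nat_Suc)
  qed (auto simp: T'n, auto simp: T')
  show "rel_acyclic T' (aug_simplices \<Delta>) aug_bd"
    unfolding rel_acyclic_def
  proof (intro allI ballI impI)
    fix q x assume x: "x \<in> frag_on (T' q)" and dx: "aug_bd q x \<in> frag_on (aug_simplices \<Delta> (q - 1))"
    show "\<exists>y\<in>frag_on (T' (q + 1)). x - aug_bd (q + 1) y \<in> frag_on (aug_simplices \<Delta> q)"
    proof (cases "q < 0")
      case True
      then show ?thesis using x neg[OF True]
        by (intro bexI[of _ 0]) (simp_all add: additive.zero[OF additive_aug_bd])
    next
      case False
      define n where "n = nat q"
      have q: "q = int n" "q + 1 = int (Suc n)" using False by (simp_all add: n_def)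
      have T'c: "c \<in> frag_on (T' (int m)) \<longleftrightarrow> singular_chain m ?KY c" for c m
        by (auto simp: frag_on_def singular_chain_def T'n subset_iff)
      have \<Delta>c: "c \<in> frag_on (aug_simplices \<Delta> (int m)) \<longleftrightarrow> singular_chain m (subtopology ?KY ?Y') c" for c m
        by (auto simp: frag_on_def singular_chain_def aug_simplices_nat sub subset_iff singular_simplex_subtopology[of m ?KY])
      have "singular_chain (n - 1) (subtopology ?KY ?Y') (chain_boundary n x)"
      proof (cases n)
        case 0 then show ?thesis by (simp add: chain_boundary_def)
      next
        case (Suc k)
        have k: "q - 1 = int k" using q Suc by simp
        have "chain_boundary (Suc k) x \<in> frag_on (aug_simplices \<Delta> (int k))"
          using dx unfolding k unfolding q(1) Suc aug_bd_Suc .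
        then show ?thesis unfolding Suc \<Delta>c by simp
      qed
      moreover have "singular_chain n ?KY x" using x unfolding q T'c .
      ultimately have "singular_relcycle n ?KY ?Y' x" by (simp add: singular_relcycle)
      then have "singular_relboundary n ?KY ?Y' x"
      proof (rule realization_deformation_relboundary[OF fin dc _ continuous_map_ray_push _ _ _ _ finite.emptyI, rotated -1])
        show "?Y \<subseteq> classical_points \<Sigma>" by blast
        fix \<beta> assume \<beta>: "\<beta> \<in> ?Y"
        show "ray_push \<alpha> s \<beta> \<in> ?Y" if "s \<in> {0..1}" for s
          using ray_push_classical[of \<beta> s] ray_push_ne[of \<beta> s] \<beta> that by blast
        show "ray_push \<alpha> 0 \<beta> = \<beta>" by (simp add: ray_push_def)
        show "support (ray_push \<alpha> s \<beta>) \<subseteq> support \<beta> \<union> {}" for s using support_ray_push \<beta> by auto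
        obtain v where v: "v \<in> support \<alpha>" "ray_ratio \<alpha> \<beta> * \<alpha> v = \<beta> v" using ray_ratio_attained by blast
        then have "v \<notin> support (ray_push \<alpha> 1 \<beta>)" by (simp add: support_def ray_push_def)
        then have "\<not> support \<alpha> \<subseteq> support (ray_push \<alpha> 1 \<beta>)" using v(1) by blast
        moreover have "ray_push \<alpha> 1 \<beta> \<in> classical_points \<Sigma>" using ray_push_classical[of \<beta> 1] \<beta> by simp
        ultimately show "ray_push \<alpha> 1 \<beta> \<in> ?Y'" by (simp add: classical_points_iff \<Delta>_def cost_def)
      next
        fix \<beta> s assume \<beta>: "\<beta> \<in> ?Y'"
        then have "ray_ratio \<alpha> \<beta> = 0"
          by (intro ray_ratio_zero) (auto simp: classical_points_iff \<Delta>_def cost_def)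
        then have "ray_push \<alpha> s \<beta> = \<beta>" by (simp add: ray_push_def)
        then show "ray_push \<alpha> s \<beta> \<in> ?Y'" using \<beta> by simp
      qed
      then obtain d e where d: "singular_chain (Suc n) ?KY d" and e: "singular_chain n (subtopology ?KY ?Y') e"
        and de: "chain_boundary (Suc n) d + e = x"
        unfolding singular_relboundary by blast
      have "x - aug_bd (q + 1) d = e" unfolding q(2) aug_bd_Suc using de by (simp add: algebra_simps)
      then show ?thesis using d e unfolding q(2) T'c[symmetric] unfolding q(1) \<Delta>c[symmetric] by (metis q(2))
    qed
  qed
qed

end

text \<open>For the empty simplex both pairs are literally equal; otherwise only the subcomplex is enlarged.\<close>

theorem point_removal_equivalence:
  assumes dc: "down_closed \<Sigma>" and fin: "\<And>s. s \<in> \<Sigma> \<Longrightarrow> finite s" and \<sigma>: "\<sigma> \<in> \<Sigma>" and \<alpha>: "\<alpha> \<in> Int_simplex \<Sigma> \<sigma>"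
  shows "\<exists>f. chain_equivalence
      (aug_singular_pair alpha0 (realization \<Sigma>) (realization (cost \<Sigma> \<sigma>)))
      (aug_singular_pair alpha0 (realization \<Sigma>) (point_removal alpha0 (realization \<Sigma>) \<alpha>)) f"
    and "is_complex (aug_singular_pair alpha0 (realization \<Sigma>) (point_removal alpha0 (realization \<Sigma>) \<alpha>))"
proof -
  have pair: "aug_singular_pair alpha0 X1 X2 =
      pair_cx (aug_singular_simplices alpha0 X1) (aug_singular_simplices alpha0 X2) aug_bd" for X1 X2 :: "('a \<Rightarrow> real) topology"
    by (simp add: aug_singular_pair_def aug_singular_chains_def)
  have dc': "t \<in> \<Sigma>" if "s \<in> \<Sigma>" "t \<subseteq> s" for s t using dc that by (auto simp: down_closed_def)
  have cs: "aug_simplices (cost \<Sigma> \<sigma>) q \<subseteq> aug_simplices \<Sigma> q" for q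
    by (rule aug_simplices_mono[OF dc down_closed_cost[OF dc] fin cost_subset])
  have ic: "is_complex (aug_singular_pair alpha0 (realization \<Sigma>) (realization (cost \<Sigma> \<sigma>)))"
    unfolding pair by (rule is_complex_pair[OF free_cx_aug free_cx_aug cs])
  have "(\<exists>f. chain_equivalence
      (aug_singular_pair alpha0 (realization \<Sigma>) (realization (cost \<Sigma> \<sigma>)))
      (aug_singular_pair alpha0 (realization \<Sigma>) (point_removal alpha0 (realization \<Sigma>) \<alpha>)) f) \<and>
      is_complex (aug_singular_pair alpha0 (realization \<Sigma>) (point_removal alpha0 (realization \<Sigma>) \<alpha>))"
  proof (cases "\<sigma> = {}")
    case True
    then have "\<alpha> = alpha0" using Int_simplex_alpha0[OF \<alpha>] by simp
    then have "point_removal alpha0 (realization \<Sigma>) \<alpha> = realization (cost \<Sigma> \<sigma>)"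
      using True by (simp add: point_removal_def realization_def cost_def)
    then show ?thesis using ic chain_equivalence_refl[OF ic] by auto
  next
    case False
    then have \<alpha>0: "\<alpha> \<noteq> alpha0" using Int_simplex_alpha0[OF \<alpha>] by simp
    have ne: "\<Sigma> \<noteq> {}" using \<sigma> by blast
    have ac: "\<alpha> \<in> classical_points \<Sigma>" using \<alpha> \<alpha>0 ne by (auto simp: Int_simplex_def topspace_realization)
    have sa: "support \<alpha> = \<sigma>" using \<alpha> by (auto simp: Int_simplex_def support_def)
    have "forget_point alpha0 (realization \<Sigma>) = classical_realization \<Sigma>"
      using ne by (simp add: realization_def forget_add_point topspace_classical_realization alpha0_not_classical)
    then have pr: "point_removal alpha0 (realization \<Sigma>) \<alpha> =
        add_point alpha0 (subtopology (classical_realization \<Sigma>) (classical_points \<Sigma> - {\<alpha>}))"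
      using \<alpha>0 by (simp add: point_removal_def topspace_classical_realization)
    let ?T = "aug_singular_simplices alpha0 (point_removal alpha0 (realization \<Sigma>) \<alpha>)"
    note R = rel_acyclic_point_removal[where \<Sigma> = \<Sigma> and \<alpha> = \<alpha>, unfolded sa, folded pr]
    have R1: "rel_acyclic ?T (aug_simplices (cost \<Sigma> \<sigma>)) aug_bd"
      by (rule R(1)) (use dc' fin ac in blast)+
    have R2: "aug_simplices (cost \<Sigma> \<sigma>) q \<subseteq> ?T q" for q
      by (rule R(2)) (use dc' fin ac in blast)+
    have R3: "?T q \<subseteq> aug_simplices \<Sigma> q" for q
      by (rule R(3)) (use dc' fin ac in blast)+
    have R4: "free_cx ?T aug_bd"
      by (rule R(4)) (use dc' fin ac in blast)+
    have R5: "?T q = {}" if "q < -1" for q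
      by (rule R(5)[OF _ _ _ that]) (use dc' fin ac in blast)+
    show ?thesis
      unfolding pair
      using acyclic_quotient_equivalence[OF free_cx_aug R4 free_cx_aug R3 R2 R5 R1]
        is_complex_pair[OF free_cx_aug R4 R3] by blast
  qed
  then show "\<exists>f. chain_equivalence
      (aug_singular_pair alpha0 (realization \<Sigma>) (realization (cost \<Sigma> \<sigma>)))
      (aug_singular_pair alpha0 (realization \<Sigma>) (point_removal alpha0 (realization \<Sigma>) \<alpha>)) f"
    "is_complex (aug_singular_pair alpha0 (realization \<Sigma>) (point_removal alpha0 (realization \<Sigma>) \<alpha>))"
    by blast+
qed

section \<open>The isomorphisms\<close>

lemma homology_shift: "homology (shift n C) G i = homology C G (i - n)"
proof -
  have e: "i - 1 - n = i - n - 1" "i + 1 - n = i - n + 1" by simp_all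
  show ?thesis
    by (simp only: homology_def cycles_def boundaries_def shift_def ab_complex.simps e)
qed

lemma cohomology_shift: "cohomology (shift n C) G i = cohomology C G (i - n)"
proof -
  have e: "i - 1 - n = i - n - 1" "i + 1 - n = i - n + 1" by simp_all
  show ?thesis
    by (simp only: cohomology_def cocycles_def coboundaries_def shift_def ab_complex.simps e)
qed

theorem proposition4p10:
  fixes A :: "'a ring" and G :: "('a, 'g) module"
    and V :: "'v set" and \<Sigma> :: "'v set set" and \<sigma> :: "'v set" and \<alpha> :: "'v \<Rightarrow> real"
  assumes "module A G"
    and "simplicial_complex V \<Sigma>"
    and "\<sigma> \<in> \<Sigma>"
    and "\<alpha> \<in> Int_simplex \<Sigma> \<sigma>"
  shows "\<exists>f1 f2 f3.
    chain_equivalence (shift (int (card \<sigma>)) (simplicial_pair (link \<Sigma> \<sigma>) {}))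
      (simplicial_pair \<Sigma> (cost \<Sigma> \<sigma>)) f1 \<and>
    chain_equivalence (simplicial_pair \<Sigma> (cost \<Sigma> \<sigma>))
      (aug_singular_pair alpha0 (realization \<Sigma>) (realization (cost \<Sigma> \<sigma>))) f2 \<and>
    chain_equivalence
      (aug_singular_pair alpha0 (realization \<Sigma>) (realization (cost \<Sigma> \<sigma>)))
      (aug_singular_pair alpha0 (realization \<Sigma>) (point_removal alpha0 (realization \<Sigma>) \<alpha>)) f3 \<and>
    (\<forall>i.
      homology_map (simplicial_pair \<Sigma> (cost \<Sigma> \<sigma>)) G f1 i
        \<in> module_iso A (simplicial_homology (i - int (card \<sigma>)) (link \<Sigma> \<sigma>) {} G)
                       (simplicial_homology i \<Sigma> (cost \<Sigma> \<sigma>) G) \<and>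
      homology_map (aug_singular_pair alpha0 (realization \<Sigma>) (realization (cost \<Sigma> \<sigma>))) G f2 i
        \<in> module_iso A (simplicial_homology i \<Sigma> (cost \<Sigma> \<sigma>) G)
             (singular_homology i alpha0 (realization \<Sigma>) (realization (cost \<Sigma> \<sigma>)) G) \<and>
      homology_map
        (aug_singular_pair alpha0 (realization \<Sigma>) (point_removal alpha0 (realization \<Sigma>) \<alpha>)) G f3 i
        \<in> module_iso A
             (singular_homology i alpha0 (realization \<Sigma>) (realization (cost \<Sigma> \<sigma>)) G)
             (singular_homology i alpha0 (realization \<Sigma>)
                (point_removal alpha0 (realization \<Sigma>) \<alpha>) G) \<and>
      cohomology_map (shift (int (card \<sigma>)) (simplicial_pair (link \<Sigma> \<sigma>) {})) G f1 i
        \<in> module_iso A (simplicial_cohomology i \<Sigma> (cost \<Sigma> \<sigma>) G)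
                       (simplicial_cohomology (i - int (card \<sigma>)) (link \<Sigma> \<sigma>) {} G) \<and>
      cohomology_map (simplicial_pair \<Sigma> (cost \<Sigma> \<sigma>)) G f2 i
        \<in> module_iso A
             (singular_cohomology i alpha0 (realization \<Sigma>) (realization (cost \<Sigma> \<sigma>)) G)
             (simplicial_cohomology i \<Sigma> (cost \<Sigma> \<sigma>) G) \<and>
      cohomology_map
        (aug_singular_pair alpha0 (realization \<Sigma>) (realization (cost \<Sigma> \<sigma>))) G f3 i
        \<in> module_iso A
             (singular_cohomology i alpha0 (realization \<Sigma>)
                (point_removal alpha0 (realization \<Sigma>) \<alpha>) G)
             (singular_cohomology i alpha0 (realization \<Sigma>) (realization (cost \<Sigma> \<sigma>)) G))"
proof -
  have dc: "down_closed \<Sigma>" and fin: "\<And>s. s \<in> \<Sigma> \<Longrightarrow> finite s"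
    using assms(2) by (auto simp: simplicial_complex_def down_closed_def)
  let ?L = "shift (int (card \<sigma>)) (simplicial_pair (link \<Sigma> \<sigma>) {})"
  let ?C = "simplicial_pair \<Sigma> (cost \<Sigma> \<sigma>)"
  let ?S = "aug_singular_pair alpha0 (realization \<Sigma>) (realization (cost \<Sigma> \<sigma>))"
  let ?R = "aug_singular_pair alpha0 (realization \<Sigma>) (point_removal alpha0 (realization \<Sigma>) \<alpha>)"
  have S: "?S = pair_cx (aug_simplices \<Sigma>) (aug_simplices (cost \<Sigma> \<sigma>)) aug_bd"
    by (simp add: aug_singular_pair_def aug_singular_chains_def)
  have cL: "is_complex ?L"
    by (intro is_complex_shift is_complex_simplicial_pair down_closed_link dc) (auto simp: down_closed_def)
  have cC: "is_complex ?C"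
    by (intro is_complex_simplicial_pair dc down_closed_cost cost_subset)
  have cS: "is_complex ?S"
    unfolding S by (rule is_complex_pair[OF free_cx_aug free_cx_aug aug_simplices_mono[OF dc down_closed_cost[OF dc] fin cost_subset]])
  have cR: "is_complex ?R"
    by (rule point_removal_equivalence(2)[OF dc fin assms(3,4)])
  obtain f1 where f1: "chain_equivalence ?L ?C f1"
    using link_equivalence[OF fin[OF assms(3)] dc] by blast
  obtain f2 where f2: "chain_equivalence ?C ?S f2"
    using simplicial_singular_equivalence[OF dc down_closed_cost[OF dc] fin cost_subset] unfolding S by blast
  obtain f3 where f3: "chain_equivalence ?S ?R f3"
    using point_removal_equivalence(1)[OF dc fin assms(3,4)] by blast
  note H = chain_equivalence_homology[OF assms(1)] and CH = chain_equivalence_cohomology[OF assms(1)]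
  show ?thesis
    using f1 f2 f3 H[OF cL cC f1] H[OF cC cS f2] H[OF cS cR f3] CH[OF cL cC f1] CH[OF cC cS f2] CH[OF cS cR f3]
    unfolding homology_shift cohomology_shift by blast
qed

end
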